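(* Let $\lambda_c:=\frac\pi2$. There are universal constants $0<\delta<1<K$ and $0<c<C$ such that for all $(\varepsilon,\lambda)$ with $$0<\varepsilon<K^{-\frac{\lambda}{\lambda-\lambda_c}}\qquad\text{and}\qquad\lambda_c<\lambda<\delta|\log\varepsilon|$$ the minimal energy satisfies $$-C\,\frac{\lambda\,\varepsilon^{\frac{\lambda_c-\lambda}{\lambda}}}{|\log\varepsilon|}\le\min F_{\varepsilon,\lambda}\le-c\,\frac{\lambda\,\varepsilon^{\frac{\lambda_c-\lambda}{\lambda}}}{|\log\varepsilon|}.$$ Moreover, for any $\gamma>0$ there are positive constants $c_\gamma,C_\gamma,\tilde C_\gamma$ depending only on $\gamma$ such that for all such $(\varepsilon,\lambda)$ and all $m\in H^1(\mathbb T^2;\mathbb S^2)$ with $$F_{\varepsilon,\lambda}[m]\le-\gamma\,\frac{\lambda\,\varepsilon^{\frac{\lambda_c-\lambda}{\lambda}}}{|\log\varepsilon|}$$ one has $$\int_{\mathbb T^2}|\nabla m_3|\,dx\le\int_{\mathbb T^2}\Big(\frac\varepsilon2|\nabla m|^2+\frac{1-m_3^2}{2\varepsilon}\Big)dx\le\frac{\lambda}{|\log\varepsilon|}\int_{\mathbb T^2}|\nabla^{1/2}m_3|^2dx,$$ and if $A$ and $B$ are any of these three quantities, then $$c_\gamma\,\varepsilon^{\frac{\lambda_c-\lambda}{\lambda}}\le A\le C_\gamma\,\varepsilon^{\frac{\lambda_c-\lambda}{\lambda}}\qquad\text{and}\qquad|A-B|\le\tilde C_\gamma\,\frac{\lam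bda}{|\log\varepsilon|}\,A.$$
   Context: $\mathbb T^2=\mathbb R^2/\mathbb Z^2$ is the unit flat torus, $\mathbb S^2\subset\mathbb R^3$ the unit sphere. For a function $u$ on $\mathbb T^2$ put $\widehat u_k=\int_{\mathbb T^2}e^{-ik\cdot x}u(x)\,dx$, $k\in2\pi\mathbb Z^2$, and $\int_{\mathbb T^2}|\nabla^{1/2}u|^2dx:=\sum_{k\in2\pi\mathbb Z^2}|k||\widehat u_k|^2$. For $0<\varepsilon<1$ the functional $F_{\varepsilon,\lambda}:L^1(\mathbb T^2;\mathbb S^2)\to\mathbb R\cup\{+\infty\}$ is $$F_{\varepsilon,\lambda}[m]=\int_{\mathbb T^2}\Big(\frac\varepsilon2|\nabla m|^2+\frac1{2\varepsilon}(1-m_3^2)\Big)dx-\frac{\lambda}{|\log\varepsilon|}\int_{\mathbb T^2}|\nabla^{1/2}m_3|^2dx$$ if $m\in H^1(\mathbb T^2;\mathbb S^2)$ and $+\infty$ otherwise. *)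

theory Defs
  imports "HOL-Analysis.Analysis"
begin

text \<open>
  A function on the torus \<open>\<real>\<^sup>2 / \<int>\<^sup>2\<close> is represented by a \<open>\<int>\<^sup>2\<close>-periodic Borel function on \<open>\<real>\<^sup>2\<close>,
  and integrals over the torus are Lebesgue integrals over a fundamental cell. All notions below
  depend only on the almost-everywhere class of such a representative.
\<close>

definition torus_periodic :: "(real^2 \<Rightarrow> 'a) \<Rightarrow> bool" where
  "torus_periodic u \<longleftrightarrow> (\<forall>x i. u (x + axis i 1) = u x)"

definition unit_cell :: "(real^2) set" where
  "unit_cell = cbox 0 (\<chi> i. 1)"

definition torus_integral :: "(real^2 \<Rightarrow> 'a :: {banach, second_countable_topology}) \<Rightarrow> 'a" where
  "torus_integral f = (LINT x:unit_cell|lborel. f x)"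

definition torus_integrable :: "(real^2 \<Rightarrow> 'a :: {banach, second_countable_topology}) \<Rightarrow> bool" where
  "torus_integrable f \<longleftrightarrow> set_integrable lborel unit_cell f"

definition L1_torus_sphere :: "(real^2 \<Rightarrow> real^3) set" where
  "L1_torus_sphere =
     {m. torus_periodic m \<and> m \<in> borel_measurable borel \<and> torus_integrable m \<and>
         (AE x in lborel. norm (m x) = 1)}"

text \<open>
  \<open>\<phi>\<close> is of class \<open>C\<^sup>\<infinity>\<close>: the function \<open>D a b\<close> is the mixed partial derivative of \<open>\<phi>\<close> of order \<open>a\<close>
  in the first and \<open>b\<close> in the second variable.
\<close>

definition smooth_plane :: "(real^2 \<Rightarrow> real) \<Rightarrow> bool" where
  "smooth_plane \<phi> \<longleftrightarrow>
     (\<exists>D :: nat \<Rightarrow> nat \<Rightarrow> real^2 \<Rightarrow> real. D 0 0 = \<phi> \<and>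
        (\<forall>a b x. (D a b has_derivative
                   (\<lambda>h. D (Suc a) b x * h $ 1 + D a (Suc b) x * h $ 2)) (at x)))"

definition torus_test_function :: "(real^2 \<Rightarrow> real) \<Rightarrow> bool" where
  "torus_test_function \<phi> \<longleftrightarrow> torus_periodic \<phi> \<and> smooth_plane \<phi>"

definition L2_torus :: "(real^2 \<Rightarrow> 'a :: euclidean_space) set" where
  "L2_torus =
     {u. torus_periodic u \<and> u \<in> borel_measurable borel \<and> torus_integrable (\<lambda>x. (norm (u x))\<^sup>2)}"

definition is_weak_gradient :: "(real^2 \<Rightarrow> real) \<Rightarrow> (real^2 \<Rightarrow> real^2) \<Rightarrow> bool" where
  "is_weak_gradient u g \<longleftrightarrow>
     g \<in> L2_torus \<and>
     (\<forall>\<phi> i. torus_test_function \<phi> \<longrightarrow>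
        torus_integral (\<lambda>x. u x * frechet_derivative \<phi> (at x) (axis i 1)) =
        - torus_integral (\<lambda>x. g x $ i * \<phi> x))"

definition H1_torus :: "(real^2 \<Rightarrow> real) set" where
  "H1_torus = {u \<in> L2_torus. \<exists>g. is_weak_gradient u g}"

text \<open>The weak gradient is unique up to null sets, so the choice made here is immaterial.\<close>

definition weak_gradient :: "(real^2 \<Rightarrow> real) \<Rightarrow> real^2 \<Rightarrow> real^2" where
  "weak_gradient u = (SOME g. is_weak_gradient u g)"

definition H1_torus_sphere :: "(real^2 \<Rightarrow> real^3) set" where
  "H1_torus_sphere = {m \<in> L1_torus_sphere. \<forall>j. (\<lambda>x. m x $ j) \<in> H1_torus}"

definition dual_lattice :: "(real^2) set" where
  "dual_lattice = {k. \<forall>i. \<exists>n :: int. k $ i = 2 * pi * of_int n}"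

definition fourier_coeff :: "(real^2 \<Rightarrow> real) \<Rightarrow> real^2 \<Rightarrow> complex" where
  "fourier_coeff u k =
     torus_integral (\<lambda>x. exp (- (\<i> * complex_of_real (k \<bullet> x))) * complex_of_real (u x))"

text \<open>
  The squared \<open>H\<^sup>1\<^sup>/\<^sup>2\<close> seminorm. It is used only for \<open>u \<in> H1_torus\<close>, where the series
  converges; a divergent series would get the value \<open>0\<close> under \<^const>\<open>infsum\<close>.
\<close>

definition half_gradient_energy :: "(real^2 \<Rightarrow> real) \<Rightarrow> real" where
  "half_gradient_energy u = (\<Sum>\<^sub>\<infinity>k\<in>dual_lattice. norm k * (cmod (fourier_coeff u k))\<^sup>2)"

definition local_energy :: "real \<Rightarrow> (real^2 \<Rightarrow> real^3) \<Rightarrow> real" where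
  "local_energy \<epsilon> m =
     torus_integral (\<lambda>x. \<epsilon> / 2 * (\<Sum>j\<in>UNIV. (norm (weak_gradient (\<lambda>y. m y $ j) x))\<^sup>2)
                         + 1 / (2 * \<epsilon>) * (1 - (m x $ 3)\<^sup>2))"

definition nonlocal_energy :: "real \<Rightarrow> real \<Rightarrow> (real^2 \<Rightarrow> real^3) \<Rightarrow> real" where
  "nonlocal_energy \<epsilon> l m = l / \<bar>ln \<epsilon>\<bar> * half_gradient_energy (\<lambda>x. m x $ 3)"

definition total_variation_m3 :: "(real^2 \<Rightarrow> real^3) \<Rightarrow> real" where
  "total_variation_m3 m = torus_integral (\<lambda>x. norm (weak_gradient (\<lambda>y. m y $ 3) x))"

definition F_energy :: "real \<Rightarrow> real \<Rightarrow> (real^2 \<Rightarrow> real^3) \<Rightarrow> ereal" where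
  "F_energy \<epsilon> l m =
     (if m \<in> H1_torus_sphere then ereal (local_energy \<epsilon> m - nonlocal_energy \<epsilon> l m) else \<infinity>)"

definition lambda_c :: real where
  "lambda_c = pi / 2"

definition regime :: "real \<Rightarrow> real \<Rightarrow> real \<Rightarrow> real \<Rightarrow> bool" where
  "regime \<delta> K \<epsilon> l \<longleftrightarrow>
     0 < \<epsilon> \<and> \<epsilon> < K powr (- (l / (l - lambda_c))) \<and> lambda_c < l \<and> l < \<delta> * \<bar>ln \<epsilon>\<bar>"

definition perimeter_scale :: "real \<Rightarrow> real \<Rightarrow> real" where
  "perimeter_scale \<epsilon> l = \<epsilon> powr ((lambda_c - l) / l)"

definition energy_scale :: "real \<Rightarrow> real \<Rightarrow> real" where
  "energy_scale \<epsilon> l = l * perimeter_scale \<epsilon> l / \<bar>ln \<epsilon>\<bar>"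

end

theory Submission
  imports Defs "HOL-Complex_Analysis.Great_Picard" "HOL-Probability.Sinc_Integral"
begin

text \<open>
  For a unit vector \<open>e\<close> one has \<open>\<pi> \<bar>k \<bullet> e\<bar> = \<integral>\<^sub>0 \<bar>exp (i t k \<bullet> e) - 1\<bar>\<^sup>2 / t\<^sup>2 dt\<close>, so that Bessel's inequality
  for \<open>u (x + t e) - u x\<close> controls \<open>\<Sum>\<^sub>k \<bar>k \<bullet> e\<bar> \<bar>u\<^sub>k\<bar>\<^sup>2\<close> by the integral of \<open>\<parallel>u (x + t e) - u x\<parallel>\<^sup>2 / t\<^sup>2\<close>. If \<open>\<bar>u\<bar> \<le> 1\<close>, the
  squared norm is at most \<open>t\<^sup>2 \<integral> \<bar>\<nabla>u\<bar>\<^sup>2\<close>, \<open>2 t \<integral> \<bar>e \<bullet> \<nabla>u\<bar>\<close> and \<open>4\<close>. Using these bounds for \<open>t < r\<close>,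
  \<open>r < t < R\<close> and \<open>t > R\<close> and averaging over \<open>e\<close> bounds the squared \<open>H\<^sup>1\<^sup>/\<^sup>2\<close> seminorm by
  \<open>r / 2 \<integral> \<bar>\<nabla>u\<bar>\<^sup>2 + (2 / \<pi>) ln (R / r) \<integral> \<bar>\<nabla>u\<bar> + 2 / R\<close>, with the sharp factor \<open>2 / \<pi> = 1 / \<lambda>\<^sub>c\<close>.

  Take \<open>u = m\<^sub>3\<close>, \<open>r = \<epsilon>\<close> and \<open>R = exp (- b) / S\<close>, where \<open>S\<close> is the perimeter scale. The logarithmic term
  then cancels the total variation up to a multiple of \<open>b \<lambda> / \<bar>ln \<epsilon>\<bar>\<close>. A positive \<open>b\<close> makes the energy
  coercive, which gives its lower bound and the upper bounds on the three quantities; a negative \<open>b\<close>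
  gives the lower bounds. The total variation is below the local energy because \<open>m \<bullet> \<partial>\<^sub>i m = 0\<close>. Minimizers
  exist by the direct method, and stripes \<open>m\<^sub>3 = tanh (A sin (2 \<pi> N x\<^sub>1))\<close> with \<open>2 \<pi> N A = 1 / \<epsilon>\<close> and \<open>N\<close> a small
  multiple of \<open>S\<close> have sufficiently negative energy.
\<close>

text \<open>The critical value comes from an average: |cos| has mean 2/\<pi> on the circle, so total
  variation P yields half-gradient energy at most (2/\<pi>) P times a logarithm of two cutoffs.
  Multiplied by \<lambda>/|ln \<epsilon>| this equals P exactly when the logarithm is
  \<open>lambda_c\<close> |ln \<epsilon>| / \<lambda>. With lower cutoff \<epsilon> the upper one
  must be the inverse of the perimeter scale S, and a factor exp (- b) is the only freedom left. Two
  obstacles shape the rest. The \<open>infsum\<close> in \<open>half_gradient_energy\<close> is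
  meaningful only for summable series, so the estimate is made for finite sets of frequencies and
  gives summability as a by-product. And weak gradients are known only through test functions, so
  they are moved to Fourier coefficients: trigonometric polynomials take the place of mollification.
  The condition with K says that S exceeds K, so that at least one stripe fits. The bound on
  \<lambda>/|ln \<epsilon>| keeps the nonlocal term from swallowing the local energy and makes walls
  thin against their distance.\<close>

definition torus_measure :: "(real^2) measure" where
  "torus_measure = restrict_space lborel unit_cell"

abbreviation tint :: "(real^2 \<Rightarrow> 'a::{banach, second_countable_topology}) \<Rightarrow> 'a" where
  "tint f \<equiv> integral\<^sup>L torus_measure f"

lemma unit_cell_sets [measurable, simp]: "unit_cell \<in> sets borel"
  by (simp add: unit_cell_def)

lemma space_torus_measure [simp]: "space torus_measure = unit_cell"
  by (simp add: torus_measure_def space_restrict_space)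

lemma torus_integral_eq: "torus_integral f = tint f"
  by (simp add: torus_integral_def torus_measure_def integral_restrict_space set_lebesgue_integral_def)

lemma torus_integrable_eq: "torus_integrable f \<longleftrightarrow> integrable torus_measure f"
  by (simp add: torus_integrable_def torus_measure_def integrable_restrict_space set_integrable_def)

lemma borel_measurable_torus_measure [intro]:
  "f \<in> borel_measurable borel \<Longrightarrow> f \<in> borel_measurable torus_measure"
  unfolding torus_measure_def by (rule measurable_restrict_space1) simp

lemma measurable_ident_torus [measurable, simp]: "(\<lambda>x. x) \<in> measurable torus_measure borel"
  unfolding torus_measure_def by (rule measurable_restrict_space1) simp

lemma emeasure_unit_cell: "emeasure lborel unit_cell = 1"
proof -
  have ne: "unit_cell \<noteq> {}"
    by (simp add: unit_cell_def interval_ne_empty_cart)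
  then have "measure lborel unit_cell = 1"
    unfolding unit_cell_def by (subst content_cbox_cart) auto
  moreover have "emeasure lborel unit_cell \<noteq> \<infinity>"
    unfolding unit_cell_def using emeasure_lborel_cbox_finite less_irrefl by metis
  ultimately show ?thesis
    by (simp add: emeasure_eq_ennreal_measure)
qed

interpretation torus: prob_space torus_measure
proof
  show "emeasure torus_measure (space torus_measure) = 1"
    unfolding space_torus_measure
    by (simp add: torus_measure_def emeasure_restrict_space emeasure_unit_cell)
qed

subsection \<open>Periodicity and translation\<close>

text \<open>The closed \<open>unit_cell\<close> counts boundary points of the torus repeatedly. The
  half-open cell meets each lattice orbit exactly once and differs from \<open>unit_cell\<close>
  only by a null set.\<close>

definition half_open_cell :: "(real^2) set" where
  "half_open_cell = {x. \<forall>i. 0 \<le> x $ i \<and> x $ i < 1}"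

definition integer_lattice :: "(real^2) set" where
  "integer_lattice = range (\<lambda>n::int^2. \<chi> i. of_int (n $ i))"

lemma countable_integer_lattice: "countable integer_lattice"
  unfolding integer_lattice_def by blast

lemma half_open_cell_sets [measurable, simp]: "half_open_cell \<in> sets borel"
  unfolding half_open_cell_def by measurable

lemma periodic_axis_int:
  assumes "torus_periodic f"
  shows "f (x + axis i (of_int n)) = f x"
proof -
  have nat: "f (x + axis i (of_nat n)) = f x" for n :: nat and x
  proof (induction n)
    case 0
    have "x + axis i (of_nat 0) = x" by (simp add: axis_def vec_eq_iff)
    then show ?case by metis
  next
    case (Suc n)
    have "x + axis i (real (Suc n)) = (x + axis i (real n)) + axis i 1"
      by (simp add: vec_eq_iff axis_def)
    then show ?case using Suc assms unfolding torus_periodic_def by metis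
  qed
  show ?thesis
  proof (cases "n \<ge> 0")
    case True
    then show ?thesis using nat[of x "nat n"] by simp
  next
    case False
    have "(x + axis i (of_int n)) + axis i (of_nat (nat (- n))) = x"
      using False by (simp add: vec_eq_iff axis_def)
    then show ?thesis using nat[of "x + axis i (of_int n)" "nat (- n)"] by metis
  qed
qed

lemma periodic_lattice:
  assumes "torus_periodic f" "n \<in> integer_lattice"
  shows "f (x + n) = f x" "f (x - n) = f x"
proof -
  have *: "f (x + (\<chi> i. of_int (n $ i))) = f x" for x and n :: "int^2"
  proof -
    have "x + (\<chi> i. of_int (n $ i)) = (x + axis 1 (of_int (n $ 1))) + axis 2 (of_int (n $ 2))"
      by (simp add: vec_eq_iff axis_def forall_2)
    then show ?thesis using periodic_axis_int[OF assms(1)] by metis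
  qed
  show "f (x + n) = f x" "f (x - n) = f x"
    using *[of x] *[of "x - n"] assms(2) unfolding integer_lattice_def
    by (auto simp del: diff_add_cancel) (metis diff_add_cancel)
qed

definition wrap :: "real^2 \<Rightarrow> real^2" where
  "wrap x = (\<chi> i. frac (x $ i))"

lemma wrap_measurable [measurable]: "wrap \<in> borel_measurable borel"
proof -
  have "(\<lambda>x::real. frac x) \<in> borel_measurable borel"
    unfolding frac_def by measurable
  then have [measurable]: "(\<lambda>x::real^2. frac (x $ i)) \<in> borel_measurable borel" for i
    by (rule measurable_compose[rotated]) measurable
  have "wrap = (\<lambda>x. \<Sum>i\<in>UNIV. frac (x $ i) *\<^sub>R axis i 1)"
    by (simp add: wrap_def fun_eq_iff vec_eq_iff axis_def sum_2 forall_2)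
  then show ?thesis
    by (rule ssubst) measurable
qed

lemma wrap_in_cell: "wrap x \<in> half_open_cell"
  by (simp add: wrap_def half_open_cell_def frac_lt_1)

lemma wrap_diff: "x - wrap x \<in> integer_lattice"
  unfolding integer_lattice_def
  by (rule range_eqI[of _ _ "\<chi> i. \<lfloor>x $ i\<rfloor>"]) (simp add: wrap_def frac_def vec_eq_iff)

lemma periodic_wrap:
  assumes "torus_periodic f"
  shows "f (wrap x) = f x"
  using periodic_lattice(2)[OF assms wrap_diff, of x x] by simp

lemma AE_unit_cell_half_open: "AE x in lborel. x \<in> unit_cell \<longleftrightarrow> x \<in> half_open_cell"
proof -
  have "{x::real^2. x $ i = 1} \<in> null_sets lborel" for i
  proof -
    have "{x::real^2. x $ i = 1} \<in> null_sets lebesgue"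
      using negligible_standard_hyperplane[of "axis i 1 :: real^2" 1]
      by (simp add: negligible_iff_null_sets inner_axis axis_in_Basis_iff)
    moreover have "{x::real^2. x $ i = 1} \<in> sets lborel" by measurable
    ultimately show ?thesis by (simp add: null_sets_completion_iff)
  qed
  then have "AE x in lborel. x \<notin> {x::real^2. x $ i = 1}" for i
    by (rule AE_not_in)
  then have "AE x in lborel. \<forall>i. x \<notin> {x::real^2. x $ i = 1}"
    by (simp add: forall_2)
  then show ?thesis
    by eventually_elim (auto simp: unit_cell_def mem_box_cart half_open_cell_def less_le)
qed

lemma AE_torus_half_open: "AE x in torus_measure. x \<in> half_open_cell"
  unfolding torus_measure_def by (subst AE_restrict_space_iff) (use AE_unit_cell_half_open in \<open>auto elim: eventually_mono\<close>)

lemma nn_integral_torus: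
  "nn_integral torus_measure f = (\<integral>\<^sup>+x. f x * indicator half_open_cell x \<partial>lborel)"
proof -
  have "nn_integral torus_measure f = (\<integral>\<^sup>+x. f x * indicator unit_cell x \<partial>lborel)"
    unfolding torus_measure_def by (subst nn_integral_restrict_space) auto
  also have "\<dots> = (\<integral>\<^sup>+x. f x * indicator half_open_cell x \<partial>lborel)"
    by (rule nn_integral_cong_AE) (use AE_unit_cell_half_open in \<open>auto elim!: eventually_mono simp: indicator_def\<close>)
  finally show ?thesis .
qed

lemma nn_integral_lborel_shift:
  fixes f :: "real^2 \<Rightarrow> ennreal"
  assumes [measurable]: "f \<in> borel_measurable borel"
  shows "(\<integral>\<^sup>+x. f (x + c) \<partial>lborel) = (\<integral>\<^sup>+x. f x \<partial>lborel)"
proof -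
  have "(\<integral>\<^sup>+x. f x \<partial>lborel) = (\<integral>\<^sup>+x. f x \<partial>distr lborel borel ((+) c))"
    by (simp add: lborel_distr_plus)
  also have "\<dots> = (\<integral>\<^sup>+x. f (c + x) \<partial>lborel)"
    by (subst nn_integral_distr) auto
  finally show ?thesis by (simp add: add.commute)
qed

text \<open>Lattice translates of the half-open cell tile the plane: the only n that counts is
  determined by the floors of the coordinates of x. The lattice sum is written as an integral for
  \<open>count_space\<close>, ready to be exchanged with a Lebesgue integral.\<close>

lemma nn_integral_count_cells:
  "(\<integral>\<^sup>+n. indicator half_open_cell (x + n) \<partial>count_space integer_lattice) = (1::ennreal)"
  "(\<integral>\<^sup>+n. indicator half_open_cell (x - n) \<partial>count_space integer_lattice) = (1::ennreal)"
proof -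
  have uniq: "n = wrap x - x" if "n \<in> integer_lattice" "x + n \<in> half_open_cell" for x n :: "real^2"
  proof -
    from that obtain p :: "int^2" where n: "n = (\<chi> i. of_int (p $ i))"
      by (auto simp: integer_lattice_def)
    have "- (p $ i) = \<lfloor>x $ i\<rfloor>" for i
      using that(2) unfolding half_open_cell_def n
      by (intro floor_unique[symmetric]) (auto simp: algebra_simps dest!: spec[of _ i])
    then have "real_of_int (p $ i) = - real_of_int \<lfloor>x $ i\<rfloor>" for i
      by (metis of_int_minus minus_minus)
    then show ?thesis
      by (simp add: n wrap_def frac_def vec_eq_iff)
  qed
  have mem: "wrap x - x \<in> integer_lattice" for x
  proof -
    have "wrap x - x = (\<chi> i. of_int ((\<chi> i. - \<lfloor>x $ i\<rfloor>) $ i))"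
      by (simp add: wrap_def frac_def vec_eq_iff)
    then show ?thesis unfolding integer_lattice_def by blast
  qed
  have one: "(\<integral>\<^sup>+n. indicator {a} n \<partial>count_space integer_lattice) = (1::ennreal)"
    if "a \<in> integer_lattice" for a
    using that by (simp add: nn_integral_indicator)
  show "(\<integral>\<^sup>+n. indicator half_open_cell (x + n) \<partial>count_space integer_lattice) = (1::ennreal)"
    unfolding one[OF mem[of x], symmetric]
  proof (rule nn_integral_cong)
    fix n assume "n \<in> space (count_space integer_lattice)"
    then have "x + n \<in> half_open_cell \<longleftrightarrow> n = wrap x - x"
      using uniq[of n x] wrap_in_cell[of x] by auto
    then show "indicator half_open_cell (x + n) = (indicator {wrap x - x} n :: ennreal)"
      by (simp add: indicator_def)
  qed
  show "(\<integral>\<^sup>+n. indicator half_open_cell (x - n) \<partial>count_space integer_lattice) = (1::ennreal)"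
    unfolding one[OF wrap_diff[of x], symmetric]
  proof (rule nn_integral_cong)
    fix n assume "n \<in> space (count_space integer_lattice)"
    then have n: "n \<in> integer_lattice" by simp
    then have n': "- n \<in> integer_lattice"
    proof -
      obtain p :: "int^2" where "n = (\<chi> i. of_int (p $ i))" using n by (auto simp: integer_lattice_def)
      then have "- n = (\<chi> i. of_int ((- p) $ i))" by (simp add: vec_eq_iff)
      then show ?thesis unfolding integer_lattice_def by blast
    qed
    have "x - n \<in> half_open_cell \<longleftrightarrow> n = x - wrap x"
    proof
      assume "x - n \<in> half_open_cell"
      then have "- n = wrap x - x" using uniq[OF n', of x] by simp
      then show "n = x - wrap x" by (simp add: algebra_simps)
    qed (simp add: wrap_in_cell)
    then show "indicator half_open_cell (x - n) = (indicator {x - wrap x} n :: ennreal)"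
      by (simp add: indicator_def)
  qed
qed

text \<open>The shifted cell is cut along the lattice and its pieces are moved back into the cell.
  One tiling identity inserts the cut, periodicity and a plane translation by n move each piece, and
  the other tiling identity reassembles the cell.\<close>

lemma nn_integral_torus_shift:
  fixes f :: "real^2 \<Rightarrow> ennreal"
  assumes per: "torus_periodic f" and [measurable]: "f \<in> borel_measurable borel"
  shows "(\<integral>\<^sup>+x. f (x + z) \<partial>torus_measure) = (\<integral>\<^sup>+x. f x \<partial>torus_measure)"
proof -
  let ?Q = "half_open_cell" and ?I = "count_space integer_lattice"
  have "(\<integral>\<^sup>+x. f (x + z) \<partial>torus_measure) = (\<integral>\<^sup>+x. f (x + z) * indicator ?Q x \<partial>lborel)"
    by (rule nn_integral_torus)
  also have "\<dots> = (\<integral>\<^sup>+x. f x * indicator ?Q (x - z) \<partial>lborel)"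
    using nn_integral_lborel_shift[of "\<lambda>x. f x * indicator ?Q (x - z)" z] by simp
  also have "\<dots> = (\<integral>\<^sup>+x. (\<integral>\<^sup>+n. f x * indicator ?Q (x - z) * indicator ?Q (x + n) \<partial>?I) \<partial>lborel)"
    by (simp add: nn_integral_cmult nn_integral_count_cells)
  also have "\<dots> = (\<integral>\<^sup>+n. (\<integral>\<^sup>+x. f x * indicator ?Q (x - z) * indicator ?Q (x + n) \<partial>lborel) \<partial>?I)"
    by (rule nn_integral_count_space_nn_integral[OF countable_integer_lattice]) simp
  also have "\<dots> = (\<integral>\<^sup>+n. (\<integral>\<^sup>+x. f x * indicator ?Q (x - z - n) * indicator ?Q x \<partial>lborel) \<partial>?I)"
  proof (rule nn_integral_cong)
    fix n assume "n \<in> space ?I"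
    then have n: "n \<in> integer_lattice" by simp
    have "(\<integral>\<^sup>+x. f x * indicator ?Q (x - z) * indicator ?Q (x + n) \<partial>lborel)
        = (\<integral>\<^sup>+x. f (x - n) * indicator ?Q (x - n - z) * indicator ?Q x \<partial>lborel)"
      using nn_integral_lborel_shift[of "\<lambda>x. f x * indicator ?Q (x - z) * indicator ?Q (x + n)" "- n"] by simp
    also have "\<dots> = (\<integral>\<^sup>+x. f x * indicator ?Q (x - z - n) * indicator ?Q x \<partial>lborel)"
      by (simp add: periodic_lattice(2)[OF per n] algebra_simps)
    finally show "(\<integral>\<^sup>+x. f x * indicator ?Q (x - z) * indicator ?Q (x + n) \<partial>lborel)
      = (\<integral>\<^sup>+x. f x * indicator ?Q (x - z - n) * indicator ?Q x \<partial>lborel)" .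
  qed
  also have "\<dots> = (\<integral>\<^sup>+x. (\<integral>\<^sup>+n. f x * indicator ?Q (x - z - n) * indicator ?Q x \<partial>?I) \<partial>lborel)"
    by (rule nn_integral_count_space_nn_integral[OF countable_integer_lattice, symmetric]) simp
  also have "\<dots> = (\<integral>\<^sup>+x. f x * indicator ?Q x \<partial>lborel)"
    by (simp add: nn_integral_cmult nn_integral_multc nn_integral_count_cells)
  also have "\<dots> = (\<integral>\<^sup>+x. f x \<partial>torus_measure)"
    by (rule nn_integral_torus[symmetric])
  finally show ?thesis .
qed

lemma emeasure_distr_indicator:
  assumes [measurable]: "g \<in> measurable M N" and "A \<in> sets N"
  shows "emeasure (distr M N g) A = (\<integral>\<^sup>+x. indicator A (g x) \<partial>M)"
proof -
  have "emeasure (distr M N g) A = (\<integral>\<^sup>+x. indicator A x \<partial>distr M N g)"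
    using assms by simp
  also have "\<dots> = (\<integral>\<^sup>+x. indicator A (g x) \<partial>M)"
    using assms by (intro nn_integral_distr) auto
  finally show ?thesis .
qed

text \<open>A periodic function factors through \<open>wrap\<close>, so its integral is one against
  the image of the measure under \<open>wrap\<close>. Invariance of this image measure needs only
  nonnegative integrands, and in \<open>torus_shift\<close> it yields integrals and integrability
  for values in any Banach space.\<close>

lemma distr_wrap_shift:
  "distr torus_measure borel (\<lambda>x. wrap (x + z)) = distr torus_measure borel wrap"
proof (rule measure_eqI)
  fix A assume "A \<in> sets (distr torus_measure borel (\<lambda>x. wrap (x + z)))"
  then have [measurable]: "A \<in> sets borel" by simp
  have per: "torus_periodic (\<lambda>x. indicator A (wrap x) :: ennreal)"
    by (auto simp: torus_periodic_def wrap_def frac_def axis_def intro!: arg_cong[where f = "indicator A"] simp: vec_eq_iff)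
  have "emeasure (distr torus_measure borel (\<lambda>x. wrap (x + z))) A
      = (\<integral>\<^sup>+x. indicator A (wrap (x + z)) \<partial>torus_measure)"
    by (rule emeasure_distr_indicator) auto
  also have "\<dots> = (\<integral>\<^sup>+x. indicator A (wrap x) \<partial>torus_measure)"
    by (rule nn_integral_torus_shift[OF per]) simp
  also have "\<dots> = emeasure (distr torus_measure borel wrap) A"
    by (rule emeasure_distr_indicator[symmetric]) auto
  finally show "emeasure (distr torus_measure borel (\<lambda>x. wrap (x + z))) A = emeasure (distr torus_measure borel wrap) A" .
qed simp

lemma torus_shift:
  fixes f :: "real^2 \<Rightarrow> 'a::{banach, second_countable_topology}"
  assumes per: "torus_periodic f" and [measurable]: "f \<in> borel_measurable borel"
  shows "tint (\<lambda>x. f (x + z)) = tint f"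
    and "integrable torus_measure (\<lambda>x. f (x + z)) \<longleftrightarrow> integrable torus_measure f"
proof -
  have "tint (\<lambda>x. f (x + z)) = tint (\<lambda>x. f (wrap (x + z)))"
    by (simp add: periodic_wrap[OF per])
  also have "\<dots> = integral\<^sup>L (distr torus_measure borel (\<lambda>x. wrap (x + z))) f"
    by (simp add: integral_distr)
  also have "\<dots> = tint (\<lambda>x. f (wrap x))"
    by (simp add: distr_wrap_shift integral_distr)
  finally show "tint (\<lambda>x. f (x + z)) = tint f"
    by (simp add: periodic_wrap[OF per])
  have "integrable torus_measure (\<lambda>x. f (x + z)) \<longleftrightarrow> integrable torus_measure (\<lambda>x. f (wrap (x + z)))"
    by (simp add: periodic_wrap[OF per])
  also have "\<dots> \<longleftrightarrow> integrable (distr torus_measure borel (\<lambda>x. wrap (x + z))) f"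
    by (simp add: integrable_distr_eq)
  also have "\<dots> \<longleftrightarrow> integrable torus_measure (\<lambda>x. f (wrap x))"
    by (simp add: distr_wrap_shift integrable_distr_eq)
  finally show "integrable torus_measure (\<lambda>x. f (x + z)) \<longleftrightarrow> integrable torus_measure f"
    by (simp add: periodic_wrap[OF per])
qed

section \<open>Difference quotients and integrals of derivatives\<close>

lemma vector_derivative_quotient_seq:
  fixes f :: "real \<Rightarrow> 'a::real_normed_vector"
  assumes "(f has_vector_derivative d) (at 0)"
  shows "(\<lambda>n. real (Suc n) *\<^sub>R (f (1 / real (Suc n)) - f 0)) \<longlonglongrightarrow> d"
proof -
  define h where "h n = 1 / real (Suc n)" for n
  have h: "0 < h n" for n by (simp add: h_def)
  have hinv: "real (Suc n) = 1 / h n" for n by (simp add: h_def)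
  have lim0: "((\<lambda>t. norm ((f t - f 0) - t *\<^sub>R d) / norm t) \<longlongrightarrow> 0) (at 0)"
    using assms unfolding has_vector_derivative_def has_derivative_iff_norm by simp
  have "h \<longlonglongrightarrow> 0"
    using LIMSEQ_inverse_real_of_nat by (simp add: h_def[abs_def] inverse_eq_divide)
  moreover have "h n \<noteq> 0" for n using h[of n] by simp
  ultimately have "filterlim h (at 0) sequentially" by (simp add: filterlim_at)
  from filterlim_compose[OF lim0 this]
  have "(\<lambda>n. norm ((f (h n) - f 0) - h n *\<^sub>R d) / norm (h n)) \<longlonglongrightarrow> 0" .
  moreover have "norm ((f (h n) - f 0) - h n *\<^sub>R d) / norm (h n) = norm ((1 / h n) *\<^sub>R (f (h n) - f 0) - d)" for n
  proof -
    have "(1 / h n) *\<^sub>R (f (h n) - f 0) - d = (1 / h n) *\<^sub>R ((f (h n) - f 0) - h n *\<^sub>R d)"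
      using h[of n] by (simp add: scaleR_diff_right)
    then show ?thesis using h[of n] by simp
  qed
  ultimately have "(\<lambda>n. norm ((1 / h n) *\<^sub>R (f (h n) - f 0) - d)) \<longlonglongrightarrow> 0" by simp
  then have "(\<lambda>n. (1 / h n) *\<^sub>R (f (h n) - f 0) - d) \<longlonglongrightarrow> 0" by (rule tendsto_norm_zero_cancel)
  then have "(\<lambda>n. (1 / h n) *\<^sub>R (f (h n) - f 0)) \<longlonglongrightarrow> d" by (rule LIM_zero_cancel)
  then show ?thesis unfolding hinv by (simp add: h_def)
qed

text \<open>The integral of the difference quotient vanishes by translation invariance, so no Fubini
  argument is needed.\<close>

lemma torus_integral_derivative:
  fixes \<psi> :: "real^2 \<Rightarrow> complex"
  assumes per: "torus_periodic \<psi>" and meas [measurable]: "\<psi> \<in> borel_measurable borel"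
    and d [measurable]: "d \<in> borel_measurable borel"
    and der: "\<And>x. ((\<lambda>t. \<psi> (x + t *\<^sub>R v)) has_vector_derivative d x) (at 0)"
    and bd: "\<And>x. norm (\<psi> x) \<le> B" "\<And>x. norm (d x) \<le> B"
  shows "tint d = 0"
proof -
  define q where "q n x = real (Suc n) *\<^sub>R (\<psi> (x + (1 / real (Suc n)) *\<^sub>R v) - \<psi> x)" for n x
  have q_meas [measurable]: "q n \<in> borel_measurable borel" for n
    unfolding q_def by measurable
  have int: "integrable torus_measure \<psi>"
    by (rule torus.integrable_const_bound[where B = B]) (use bd in auto)
  have int': "integrable torus_measure (\<lambda>x. \<psi> (x + z))" for z
    using torus_shift(2)[OF per meas] int by simp
  have zero: "tint (q n) = 0" for n
    unfolding q_def using int int' torus_shift(1)[OF per meas] by simp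
  have der_line: "((\<lambda>s. \<psi> (x + s *\<^sub>R v)) has_vector_derivative d (x + t *\<^sub>R v)) (at t)" for x t
  proof -
    have "((\<lambda>s. s - t) has_vector_derivative 1) (at t)"
      by (auto intro!: derivative_eq_intros)
    from vector_diff_chain_at[OF this, of "\<lambda>s. \<psi> ((x + t *\<^sub>R v) + s *\<^sub>R v)" "d (x + t *\<^sub>R v)"]
    have "((\<lambda>s. \<psi> ((x + t *\<^sub>R v) + (s - t) *\<^sub>R v)) has_vector_derivative d (x + t *\<^sub>R v)) (at t)"
      using der[of "x + t *\<^sub>R v"] by (simp add: o_def)
    then show ?thesis by (simp add: algebra_simps)
  qed
  have q_bound: "norm (q n x) \<le> B" for n x
  proof -
    have "norm (\<psi> (x + (1 / real (Suc n)) *\<^sub>R v) - \<psi> (x + 0 *\<^sub>R v)) \<le> B * norm (1 / real (Suc n) - 0)"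
    proof (rule differentiable_bound[where S = UNIV])
      fix s show "((\<lambda>s. \<psi> (x + s *\<^sub>R v)) has_derivative (\<lambda>h. h *\<^sub>R d (x + s *\<^sub>R v))) (at s)"
        using der_line[of x s] by (simp add: has_vector_derivative_def)
      show "onorm (\<lambda>h. h *\<^sub>R d (x + s *\<^sub>R v)) \<le> B"
        by (rule onorm_le) (use bd(2)[of "x + s *\<^sub>R v"] in \<open>simp add: mult.commute[of B] mult_left_mono\<close>)
    qed auto
    then have "real (Suc n) * norm (\<psi> (x + (1 / real (Suc n)) *\<^sub>R v) - \<psi> x) \<le> real (Suc n) * (B * (1 / real (Suc n)))"
      by (intro mult_left_mono) simp_all
    also have "\<dots> = B" by (simp del: of_nat_Suc)
    finally show ?thesis unfolding q_def by (simp only: norm_scaleR abs_of_nat)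
  qed
  have lim: "(\<lambda>n. q n x) \<longlonglongrightarrow> d x" for x
    using vector_derivative_quotient_seq[OF der[of x]] unfolding q_def by simp
  have "(\<lambda>n. tint (q n)) \<longlonglongrightarrow> tint d"
    by (rule integral_dominated_convergence[where w = "\<lambda>_. B"]) (use lim q_bound in auto)
  then show ?thesis
    using LIMSEQ_unique[OF _ tendsto_const] unfolding zero by metis
qed

subsection \<open>Characters\<close>

definition torus_char :: "real^2 \<Rightarrow> real^2 \<Rightarrow> complex" where
  "torus_char k x = cis (k \<bullet> x)"

definition dual_vec :: "int^2 \<Rightarrow> real^2" where
  "dual_vec n = (\<chi> i. 2 * pi * of_int (n $ i))"

text \<open>Square partial sums: an increasing exhaustion that turns unordered lattice sums into
  sequences.\<close>

definition dual_box :: "nat \<Rightarrow> (real^2) set" where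
  "dual_box n = {k \<in> dual_lattice. \<forall>i. \<bar>k $ i\<bar> \<le> 2 * pi * real n}"

text \<open>Coefficients of complex functions, because partial sums and products with characters are
  complex even when u is real.\<close>

definition fcoef :: "(real^2 \<Rightarrow> complex) \<Rightarrow> real^2 \<Rightarrow> complex" where
  "fcoef u k = tint (\<lambda>x. cnj (torus_char k x) * u x)"

lemma cnj_measurable [measurable]: "cnj \<in> borel_measurable borel"
  by (intro borel_measurable_continuous_onI continuous_intros)

lemma fourier_coeff_eq: "fourier_coeff u k = fcoef (\<lambda>x. of_real (u x)) k"
  by (simp add: fourier_coeff_def fcoef_def torus_integral_eq torus_char_def cis_cnj)
    (simp add: cis_conv_exp)

lemma dual_lattice_eq_range: "dual_lattice = range dual_vec"
proof (intro set_eqI iffI)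
  fix k assume "k \<in> dual_lattice"
  then obtain f where "\<And>i. k $ i = 2 * pi * of_int (f i)"
    unfolding dual_lattice_def by (auto simp: choice_iff)
  then have "k = dual_vec (\<chi> i. f i)"
    by (simp add: dual_vec_def vec_eq_iff)
  then show "k \<in> range dual_vec" by simp
qed (auto simp: dual_lattice_def dual_vec_def)

lemma countable_dual_lattice: "countable dual_lattice"
  unfolding dual_lattice_eq_range by blast

lemma dual_lattice_zero [simp]: "0 \<in> dual_lattice"
  unfolding dual_lattice_def by (auto intro: exI[of _ "0::int"])

lemma dual_lattice_add [intro]: "k \<in> dual_lattice \<Longrightarrow> l \<in> dual_lattice \<Longrightarrow> k + l \<in> dual_lattice"
proof -
  have "dual_vec a + dual_vec b = dual_vec (a + b)" for a b
    by (simp add: dual_vec_def vec_eq_iff algebra_simps)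
  then show "k \<in> dual_lattice \<Longrightarrow> l \<in> dual_lattice \<Longrightarrow> k + l \<in> dual_lattice"
    unfolding dual_lattice_eq_range by (metis (no_types, lifting) imageE rangeI)
qed

lemma dual_lattice_uminus [simp]: "- k \<in> dual_lattice \<longleftrightarrow> k \<in> dual_lattice"
proof -
  have "- k \<in> dual_lattice" if "k \<in> dual_lattice" for k
  proof -
    have "- dual_vec a = dual_vec (- a)" for a
      by (simp add: dual_vec_def vec_eq_iff)
    then show ?thesis
      using that unfolding dual_lattice_eq_range by (metis (no_types, lifting) imageE rangeI)
  qed
  from this[of k] this[of "- k"] show ?thesis by auto
qed

lemma dual_lattice_diff [intro]: "k \<in> dual_lattice \<Longrightarrow> l \<in> dual_lattice \<Longrightarrow> k - l \<in> dual_lattice"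
  using dual_lattice_add[of k "- l"] by simp

lemma dual_axis [simp]: "axis i (2 * pi * of_int n) \<in> dual_lattice"
  unfolding dual_lattice_def by (auto simp: axis_def intro: exI[of _ n] exI[of _ "0::int"])

lemma dual_axis1 [simp]: "axis i (2 * pi) \<in> dual_lattice"
  using dual_axis[of i 1] by simp

lemma finite_dual_box [simp]: "finite (dual_box n)"
proof (rule finite_subset)
  let ?I = "{- int n..int n}"
  show "dual_box n \<subseteq> (\<lambda>(a, b). dual_vec (\<chi> i. if i = 1 then a else b)) ` (?I \<times> ?I)"
  proof
    fix k assume k: "k \<in> dual_box n"
    then obtain m where m: "k = dual_vec m"
      unfolding dual_box_def dual_lattice_eq_range by auto
    have "m $ i \<in> ?I" for i
    proof -
      have "2 * pi * \<bar>real_of_int (m $ i)\<bar> \<le> 2 * pi * real n"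
        using k unfolding m by (auto simp: dual_box_def dual_vec_def abs_mult)
      then have "\<bar>real_of_int (m $ i)\<bar> \<le> real n" by simp
      then show ?thesis by auto
    qed
    moreover have "m = (\<chi> i. if i = 1 then m $ 1 else m $ 2)"
      by (simp add: vec_eq_iff forall_2)
    ultimately show "k \<in> (\<lambda>(a, b). dual_vec (\<chi> i. if i = 1 then a else b)) ` (?I \<times> ?I)"
      unfolding m by (intro rev_image_eqI[of "(m $ 1, m $ 2)"]) auto
  qed
qed simp

lemma dual_box_subset: "dual_box n \<subseteq> dual_lattice"
  by (auto simp: dual_box_def)

lemma dual_box_mono: "m \<le> n \<Longrightarrow> dual_box m \<subseteq> dual_box n"
  by (auto simp: dual_box_def intro: order_trans)

lemma dual_box_exhaust:
  assumes "finite K" "K \<subseteq> dual_lattice"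
  obtains n where "K \<subseteq> dual_box n"
proof -
  have ex: "\<exists>n. k \<in> dual_box n" if "k \<in> dual_lattice" for k
  proof -
    obtain n where n: "\<bar>k $ 1\<bar> + \<bar>k $ 2\<bar> \<le> real n"
      using real_arch_simple by blast
    have "1 * real n \<le> 2 * pi * real n"
      using pi_gt3 by (intro mult_right_mono) auto
    then show ?thesis
      using that n by (auto simp: dual_box_def forall_2 intro!: exI[of _ n])
  qed
  from assms have "\<exists>n. K \<subseteq> dual_box n"
  proof (induction K)
    case (insert k K)
    then obtain n m where "K \<subseteq> dual_box n" "k \<in> dual_box m" using ex by blast
    then have "insert k K \<subseteq> dual_box (max n m)"
      using dual_box_mono[of n "max n m"] dual_box_mono[of m "max n m"] by auto
    then show ?case by blast
  qed simp
  then show thesis using that by blast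
qed

lemma torus_char_add: "torus_char (k + l) x = torus_char k x * torus_char l x"
  by (simp add: torus_char_def inner_add_left cis_mult)

lemma torus_char_shift: "torus_char k (x + z) = torus_char k x * torus_char k z"
  by (simp add: torus_char_def inner_add_right cis_mult)

lemma torus_char_uminus: "torus_char (- k) x = cnj (torus_char k x)"
  by (simp add: torus_char_def cis_cnj)

lemma norm_torus_char [simp]: "norm (torus_char k x) = 1"
  by (simp add: torus_char_def)

lemma torus_char_zero [simp]: "torus_char 0 x = 1"
  by (simp add: torus_char_def)

lemma torus_char_measurable [measurable]: "torus_char k \<in> borel_measurable borel"
  unfolding torus_char_def cis_conv_exp by measurable

lemma torus_char_periodic: "k \<in> dual_lattice \<Longrightarrow> torus_periodic (torus_char k)"
  unfolding torus_periodic_def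
proof safe
  fix x i assume "k \<in> dual_lattice"
  then obtain n :: int where "k $ i = 2 * pi * of_int n"
    unfolding dual_lattice_def by blast
  then have "torus_char k (axis i 1) = 1"
    by (simp add: torus_char_def inner_axis cis_multiple_2pi)
  then show "torus_char k (x + axis i 1) = torus_char k x"
    by (simp add: torus_char_shift)
qed

lemma integrable_torus_char [simp]: "integrable torus_measure (torus_char k)"
  by (rule torus.integrable_const_bound[where B = 1]) auto

text \<open>Shifting by half a period in a coordinate direction multiplies a nontrivial character by \<open>-1\<close>.\<close>

lemma integral_torus_char:
  assumes "k \<in> dual_lattice"
  shows "tint (torus_char k) = of_bool (k = 0)"
proof (cases "k = 0")
  case True
  then have "tint (torus_char k) = tint (\<lambda>_. 1)"
    by (intro Bochner_Integration.integral_cong) auto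
  also have "\<dots> = 1" using torus.prob_space by simp
  finally show ?thesis using True by simp
next
  case False
  then obtain i where i: "k $ i \<noteq> 0" by (auto simp: vec_eq_iff)
  define z :: "real^2" where "z = axis i (pi / k $ i)"
  have "torus_char k z = - 1"
    using i by (simp add: torus_char_def z_def inner_axis)
  then have "tint (torus_char k) = - tint (torus_char k)"
    using torus_shift(1)[OF torus_char_periodic[OF assms] torus_char_measurable, of z]
    by (simp add: torus_char_shift)
  then show ?thesis using False by simp
qed

subsection \<open>Uniqueness of Fourier coefficients\<close>

text \<open>The torus as a product of two unit circles in C^2. Real polynomials in the coordinates
  pull back to trigonometric polynomials, which makes the Stone-Weierstrass theorem on the compact
  image available.\<close>

definition torus_embed :: "real^2 \<Rightarrow> complex \<times> complex" where
  "torus_embed x = (torus_char (axis 1 (2 * pi)) x, torus_char (axis 2 (2 * pi)) x)"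

lemma continuous_torus_embed: "continuous_on S torus_embed"
  unfolding torus_embed_def torus_char_def cis_conv_exp by (intro continuous_intros)

lemma torus_embed_measurable [measurable]: "torus_embed \<in> borel_measurable borel"
  using continuous_torus_embed by (rule borel_measurable_continuous_onI)

lemma torus_embed_inj: "inj_on torus_embed half_open_cell"
proof (rule inj_onI)
  fix x y :: "real^2" assume x: "x \<in> half_open_cell" and y: "y \<in> half_open_cell"
    and eq: "torus_embed x = torus_embed y"
  have "x $ i = y $ i" for i
  proof -
    have "cis (2 * pi * x $ i) = cis (2 * pi * y $ i)"
      using eq exhaust_2[of i] by (auto simp: torus_embed_def torus_char_def inner_axis')
    then have "cis (2 * pi * (x $ i) - 2 * pi * (y $ i)) = 1"
      by (simp add: cis_divide[symmetric])
    then have "cos (2 * pi * (x $ i - y $ i)) = 1"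
      by (simp add: cis.ctr complex_eq_iff algebra_simps)
    then obtain n :: int where "2 * pi * (x $ i - y $ i) = of_int n * 2 * pi"
      by (auto simp: cos_one_2pi_int)
    then have n: "x $ i - y $ i = of_int n" by simp
    have "\<bar>x $ i - y $ i\<bar> < 1"
      using x y unfolding half_open_cell_def by (auto dest!: spec[of _ i])
    then have "n = 0" unfolding n by simp
    then show ?thesis using n by simp
  qed
  then show "x = y" by (simp add: vec_eq_iff)
qed

definition zero_coefs :: "(real^2 \<Rightarrow> complex) \<Rightarrow> bool" where
  "zero_coefs u \<longleftrightarrow> u \<in> borel_measurable torus_measure \<and> integrable torus_measure u \<and> (\<forall>k\<in>dual_lattice. fcoef u k = 0)"

lemma zero_coefs_char:
  assumes "zero_coefs u" "l \<in> dual_lattice"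
  shows "zero_coefs (\<lambda>x. torus_char l x * u x)"
proof -
  have [measurable]: "u \<in> borel_measurable torus_measure"
    using assms by (auto simp: zero_coefs_def)
  have "integrable torus_measure (\<lambda>x. torus_char l x * u x)"
    by (rule Bochner_Integration.integrable_bound[of _ u])
      (use assms in \<open>auto simp: zero_coefs_def norm_mult\<close>)
  moreover have "fcoef (\<lambda>x. torus_char l x * u x) k = fcoef u (k - l)" for k
    unfolding fcoef_def
    by (rule Bochner_Integration.integral_cong)
      (use torus_char_add[of k "- l"] in \<open>auto simp: torus_char_uminus\<close>)
  ultimately show ?thesis
    using assms unfolding zero_coefs_def by auto
qed

lemma zero_coefs_add:
  assumes "zero_coefs u" "zero_coefs v"
  shows "zero_coefs (\<lambda>x. u x + v x)"
proof -
  have [measurable]: "u \<in> borel_measurable torus_measure" "v \<in> borel_measurable torus_measure"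
    using assms by (auto simp: zero_coefs_def)
  have "integrable torus_measure (\<lambda>x. cnj (torus_char k x) * w x)" if "integrable torus_measure w" for w k
  proof (rule Bochner_Integration.integrable_bound[OF that])
    have [measurable]: "w \<in> borel_measurable torus_measure"
      using that by (rule borel_measurable_integrable)
    show "(\<lambda>x. cnj (torus_char k x) * w x) \<in> borel_measurable torus_measure" by measurable
  qed (simp add: norm_mult)
  then show ?thesis
    using assms by (auto simp: zero_coefs_def fcoef_def distrib_left)
qed

lemma zero_coefs_cmult:
  assumes "zero_coefs u"
  shows "zero_coefs (\<lambda>x. c * u x)"
proof -
  have "fcoef (\<lambda>x. c * u x) k = c * fcoef u k" for k
    unfolding fcoef_def by (simp add: mult.left_commute)
  then show ?thesis
    using assms by (auto simp: zero_coefs_def)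
qed

text \<open>Multiplication by a character only permutes the Fourier coefficients, so vanishing of
  all of them survives it, and hence also multiplication by the real and imaginary parts of the two
  coordinate characters. These generate all real polynomials on the embedded torus.\<close>

lemma zero_coefs_polynomial:
  assumes "real_polynomial_function p" "zero_coefs u"
  shows "zero_coefs (\<lambda>x. of_real (p (torus_embed x)) * u x)"
  using assms
proof (induction arbitrary: u rule: real_polynomial_function.induct)
  case (linear f)
  interpret f: bounded_linear f by fact
  have f_eq: "f (a, b) = Re a * f (1, 0) + Im a * f (\<i>, 0) + Re b * f (0, 1) + Im b * f (0, \<i>)" for a b
  proof -
    have "(a, b) = Re a *\<^sub>R (1, 0) + Im a *\<^sub>R (\<i>, 0) + Re b *\<^sub>R (0, 1) + Im b *\<^sub>R (0, \<i>)"
      by (simp add: complex_eq_iff)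
    then show ?thesis
      by (metis f.add f.scaleR real_scaleR_def)
  qed
  have re: "zero_coefs (\<lambda>x. of_real (Re (torus_char k x)) * u x)"
    and im: "zero_coefs (\<lambda>x. of_real (Im (torus_char k x)) * u x)" if "k \<in> dual_lattice" for k
  proof -
    have p: "zero_coefs (\<lambda>x. torus_char k x * u x)" "zero_coefs (\<lambda>x. torus_char (- k) x * u x)"
      using zero_coefs_char[OF linear(2)] that by simp_all
    have "zero_coefs (\<lambda>x. (1/2) * (torus_char k x * u x) + (1/2) * (torus_char (- k) x * u x))"
      by (intro zero_coefs_add zero_coefs_cmult p)
    moreover have "(1/2) * (z * w) + (1/2) * (cnj z * w) = of_real (Re z) * w" for z w
      by (simp add: complex_eq_iff field_simps)
    ultimately show "zero_coefs (\<lambda>x. of_real (Re (torus_char k x)) * u x)"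
      by (simp add: torus_char_uminus)
    have "zero_coefs (\<lambda>x. (-\<i>/2) * (torus_char k x * u x) + (\<i>/2) * (torus_char (- k) x * u x))"
      by (intro zero_coefs_add zero_coefs_cmult p)
    moreover have "(-\<i>/2) * (z * w) + (\<i>/2) * (cnj z * w) = of_real (Im z) * w" for z w
      by (simp add: complex_eq_iff field_simps)
    ultimately show "zero_coefs (\<lambda>x. of_real (Im (torus_char k x)) * u x)"
      by (simp add: torus_char_uminus)
  qed
  have "zero_coefs (\<lambda>x. of_real (f (1, 0)) * (of_real (Re (torus_char (axis 1 (2 * pi)) x)) * u x)
     + of_real (f (\<i>, 0)) * (of_real (Im (torus_char (axis 1 (2 * pi)) x)) * u x)
     + of_real (f (0, 1)) * (of_real (Re (torus_char (axis 2 (2 * pi)) x)) * u x)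
     + of_real (f (0, \<i>)) * (of_real (Im (torus_char (axis 2 (2 * pi)) x)) * u x))"
    by (intro zero_coefs_add zero_coefs_cmult re im) auto
  moreover have "of_real (f (torus_embed x)) * u x =
      of_real (f (1, 0)) * (of_real (Re (torus_char (axis 1 (2 * pi)) x)) * u x)
     + of_real (f (\<i>, 0)) * (of_real (Im (torus_char (axis 1 (2 * pi)) x)) * u x)
     + of_real (f (0, 1)) * (of_real (Re (torus_char (axis 2 (2 * pi)) x)) * u x)
     + of_real (f (0, \<i>)) * (of_real (Im (torus_char (axis 2 (2 * pi)) x)) * u x)" for x
    unfolding torus_embed_def
    by (subst f_eq) (simp only: of_real_add of_real_mult algebra_simps)
  ultimately show ?case
    by presburger
next
  case (const c)
  then show ?case by (simp add: zero_coefs_cmult)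
next
  case (add f g)
  then show ?case by (simp add: distrib_right zero_coefs_add)
next
  case (mult f g)
  from mult.IH(1)[OF mult.IH(2)[OF mult.prems]] show ?case
    by (simp add: mult.assoc)
qed

text \<open>The indicator of K is almost everywhere a bounded limit of polynomials in
  \<open>torus_embed\<close>. Against such a polynomial u integrates to 0, because the integral is
  the coefficient at frequency 0 of a product covered by
  \<open>zero_coefs_polynomial\<close>.\<close>

lemma zero_coefs_compact:
  assumes u: "zero_coefs u" and K: "compact K" "K \<subseteq> half_open_cell"
  shows "tint (\<lambda>x. indicator K x *\<^sub>R u x) = 0"
proof (cases "K = {}")
  case True then show ?thesis by simp
next
  case False
  have [measurable]: "u \<in> borel_measurable torus_measure" "K \<in> sets borel"
    using u K by (auto simp: zero_coefs_def borel_compact)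
  define S where "S = torus_embed ` unit_cell"
  define E where "E = torus_embed ` K"
  have S: "compact S"
    unfolding S_def unit_cell_def by (intro compact_continuous_image continuous_torus_embed compact_cbox)
  have E: "closed E" "E \<noteq> {}"
    unfolding E_def using False K by (auto intro!: compact_imp_closed compact_continuous_image continuous_torus_embed)
  \<comment> \<open>Tent functions around \<open>E\<close>: they equal 1 on \<open>E\<close> and
    decrease to its indicator because \<open>E\<close> is closed.\<close>
  define h where "h n s = max 0 (1 - real n * infdist s E)" for n :: nat and s
  have "continuous_on S (h n)" for n
    unfolding h_def by (intro continuous_intros)
  then have "\<exists>p. real_polynomial_function p \<and> (\<forall>s\<in>S. \<bar>h n s - p s\<bar> < 1 / real (Suc n))" for n
    using Stone_Weierstrass_real_polynomial_function[OF S, of "h n" "1 / real (Suc n)"]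
    by (metis divide_pos_pos of_nat_0_less_iff zero_less_Suc zero_less_one)
  then obtain p where p: "\<And>n. real_polynomial_function (p n)"
    and hp: "\<And>n s. s \<in> S \<Longrightarrow> \<bar>h n s - p n s\<bar> < 1 / real (Suc n)"
    by metis
  have pz: "zero_coefs (\<lambda>x. of_real (p n (torus_embed x)) * u x)" for n
    by (rule zero_coefs_polynomial[OF p u])
  have int0: "tint (\<lambda>x. of_real (p n (torus_embed x)) * u x) = 0" for n
  proof -
    have "fcoef (\<lambda>x. of_real (p n (torus_embed x)) * u x) 0 = 0"
      using pz[of n] by (simp add: zero_coefs_def)
    then show ?thesis by (simp add: fcoef_def)
  qed
  have p_bound: "\<bar>p n s\<bar> \<le> 2" if "s \<in> S" for n s
  proof -
    have "0 \<le> h n s" "h n s \<le> 1"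
      unfolding h_def using infdist_nonneg[of s E] by auto
    moreover have "1 / real (Suc n) \<le> 1" by simp
    ultimately show ?thesis using hp[OF that, of n] by linarith
  qed
  have h_lim: "(\<lambda>n. h n s) \<longlonglongrightarrow> indicator E s" for s
  proof (cases "s \<in> E")
    case True
    then have "h n s = 1" for n by (simp add: h_def)
    then show ?thesis using True by simp
  next
    case False
    then have pos: "0 < infdist s E"
      using E by (metis in_closed_iff_infdist_zero infdist_nonneg less_le)
    obtain N where N: "1 / infdist s E < real N" using reals_Archimedean2 by blast
    have "h n s = 0" if "n \<ge> N" for n
    proof -
      have "1 / infdist s E < real n" using N that by linarith
      then have "1 < real n * infdist s E" using pos by (simp add: field_simps)
      then show ?thesis by (simp add: h_def)
    qed
    then have "eventually (\<lambda>n. h n s = 0) sequentially"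
      by (auto simp: eventually_sequentially)
    then show ?thesis using False by (simp add: tendsto_eventually)
  qed
  have p_lim: "(\<lambda>n. p n s) \<longlonglongrightarrow> indicator E s" if "s \<in> S" for s
  proof -
    have "(\<lambda>n. h n s - p n s) \<longlonglongrightarrow> 0"
    proof (rule Lim_null_comparison)
      show "\<forall>\<^sub>F n in sequentially. norm (h n s - p n s) \<le> 1 / real (Suc n)"
        using hp[OF that] by (auto intro!: always_eventually less_imp_le)
      show "(\<lambda>n. 1 / real (Suc n)) \<longlonglongrightarrow> 0"
        using LIMSEQ_inverse_real_of_nat by (simp add: inverse_eq_divide)
    qed
    from tendsto_diff[OF h_lim[of s] this] show ?thesis by simp
  qed
  \<comment> \<open>Here the half-open cell matters: on the closed cell \<open>torus_embed\<close>
    glues opposite sides.\<close>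
  have E_iff: "torus_embed x \<in> E \<longleftrightarrow> x \<in> K" if "x \<in> half_open_cell" for x
    using torus_embed_inj that K(2) unfolding E_def inj_on_def by auto
  have pm [measurable]: "p n \<in> borel_measurable borel" for n
    by (rule borel_measurable_continuous_onI, rule continuous_on_polymonial_function)
       (rule p[of n, unfolded real_polynomial_function_eq])
  have "(\<lambda>n. tint (\<lambda>x. of_real (p n (torus_embed x)) * u x))
      \<longlonglongrightarrow> tint (\<lambda>x. indicator K x *\<^sub>R u x)"
  proof (rule integral_dominated_convergence[where w = "\<lambda>x. 2 * norm (u x)"])
    show "integrable torus_measure (\<lambda>x. 2 * norm (u x))"
      using u by (auto simp: zero_coefs_def)
    show "AE x in torus_measure. (\<lambda>n. of_real (p n (torus_embed x)) * u x) \<longlonglongrightarrow> indicator K x *\<^sub>R u x"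
      using AE_torus_half_open AE_space
    proof eventually_elim
      case (elim x)
      then have "(\<lambda>n. p n (torus_embed x)) \<longlonglongrightarrow> indicator E (torus_embed x)"
        by (intro p_lim) (simp add: S_def)
      moreover have "indicator E (torus_embed x) = (indicator K x :: real)"
        using E_iff[OF elim(1)] by (simp add: indicator_def)
      ultimately have "(\<lambda>n. of_real (p n (torus_embed x)) * u x) \<longlonglongrightarrow> of_real (indicator K x) * u x"
        by (intro tendsto_intros) simp
      then show ?case by (simp add: scaleR_conv_of_real)
    qed
    show "AE x in torus_measure. norm (of_real (p n (torus_embed x)) * u x) \<le> 2 * norm (u x)" for n
      using AE_space
    proof eventually_elim
      case (elim x)
      then show ?case
        unfolding norm_mult norm_of_real by (intro mult_right_mono p_bound) (auto simp: S_def)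
    qed
  qed measurable
  then show ?thesis
    unfolding int0 using LIMSEQ_unique[OF _ tendsto_const] by metis
qed

text \<open>A compact subset of the part of the cell where v > 1/(n+1) is null, since the integral
  of v over it vanishes but is at least its measure divided by n+1. Inner regularity passes this on
  to the whole part; it concerns Borel measures, hence the image measure under the identity.\<close>

lemma AE_nonpos_compact:
  fixes v :: "real^2 \<Rightarrow> real"
  assumes v: "integrable torus_measure v" and vb: "v \<in> borel_measurable borel"
    and K: "\<And>K. compact K \<Longrightarrow> K \<subseteq> half_open_cell \<Longrightarrow> tint (\<lambda>x. indicator K x * v x) = 0"
  shows "AE x in torus_measure. v x \<le> 0"
proof -
  note vb [measurable]
  have null: "emeasure torus_measure ({x. v x > 1 / real (Suc n)} \<inter> half_open_cell \<inter> unit_cell) = 0" for n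
  proof -
    let ?A = "{x. v x > 1 / real (Suc n)} \<inter> half_open_cell"
    let ?M = "distr torus_measure borel (\<lambda>x. x)"
    have [measurable]: "?A \<in> sets borel" by measurable
    have "emeasure ?M ?A = (SUP K\<in>{K. K \<subseteq> ?A \<and> compact K}. emeasure ?M K)"
    proof (rule inner_regular)
      show "emeasure ?M (space ?M) \<noteq> \<infinity>"
        using torus.prob_space_distr[of "\<lambda>x. x" borel] prob_space.emeasure_space_1 by fastforce
    qed simp_all
    moreover have "emeasure ?M K = 0" if k: "K \<subseteq> ?A" "compact K" for K
    proof -
      have [measurable]: "K \<in> sets borel" using k borel_compact by blast
      have "tint (\<lambda>x. indicator K x * (1 / real (Suc n))) \<le> tint (\<lambda>x. indicator K x * v x)"
      proof (rule integral_mono)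
        show "integrable torus_measure (\<lambda>x. indicator K x * (1 / real (Suc n)))"
          by (rule torus.integrable_const_bound[where B = 1]) (auto simp: indicator_def)
        show "integrable torus_measure (\<lambda>x. indicator K x * v x)"
          by (rule Bochner_Integration.integrable_bound[OF v]) (auto simp: indicator_def)
        show "indicator K x * (1 / real (Suc n)) \<le> indicator K x * v x" for x
          using k by (auto simp: indicator_def)
      qed
      also have "\<dots> = 0" using K k by auto
      also have "tint (\<lambda>x. indicator K x * (1 / real (Suc n)))
          = integral\<^sup>L ?M (\<lambda>x. indicator K x * (1 / real (Suc n)))"
        by (subst integral_distr) auto
      also have "\<dots> = measure ?M K * (1 / real (Suc n))" by simp
      finally have "measure ?M K * (1 / real (Suc n)) \<le> 0" .
      then have "measure ?M K = 0"
        using measure_nonneg[of ?M K] by (simp add: mult_le_0_iff zero_le_mult_iff divide_le_0_iff)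
      then show ?thesis
        using torus.prob_space_distr[of "\<lambda>x. x" borel]
        by (simp add: finite_measure.emeasure_eq_measure prob_space.axioms)
    qed
    ultimately have "emeasure ?M ?A = 0"
      by (auto simp: SUP_eq_const intro: antisym SUP_least)
    then show ?thesis
      by (subst (asm) emeasure_distr) (auto simp: vimage_def)
  qed
  have sets: "{x. v x > 1 / real (Suc n)} \<inter> half_open_cell \<inter> unit_cell \<in> sets torus_measure" for n
  proof -
    have "{x. v x > 1 / real (Suc n)} \<inter> half_open_cell \<in> sets borel" by measurable
    from measurable_sets[OF measurable_ident_torus this] show ?thesis by (simp add: vimage_def)
  qed
  have "AE x in torus_measure. \<forall>n. x \<notin> {x. v x > 1 / real (Suc n)} \<inter> half_open_cell \<inter> unit_cell"
    unfolding AE_all_countable by (intro allI AE_not_in null_setsI null sets)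
  then show ?thesis
    using AE_torus_half_open AE_space
  proof eventually_elim
    case (elim x)
    then have le: "v x \<le> 1 / real (Suc n)" for n
      using elim(1)[rule_format, of n] by (simp add: not_less)
    show ?case
    proof (rule ccontr)
      assume "\<not> v x \<le> 0"
      then obtain n where "inverse (real (Suc n)) < v x" using reals_Archimedean[of "v x"] by auto
      then show False using le[of n] by (simp add: inverse_eq_divide)
    qed
  qed
qed

text \<open>Integrability suffices, so the theorem also applies to a product of two L2 functions,
  such as a component of m times its gradient.\<close>

theorem fourier_uniqueness:
  assumes u: "u \<in> borel_measurable borel" "integrable torus_measure u"
    and z: "\<And>k. k \<in> dual_lattice \<Longrightarrow> fcoef u k = 0"
  shows "AE x in torus_measure. u x = 0"
proof -
  note u(1)[measurable]
  have zc: "zero_coefs u" using u z by (auto simp: zero_coefs_def)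
  have Kint: "integrable torus_measure (\<lambda>x. indicator K x *\<^sub>R u x)" if "compact K" for K
  proof -
    have [measurable]: "K \<in> sets borel" using that by (rule borel_compact)
    show ?thesis
      by (rule Bochner_Integration.integrable_bound[OF u(2)]) (auto simp: indicator_def)
  qed
  have re: "tint (\<lambda>x. indicator K x * Re (u x)) = 0"
    and im: "tint (\<lambda>x. indicator K x * Im (u x)) = 0"
    if "compact K" "K \<subseteq> half_open_cell" for K
    using integral_Re[OF Kint[OF that(1)]] integral_Im[OF Kint[OF that(1)]] zero_coefs_compact[OF zc that]
    by simp_all
  have "AE x in torus_measure. Re (u x) \<le> 0"
    by (rule AE_nonpos_compact) (use u re in auto)
  moreover have "AE x in torus_measure. - Re (u x) \<le> 0"
    by (rule AE_nonpos_compact) (use u re in auto)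
  moreover have "AE x in torus_measure. Im (u x) \<le> 0"
    by (rule AE_nonpos_compact) (use u im in auto)
  moreover have "AE x in torus_measure. - Im (u x) \<le> 0"
    by (rule AE_nonpos_compact) (use u im in auto)
  ultimately show ?thesis
    by eventually_elim (simp add: complex_eq_iff)
qed

subsection \<open>Square-integrable functions\<close>

text \<open>The squared L2 norm. Functions are not identified almost everywhere, so L2 convergence
  is stated as \<open>nsq\<close> of a difference tending to 0.\<close>

definition nsq :: "(real^2 \<Rightarrow> 'a::euclidean_space) \<Rightarrow> real" where
  "nsq f = tint (\<lambda>x. (norm (f x))\<^sup>2)"

lemma nsq_nonneg [simp]: "0 \<le> nsq f"
  by (simp add: nsq_def)

lemma L2_torusI:
  assumes "torus_periodic f" "f \<in> borel_measurable borel" "integrable torus_measure (\<lambda>x. (norm (f x))\<^sup>2)"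
  shows "f \<in> L2_torus"
  using assms by (simp add: L2_torus_def torus_integrable_eq)

lemma L2_torusD:
  assumes "f \<in> L2_torus"
  shows "torus_periodic f" "f \<in> borel_measurable borel" "integrable torus_measure (\<lambda>x. (norm (f x))\<^sup>2)"
  using assms by (simp_all add: L2_torus_def torus_integrable_eq)

lemma L2_torus_measurable: "f \<in> L2_torus \<Longrightarrow> f \<in> borel_measurable torus_measure"
  using L2_torusD(2) borel_measurable_torus_measure by blast

lemma L2_bounded:
  assumes "torus_periodic f" "f \<in> borel_measurable borel" "\<And>x. norm (f x) \<le> B"
  shows "f \<in> L2_torus"
proof (rule L2_torusI[OF assms(1,2)])
  note assms(2)[measurable]
  show "integrable torus_measure (\<lambda>x. (norm (f x))\<^sup>2)"
    by (rule torus.integrable_const_bound[where B = "B\<^sup>2"])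
      (auto intro!: AE_I2 power_mono assms(3))
qed

lemma L2_prod_norm:
  assumes "f \<in> L2_torus" "g \<in> L2_torus"
  shows "integrable torus_measure (\<lambda>x. norm (f x) * norm (g x))"
proof (rule Bochner_Integration.integrable_bound)
  note L2_torusD(2)[OF assms(1), measurable] L2_torusD(2)[OF assms(2), measurable]
  show "integrable torus_measure (\<lambda>x. (norm (f x))\<^sup>2 + (norm (g x))\<^sup>2)"
    using assms by (intro Bochner_Integration.integrable_add L2_torusD(3))
  show "(\<lambda>x. norm (f x) * norm (g x)) \<in> borel_measurable torus_measure" by measurable
  show "AE x in torus_measure. norm (norm (f x) * norm (g x)) \<le> norm ((norm (f x))\<^sup>2 + (norm (g x))\<^sup>2)"
  proof (rule AE_I2)
    fix x
    have "2 * (norm (f x) * norm (g x)) \<le> (norm (f x))\<^sup>2 + (norm (g x))\<^sup>2"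
      using zero_le_power2[of "norm (f x) - norm (g x)"] by (simp add: power2_eq_square algebra_simps)
    moreover have "0 \<le> norm (f x) * norm (g x)" by simp
    ultimately have "norm (f x) * norm (g x) \<le> (norm (f x))\<^sup>2 + (norm (g x))\<^sup>2" by linarith
    then show "norm (norm (f x) * norm (g x)) \<le> norm ((norm (f x))\<^sup>2 + (norm (g x))\<^sup>2)"
      by (simp add: abs_mult)
  qed
qed

lemma L2_const: "(\<lambda>_. c) \<in> L2_torus"
  by (rule L2_bounded[where B = "norm c"]) (auto simp: torus_periodic_def)

lemma L2_norm_integrable: "f \<in> L2_torus \<Longrightarrow> integrable torus_measure (\<lambda>x. norm (f x))"
  using L2_prod_norm[OF _ L2_const[of "1::real"]] by simp

lemma L2_integrable: "f \<in> L2_torus \<Longrightarrow> integrable torus_measure f"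
  using L2_norm_integrable L2_torus_measurable integrable_norm_iff by blast

lemma L2_prod:
  fixes f g :: "real^2 \<Rightarrow> 'a::{real_normed_field, euclidean_space}"
  assumes "f \<in> L2_torus" "g \<in> L2_torus"
  shows "integrable torus_measure (\<lambda>x. f x * g x)"
proof (rule Bochner_Integration.integrable_bound[OF L2_prod_norm[OF assms]])
  note L2_torusD(2)[OF assms(1), measurable] L2_torusD(2)[OF assms(2), measurable]
  show "(\<lambda>x. f x * g x) \<in> borel_measurable torus_measure" by measurable
qed (simp add: norm_mult)

lemma L2_add:
  assumes "f \<in> L2_torus" "g \<in> L2_torus"
  shows "(\<lambda>x. f x + g x) \<in> L2_torus"
proof (rule L2_torusI)
  note L2_torusD(2)[OF assms(1), measurable] L2_torusD(2)[OF assms(2), measurable]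
  show "torus_periodic (\<lambda>x. f x + g x)"
    using L2_torusD(1)[OF assms(1)] L2_torusD(1)[OF assms(2)] by (simp add: torus_periodic_def)
  show "(\<lambda>x. f x + g x) \<in> borel_measurable borel" by measurable
  show "integrable torus_measure (\<lambda>x. (norm (f x + g x))\<^sup>2)"
  proof (rule Bochner_Integration.integrable_bound)
    show "integrable torus_measure (\<lambda>x. (norm (f x))\<^sup>2 + (norm (g x))\<^sup>2 + 2 * (norm (f x) * norm (g x)))"
      using assms by (intro Bochner_Integration.integrable_add L2_torusD(3) integrable_mult_right L2_prod_norm)
    show "AE x in torus_measure. norm ((norm (f x + g x))\<^sup>2)
        \<le> norm ((norm (f x))\<^sup>2 + (norm (g x))\<^sup>2 + 2 * (norm (f x) * norm (g x)))"
    proof (rule AE_I2)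
      fix x
      have "(norm (f x + g x))\<^sup>2 \<le> (norm (f x) + norm (g x))\<^sup>2"
        by (intro power_mono norm_triangle_ineq) auto
      then show "norm ((norm (f x + g x))\<^sup>2)
        \<le> norm ((norm (f x))\<^sup>2 + (norm (g x))\<^sup>2 + 2 * (norm (f x) * norm (g x)))"
        by (simp add: power2_sum)
    qed
  qed measurable
qed

lemma L2_scaleR:
  assumes "f \<in> L2_torus"
  shows "(\<lambda>x. c *\<^sub>R f x) \<in> L2_torus"
proof (rule L2_torusI)
  note L2_torusD(2)[OF assms(1), measurable]
  show "torus_periodic (\<lambda>x. c *\<^sub>R f x)"
    using L2_torusD(1)[OF assms(1)] by (simp add: torus_periodic_def)
  show "(\<lambda>x. c *\<^sub>R f x) \<in> borel_measurable borel" by measurable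
  show "integrable torus_measure (\<lambda>x. (norm (c *\<^sub>R f x))\<^sup>2)"
    using L2_torusD(3)[OF assms] by (simp add: power_mult_distrib)
qed

lemma L2_mult_bounded:
  fixes f g :: "real^2 \<Rightarrow> 'a::{real_normed_field, euclidean_space}"
  assumes "f \<in> L2_torus" "torus_periodic g" "g \<in> borel_measurable borel" "AE x in torus_measure. norm (g x) \<le> B"
  shows "(\<lambda>x. g x * f x) \<in> L2_torus"
proof (rule L2_torusI)
  note L2_torusD(2)[OF assms(1), measurable] assms(3)[measurable]
  show "torus_periodic (\<lambda>x. g x * f x)"
    using L2_torusD(1)[OF assms(1)] assms(2) by (simp add: torus_periodic_def)
  show "(\<lambda>x. g x * f x) \<in> borel_measurable borel" by measurable
  show "integrable torus_measure (\<lambda>x. (norm (g x * f x))\<^sup>2)"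
  proof (rule Bochner_Integration.integrable_bound)
    show "integrable torus_measure (\<lambda>x. B\<^sup>2 * (norm (f x))\<^sup>2)"
      using L2_torusD(3)[OF assms(1)] by simp
    show "AE x in torus_measure. norm ((norm (g x * f x))\<^sup>2) \<le> norm (B\<^sup>2 * (norm (f x))\<^sup>2)"
      using assms(4)
      by eventually_elim (simp add: norm_mult power_mult_distrib mult_right_mono power_mono)
  qed measurable
qed

lemma L2_diff: "f \<in> L2_torus \<Longrightarrow> g \<in> L2_torus \<Longrightarrow> (\<lambda>x. f x - g x) \<in> L2_torus"
  using L2_add[of f "\<lambda>x. (-1) *\<^sub>R g x"] L2_scaleR[of g "-1"] by simp

lemma L2_sum: "finite K \<Longrightarrow> (\<And>k. k \<in> K \<Longrightarrow> f k \<in> L2_torus) \<Longrightarrow> (\<lambda>x. \<Sum>k\<in>K. f k x) \<in> L2_torus"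
  by (induction K rule: finite_induct) (auto intro: L2_add L2_const[of 0])

lemma L2_bounded_linear:
  assumes "f \<in> L2_torus" "bounded_linear T"
  shows "(\<lambda>x. T (f x)) \<in> L2_torus"
proof (rule L2_torusI)
  interpret T: bounded_linear T by fact
  note L2_torusD(2)[OF assms(1), measurable]
  have [measurable]: "T \<in> borel_measurable borel"
    by (intro borel_measurable_continuous_onI T.continuous_on continuous_on_id)
  obtain B where B: "\<And>x. norm (T x) \<le> norm x * B"
    using T.bounded by blast
  show "torus_periodic (\<lambda>x. T (f x))"
    using L2_torusD(1)[OF assms(1)] by (simp add: torus_periodic_def)
  show "(\<lambda>x. T (f x)) \<in> borel_measurable borel" by measurable
  show "integrable torus_measure (\<lambda>x. (norm (T (f x)))\<^sup>2)"
  proof (rule Bochner_Integration.integrable_bound)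
    show "integrable torus_measure (\<lambda>x. (norm (f x))\<^sup>2 * B\<^sup>2)"
      using L2_torusD(3)[OF assms(1)] by simp
    show "AE x in torus_measure. norm ((norm (T (f x)))\<^sup>2) \<le> norm ((norm (f x))\<^sup>2 * B\<^sup>2)"
      using power_mono[OF B norm_ge_zero, of _ 2] by (auto simp: power_mult_distrib)
  qed measurable
qed

lemma L2_of_real_iff: "(\<lambda>x. complex_of_real (u x)) \<in> L2_torus \<longleftrightarrow> u \<in> L2_torus"
proof
  assume "(\<lambda>x. complex_of_real (u x)) \<in> L2_torus"
  from L2_bounded_linear[OF this bounded_linear_Re] show "u \<in> L2_torus" by simp
next
  assume "u \<in> L2_torus"
  from L2_bounded_linear[OF this bounded_linear_of_real]
  show "(\<lambda>x. complex_of_real (u x)) \<in> L2_torus" .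
qed

lemma nsq_of_real: "nsq (\<lambda>x. complex_of_real (u x)) = nsq u"
  by (simp add: nsq_def)

lemma nsq_minus_commute: "nsq (\<lambda>x. f x - g x) = nsq (\<lambda>x. g x - f x)"
  by (simp add: nsq_def norm_minus_commute)

lemma L2_Cauchy_Schwarz:
  assumes "f \<in> L2_torus" "g \<in> L2_torus"
  shows "tint (\<lambda>x. norm (f x) * norm (g x)) \<le> sqrt (nsq f) * sqrt (nsq g)"
proof -
  let ?c = "tint (\<lambda>x. norm (f x) * norm (g x))"
  have q: "0 \<le> nsq f - 2 * t * ?c + t\<^sup>2 * nsq g" for t
  proof -
    have "0 \<le> tint (\<lambda>x. (norm (f x) - t * norm (g x))\<^sup>2)"
      by simp
    also have "\<dots> = tint
        (\<lambda>x. (norm (f x))\<^sup>2 - 2 * t * (norm (f x) * norm (g x)) + t\<^sup>2 * (norm (g x))\<^sup>2)"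
      by (simp add: power2_diff power_mult_distrib algebra_simps)
    also have "\<dots> = nsq f - 2 * t * ?c + t\<^sup>2 * nsq g"
      unfolding nsq_def using L2_torusD(3)[OF assms(1)] L2_torusD(3)[OF assms(2)] L2_prod_norm[OF assms]
      by simp
    finally show ?thesis .
  qed
  have "?c\<^sup>2 \<le> nsq f * nsq g"
  proof (cases "nsq g = 0")
    case True
    have "?c = 0"
    proof (rule ccontr)
      assume "?c \<noteq> 0"
      \<comment> \<open>With \<open>nsq g = 0\<close> the quadratic in \<open>q\<close> is affine in
        t, and this t gives it the value -1.\<close>
      then show False using q[of "(nsq f + 1) / (2 * ?c)"] True by simp
    qed
    then show ?thesis by simp
  next
    case False
    then have "0 < nsq g" using nsq_nonneg[of g] by linarith
    then show ?thesis
      using q[of "?c / nsq g"] by (simp add: power2_eq_square field_simps)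
  qed
  then have "?c \<le> sqrt (nsq f * nsq g)"
    by (rule real_le_rsqrt)
  then show ?thesis by (simp add: real_sqrt_mult)
qed

lemma L1_le_L2:
  assumes "f \<in> L2_torus"
  shows "tint (\<lambda>x. norm (f x)) \<le> sqrt (nsq f)"
  using L2_Cauchy_Schwarz[OF assms L2_const[of "1::real"]] torus.prob_space
  by (simp add: nsq_def)

lemma nsq_add_le:
  assumes "f \<in> L2_torus" "g \<in> L2_torus"
  shows "nsq (\<lambda>x. f x + g x) \<le> 2 * nsq f + 2 * nsq g"
proof -
  have "nsq (\<lambda>x. f x + g x) \<le> tint (\<lambda>x. 2 * (norm (f x))\<^sup>2 + 2 * (norm (g x))\<^sup>2)"
    unfolding nsq_def
  proof (rule integral_mono)
    show "integrable torus_measure (\<lambda>x. (norm (f x + g x))\<^sup>2)"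
      by (intro L2_torusD(3) L2_add assms)
    show "integrable torus_measure (\<lambda>x. 2 * (norm (f x))\<^sup>2 + 2 * (norm (g x))\<^sup>2)"
      using assms L2_torusD(3) by (intro Bochner_Integration.integrable_add integrable_mult_right) auto
    fix x
    have "(norm (f x + g x))\<^sup>2 \<le> (norm (f x) + norm (g x))\<^sup>2"
      by (intro power_mono norm_triangle_ineq) auto
    also have "\<dots> \<le> 2 * (norm (f x))\<^sup>2 + 2 * (norm (g x))\<^sup>2"
      using zero_le_power2[of "norm (f x) - norm (g x)"] by (simp add: power2_eq_square algebra_simps)
    finally show "(norm (f x + g x))\<^sup>2 \<le> 2 * (norm (f x))\<^sup>2 + 2 * (norm (g x))\<^sup>2" .
  qed
  also have "\<dots> = 2 * nsq f + 2 * nsq g"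
    unfolding nsq_def using L2_torusD(3)[OF assms(1)] L2_torusD(3)[OF assms(2)] by simp
  finally show ?thesis .
qed

lemma L2_prod_tendsto:
  fixes f g :: "real^2 \<Rightarrow> 'a::{real_normed_field, euclidean_space}"
  assumes f: "\<And>n. F n \<in> L2_torus" "f \<in> L2_torus" "(\<lambda>n. nsq (\<lambda>x. F n x - f x)) \<longlonglongrightarrow> 0"
    and g: "\<And>n. G n \<in> L2_torus" "g \<in> L2_torus" "(\<lambda>n. nsq (\<lambda>x. G n x - g x)) \<longlonglongrightarrow> 0"
  shows "(\<lambda>n. tint (\<lambda>x. F n x * G n x)) \<longlonglongrightarrow> tint (\<lambda>x. f x * g x)"
proof -
  have df: "(\<lambda>x. F n x - f x) \<in> L2_torus" and dg: "(\<lambda>x. G n x - g x) \<in> L2_torus" for n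
    using f g by (auto intro: L2_diff)
  have "(\<lambda>n. tint (\<lambda>x. F n x * G n x) - tint (\<lambda>x. f x * g x)) \<longlonglongrightarrow> 0"
  proof (rule Lim_null_comparison)
    let ?A = "\<lambda>n. sqrt (nsq (\<lambda>x. F n x - f x))" and ?B = "\<lambda>n. sqrt (nsq (\<lambda>x. G n x - g x))"
    show "(\<lambda>n. ?A n * ?B n + ?A n * sqrt (nsq g) + sqrt (nsq f) * ?B n) \<longlonglongrightarrow> 0"
      using f(3) g(3) by (auto intro!: tendsto_eq_intros)
    show "\<forall>\<^sub>F n in sequentially. norm (tint (\<lambda>x. F n x * G n x) - tint (\<lambda>x. f x * g x))
       \<le> ?A n * ?B n + ?A n * sqrt (nsq g) + sqrt (nsq f) * ?B n"
    proof (intro always_eventually allI)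
      fix n
      have eq: "tint (\<lambda>x. F n x * G n x) - tint (\<lambda>x. f x * g x)
          = tint (\<lambda>x. (F n x - f x) * (G n x - g x) + (F n x - f x) * g x + f x * (G n x - g x))"
        by (subst Bochner_Integration.integral_diff[symmetric])
          (auto intro!: L2_prod f g Bochner_Integration.integral_cong simp: algebra_simps)
      have "norm (tint (\<lambda>x. F n x * G n x) - tint (\<lambda>x. f x * g x))
        \<le> tint (\<lambda>x. norm ((F n x - f x) * (G n x - g x) + (F n x - f x) * g x + f x * (G n x - g x)))"
        unfolding eq by (rule integral_norm_bound)
      also have "\<dots> \<le> tint (\<lambda>x. norm (F n x - f x) * norm (G n x - g x)
          + norm (F n x - f x) * norm (g x) + norm (f x) * norm (G n x - g x))"
      proof (rule integral_mono)
        show "integrable torus_measure (\<lambda>x. norm ((F n x - f x) * (G n x - g x) + (F n x - f x) * g x + f x * (G n x - g x)))"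
          using L2_prod[OF df[of n] dg[of n]] L2_prod[OF df[of n] g(2)] L2_prod[OF f(2) dg[of n]]
          by (intro integrable_norm Bochner_Integration.integrable_add)
        show "integrable torus_measure (\<lambda>x. norm (F n x - f x) * norm (G n x - g x)
          + norm (F n x - f x) * norm (g x) + norm (f x) * norm (G n x - g x))"
          using L2_prod_norm[OF df[of n] dg[of n]] L2_prod_norm[OF df[of n] g(2)] L2_prod_norm[OF f(2) dg[of n]]
          by (intro Bochner_Integration.integrable_add)
        fix x
        show "norm ((F n x - f x) * (G n x - g x) + (F n x - f x) * g x + f x * (G n x - g x))
          \<le> norm (F n x - f x) * norm (G n x - g x) + norm (F n x - f x) * norm (g x) + norm (f x) * norm (G n x - g x)"
          using norm_triangle_ineq[of "(F n x - f x) * (G n x - g x) + (F n x - f x) * g x" "f x * (G n x - g x)"]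
            norm_triangle_ineq[of "(F n x - f x) * (G n x - g x)" "(F n x - f x) * g x"]
          unfolding norm_mult by linarith
      qed
      also have "\<dots> = tint (\<lambda>x. norm (F n x - f x) * norm (G n x - g x))
          + tint (\<lambda>x. norm (F n x - f x) * norm (g x))
          + tint (\<lambda>x. norm (f x) * norm (G n x - g x))"
        using L2_prod_norm[OF df[of n] dg[of n]] L2_prod_norm[OF df[of n] g(2)] L2_prod_norm[OF f(2) dg[of n]]
        by simp
      also have "\<dots> \<le> ?A n * ?B n + ?A n * sqrt (nsq g) + sqrt (nsq f) * ?B n"
        by (intro add_mono L2_Cauchy_Schwarz df dg f g)
      finally show "norm (tint (\<lambda>x. F n x * G n x) - tint (\<lambda>x. f x * g x))
        \<le> ?A n * ?B n + ?A n * sqrt (nsq g) + sqrt (nsq f) * ?B n" .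
    qed
  qed
  then show ?thesis by (rule LIM_zero_cancel)
qed

lemma nsq_tendsto:
  assumes f: "\<And>n. F n \<in> L2_torus" "f \<in> L2_torus" "(\<lambda>n. nsq (\<lambda>x. F n x - f x)) \<longlonglongrightarrow> 0"
  shows "(\<lambda>n. nsq (F n)) \<longlonglongrightarrow> nsq f"
proof -
  have L: "(\<lambda>x. norm (h x)) \<in> L2_torus" if "h \<in> L2_torus" for h :: "real^2 \<Rightarrow> 'a"
  proof (rule L2_torusI)
    note L2_torusD(2)[OF that, measurable]
    show "(\<lambda>x. norm (h x)) \<in> borel_measurable borel" by measurable
  qed (use L2_torusD[OF that] in \<open>auto simp: torus_periodic_def\<close>)
  have lim: "(\<lambda>n. nsq (\<lambda>x. norm (F n x) - norm (f x))) \<longlonglongrightarrow> 0"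
  proof (rule Lim_null_comparison[OF _ f(3)])
    show "\<forall>\<^sub>F n in sequentially. norm (nsq (\<lambda>x. norm (F n x) - norm (f x))) \<le> nsq (\<lambda>x. F n x - f x)"
    proof (intro always_eventually allI)
      fix n
      have "nsq (\<lambda>x. norm (F n x) - norm (f x)) \<le> nsq (\<lambda>x. F n x - f x)"
        unfolding nsq_def
        by (intro integral_mono L2_torusD(3) L2_diff L f power_mono) (auto simp: norm_triangle_ineq3)
      then show "norm (nsq (\<lambda>x. norm (F n x) - norm (f x))) \<le> nsq (\<lambda>x. F n x - f x)" by simp
    qed
  qed
  have "(\<lambda>n. tint (\<lambda>x. norm (F n x) * norm (F n x))) \<longlonglongrightarrow> tint (\<lambda>x. norm (f x) * norm (f x))"
    by (rule L2_prod_tendsto) (use f L lim in auto)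
  then show ?thesis by (simp add: nsq_def power2_eq_square)
qed

text \<open>A rapidly Cauchy subsequence converges almost everywhere, and Fatou's lemma transfers
  the Cauchy bound to its limit. The subsequence is part of the conclusion because it later carries
  the constraint |m| = 1 to the limit.\<close>

lemma L2_complete:
  fixes f :: "nat \<Rightarrow> real^2 \<Rightarrow> 'a::euclidean_space"
  assumes f: "\<And>n. f n \<in> L2_torus"
    and Cauchy: "\<And>e. 0 < e \<Longrightarrow> \<exists>N. \<forall>m\<ge>N. \<forall>n\<ge>N. nsq (\<lambda>x. f m x - f n x) < e"
  obtains g r where "g \<in> L2_torus" "(\<lambda>n. nsq (\<lambda>x. f n x - g x)) \<longlonglongrightarrow> 0" "strict_mono (r :: nat \<Rightarrow> nat)"
    "AE x in torus_measure. (\<lambda>n. f (r n) x) \<longlonglongrightarrow> g x"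
proof -
  have fm [measurable]: "f n \<in> borel_measurable borel" for n
    using L2_torusD(2)[OF f] .
  have "\<forall>k. \<exists>N. \<forall>m\<ge>N. \<forall>n\<ge>N. nsq (\<lambda>x. f m x - f n x) < (1/4)^k"
    by (intro allI Cauchy) simp
  then obtain N where N: "\<And>k m n. m \<ge> N k \<Longrightarrow> n \<ge> N k \<Longrightarrow> nsq (\<lambda>x. f m x - f n x) < (1/4)^k"
    by metis
  define r where "r k = k + (\<Sum>i\<le>k. N i)" for k
  have r_mono: "strict_mono r"
    by (rule strict_monoI_Suc) (simp add: r_def)
  have r_ge: "N k \<le> r k" for k
    using member_le_sum[of k "{..k}" N] by (auto simp: r_def intro: trans_le_add2)
  define d where "d k x = f (r (Suc k)) x - f (r k) x" for k x
  have dL: "d k \<in> L2_torus" for k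
    unfolding d_def by (intro L2_diff f)
  have dm [measurable]: "d k \<in> borel_measurable borel" for k
    using L2_torusD(2)[OF dL] .
  have d_int: "tint (\<lambda>x. norm (d k x)) \<le> (1/2)^k" for k
  proof -
    have "r k \<le> r (Suc k)" using r_mono by (simp add: strict_mono_less_eq)
    then have "nsq (d k) \<le> (1/4)^k"
      unfolding d_def using r_ge[of k] N[of k "r (Suc k)" "r k"] by simp
    then have "sqrt (nsq (d k)) \<le> sqrt ((1/4)^k)" by simp
    also have "sqrt ((1/4)^k) = (1/2::real)^k"
      by (simp add: real_sqrt_power real_sqrt_divide)
    finally show ?thesis using L1_le_L2[OF dL[of k]] by linarith
  qed
  have "(\<integral>\<^sup>+x. (\<Sum>k. ennreal (norm (d k x))) \<partial>torus_measure) = (\<Sum>k. \<integral>\<^sup>+x. ennreal (norm (d k x)) \<partial>torus_measure)"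
    by (rule nn_integral_suminf) measurable
  also have "\<dots> \<le> (\<Sum>k. ennreal ((1/2)^k))"
  proof (rule suminf_le)
    fix k show "(\<integral>\<^sup>+x. ennreal (norm (d k x)) \<partial>torus_measure) \<le> ennreal ((1/2)^k)"
      using L2_norm_integrable[OF dL[of k]] d_int[of k]
      by (subst nn_integral_eq_integral) (auto intro: ennreal_leI)
  qed auto
  also have "\<dots> = ennreal (\<Sum>k. (1/2)^k)"
    by (rule suminf_ennreal2) (auto intro: summable_geometric)
  also have "\<dots> < \<infinity>" by simp
  finally have "(\<integral>\<^sup>+x. (\<Sum>k. ennreal (norm (d k x))) \<partial>torus_measure) \<noteq> \<infinity>"
    by simp
  then have "AE x in torus_measure. (\<Sum>k. ennreal (norm (d k x))) \<noteq> \<infinity>"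
    by (intro nn_integral_noteq_infinite) auto
  then have conv: "AE x in torus_measure. convergent (\<lambda>n. f (r n) x)"
  proof eventually_elim
    case (elim x)
    then have "summable (\<lambda>k. norm (d k x))"
      by (intro summable_suminf_not_top) auto
    then have "summable (\<lambda>k. d k x)" by (rule summable_norm_cancel)
    then have "convergent (\<lambda>n. \<Sum>k<n. d k x)" by (simp add: summable_iff_convergent)
    moreover have "(\<Sum>k<n. d k x) = f (r n) x - f (r 0) x" for n
      unfolding d_def by (rule sum_lessThan_telescope)
    ultimately have "convergent (\<lambda>n. (f (r n) x - f (r 0) x) + f (r 0) x)"
      by (intro convergent_add convergent_const) simp
    then show ?case by simp
  qed
  \<comment> \<open>Even where the sequence diverges, \<open>lim\<close> depends on the sequence
    alone, so \<open>g\<close> is periodic at every point of the plane.\<close>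
  define g where "g x = lim (\<lambda>n. f (r n) x)" for x
  have gm [measurable]: "g \<in> borel_measurable borel"
    unfolding g_def by measurable
  have g_per: "torus_periodic g"
    unfolding g_def torus_periodic_def using L2_torusD(1)[OF f] by (simp add: torus_periodic_def)
  have lim: "AE x in torus_measure. (\<lambda>n. f (r n) x) \<longlonglongrightarrow> g x"
    using conv unfolding g_def by eventually_elim (simp add: convergent_LIMSEQ_iff)
  have fatou: "(\<integral>\<^sup>+x. ennreal ((norm (f n x - g x))\<^sup>2) \<partial>torus_measure) \<le> ennreal e"
    if "0 < e" "\<forall>m\<ge>M. nsq (\<lambda>x. f n x - f m x) < e" for n e M
  proof -
    have "(\<integral>\<^sup>+x. ennreal ((norm (f n x - g x))\<^sup>2) \<partial>torus_measure)
        = (\<integral>\<^sup>+x. liminf (\<lambda>j. ennreal ((norm (f n x - f (r j) x))\<^sup>2)) \<partial>torus_measure)"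
    proof (rule nn_integral_cong_AE)
      show "AE x in torus_measure. ennreal ((norm (f n x - g x))\<^sup>2) = liminf (\<lambda>j. ennreal ((norm (f n x - f (r j) x))\<^sup>2))"
        using lim
      proof eventually_elim
        case (elim x)
        then have "(\<lambda>j. ennreal ((norm (f n x - f (r j) x))\<^sup>2)) \<longlonglongrightarrow> ennreal ((norm (f n x - g x))\<^sup>2)"
          by (intro tendsto_intros)
        then show ?case by (rule lim_imp_Liminf[OF trivial_limit_sequentially, symmetric])
      qed
    qed
    also have "\<dots> \<le> liminf (\<lambda>j. \<integral>\<^sup>+x. ennreal ((norm (f n x - f (r j) x))\<^sup>2) \<partial>torus_measure)"
      by (rule nn_integral_liminf) measurable
    also have "\<dots> \<le> ennreal e"
    proof (rule Liminf_le)
      have "eventually (\<lambda>j. r j \<ge> M) sequentially"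
        using r_mono by (meson eventually_sequentiallyI le_trans seq_suble)
      then show "\<forall>\<^sub>F j in sequentially. (\<integral>\<^sup>+x. ennreal ((norm (f n x - f (r j) x))\<^sup>2) \<partial>torus_measure) \<le> ennreal e"
      proof eventually_elim
        case (elim j)
        then have "nsq (\<lambda>x. f n x - f (r j) x) \<le> e" using that by (auto intro: less_imp_le)
        then show ?case
          unfolding nsq_def using L2_torusD(3)[OF L2_diff[OF f[of n] f[of "r j"]]]
          by (subst nn_integral_eq_integral) (auto intro: ennreal_leI)
      qed
    qed simp
    finally show ?thesis .
  qed
  have dg: "(\<lambda>x. f n x - g x) \<in> L2_torus" and dg_le: "nsq (\<lambda>x. f n x - g x) \<le> e"
    if "0 < e" "\<forall>m\<ge>M. nsq (\<lambda>x. f n x - f m x) < e" for n e M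
  proof -
    have int: "integrable torus_measure (\<lambda>x. (norm (f n x - g x))\<^sup>2)"
      using fatou[OF that] by (intro integrableI_nonneg) (auto simp: order.strict_trans1 less_top[symmetric] top_unique)
    then show "(\<lambda>x. f n x - g x) \<in> L2_torus"
      using L2_torusD(1)[OF f[of n]] g_per by (intro L2_torusI) (auto simp: torus_periodic_def)
    show "nsq (\<lambda>x. f n x - g x) \<le> e"
      using fatou[OF that] that(1) unfolding nsq_def
      by (subst (asm) nn_integral_eq_integral[OF int]) auto
  qed
  have "g \<in> L2_torus"
  proof -
    obtain N where "\<forall>m\<ge>N. \<forall>n\<ge>N. nsq (\<lambda>x. f m x - f n x) < 1" using Cauchy[of 1] by auto
    then have "(\<lambda>x. f N x - g x) \<in> L2_torus" by (intro dg[of 1 N]) auto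
    from L2_diff[OF f[of N] this] show ?thesis by simp
  qed
  moreover have "(\<lambda>n. nsq (\<lambda>x. f n x - g x)) \<longlonglongrightarrow> 0"
  proof (rule LIMSEQ_I)
    fix e :: real assume "0 < e"
    then obtain N where "\<forall>m\<ge>N. \<forall>n\<ge>N. nsq (\<lambda>x. f m x - f n x) < e / 2" using Cauchy[of "e/2"] by auto
    then have "nsq (\<lambda>x. f n x - g x) \<le> e / 2" if "n \<ge> N" for n
      using \<open>0 < e\<close> that by (intro dg_le[of _ N]) auto
    then show "\<exists>N. \<forall>n\<ge>N. norm (nsq (\<lambda>x. f n x - g x) - 0) < e"
      using \<open>0 < e\<close> by (intro exI[of _ N]) (auto intro: le_less_trans[of _ "e / 2"])
  qed
  ultimately show thesis using that r_mono lim by blast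
qed

subsection \<open>Fourier series\<close>

definition tpoly :: "(real^2) set \<Rightarrow> (real^2 \<Rightarrow> complex) \<Rightarrow> real^2 \<Rightarrow> complex" where
  "tpoly K c x = (\<Sum>k\<in>K. c k * torus_char k x)"

lemma L2_torus_char: "k \<in> dual_lattice \<Longrightarrow> torus_char k \<in> L2_torus"
  by (rule L2_bounded[where B = 1]) (auto simp: torus_char_periodic)

lemma L2_cmult:
  fixes c :: complex
  assumes "f \<in> L2_torus" shows "(\<lambda>x. c * f x) \<in> L2_torus"
  by (rule L2_bounded_linear[OF assms bounded_linear_mult_right])

lemma L2_cnj:
  assumes "f \<in> L2_torus" shows "(\<lambda>x. cnj (f x)) \<in> L2_torus"
  by (rule L2_bounded_linear[OF assms bounded_linear_cnj])

lemma L2_tpoly: "finite K \<Longrightarrow> K \<subseteq> dual_lattice \<Longrightarrow> tpoly K c \<in> L2_torus"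
  unfolding tpoly_def[abs_def] by (intro L2_sum L2_cmult L2_torus_char) auto

lemma fcoef_integrable:
  assumes "u \<in> L2_torus" "k \<in> dual_lattice"
  shows "integrable torus_measure (\<lambda>x. cnj (torus_char k x) * u x)"
  by (intro L2_prod L2_cnj L2_torus_char assms)

lemma fcoef_add:
  assumes "u \<in> L2_torus" "v \<in> L2_torus" "k \<in> dual_lattice"
  shows "fcoef (\<lambda>x. u x + v x) k = fcoef u k + fcoef v k"
  unfolding fcoef_def using fcoef_integrable[OF assms(1,3)] fcoef_integrable[OF assms(2,3)]
  by (simp add: distrib_left)

lemma fcoef_diff:
  assumes "u \<in> L2_torus" "v \<in> L2_torus" "k \<in> dual_lattice"
  shows "fcoef (\<lambda>x. u x - v x) k = fcoef u k - fcoef v k"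
  unfolding fcoef_def using fcoef_integrable[OF assms(1,3)] fcoef_integrable[OF assms(2,3)]
  by (simp add: right_diff_distrib)

lemma fcoef_cmult: "fcoef (\<lambda>x. c * u x) k = c * fcoef u k"
  unfolding fcoef_def by (simp add: mult.left_commute)

lemma fcoef_char:
  assumes "k \<in> dual_lattice" "l \<in> dual_lattice"
  shows "fcoef (torus_char l) k = of_bool (l = k)"
proof -
  have "fcoef (torus_char l) k = tint (torus_char (l - k))"
    unfolding fcoef_def
    by (intro Bochner_Integration.integral_cong refl)
      (use torus_char_add[of l "- k"] in \<open>simp add: torus_char_uminus mult.commute\<close>)
  also have "\<dots> = of_bool (l - k = 0)"
    by (intro integral_torus_char dual_lattice_diff assms)
  finally show ?thesis by simp
qed

lemma fcoef_tpoly: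
  assumes "finite K" "K \<subseteq> dual_lattice" "l \<in> dual_lattice"
  shows "fcoef (tpoly K c) l = (if l \<in> K then c l else 0)"
proof -
  have "fcoef (tpoly K c) l = (\<Sum>k\<in>K. fcoef (\<lambda>x. c k * torus_char k x) l)"
    unfolding fcoef_def tpoly_def sum_distrib_left
    using assms by (intro Bochner_Integration.integral_sum)
      (auto intro!: fcoef_integrable[unfolded fcoef_def] L2_cmult L2_torus_char)
  also have "\<dots> = (\<Sum>k\<in>K. if k = l then c k else 0)"
    using assms by (intro sum.cong refl) (auto simp: fcoef_cmult fcoef_char)
  also have "\<dots> = (if l \<in> K then c l else 0)"
    using assms(1) by simp
  finally show ?thesis .
qed

lemma of_real_nsq:
  "complex_of_real (nsq u) = tint (\<lambda>x. cnj (u x) * u x)"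
proof -
  have "complex_of_real (nsq u) = tint (\<lambda>x. complex_of_real ((norm (u x))\<^sup>2))"
    unfolding nsq_def by (rule integral_complex_of_real[symmetric])
  also have "\<dots> = tint (\<lambda>x. cnj (u x) * u x)"
    by (intro Bochner_Integration.integral_cong refl) (simp only: complex_norm_square mult.commute)
  finally show ?thesis .
qed

lemma integral_cnj_tpoly:
  assumes "finite K" "K \<subseteq> dual_lattice" "u \<in> L2_torus"
  shows "tint (\<lambda>x. cnj (tpoly K c x) * u x) = (\<Sum>k\<in>K. cnj (c k) * fcoef u k)"
proof -
  have "tint (\<lambda>x. cnj (tpoly K c x) * u x)
      = tint (\<lambda>x. \<Sum>k\<in>K. cnj (c k) * (cnj (torus_char k x) * u x))"
    unfolding tpoly_def by (simp add: sum_distrib_right mult.assoc)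
  also have "\<dots> = (\<Sum>k\<in>K. cnj (c k) * fcoef u k)"
    unfolding fcoef_def using assms
    by (subst Bochner_Integration.integral_sum) (auto intro!: integrable_mult_right fcoef_integrable)
  finally show ?thesis .
qed

lemma nsq_tpoly:
  assumes "finite K" "K \<subseteq> dual_lattice"
  shows "nsq (tpoly K c) = (\<Sum>k\<in>K. (norm (c k))\<^sup>2)"
proof -
  have "complex_of_real (nsq (tpoly K c)) = (\<Sum>k\<in>K. cnj (c k) * fcoef (tpoly K c) k)"
    unfolding of_real_nsq by (intro integral_cnj_tpoly L2_tpoly assms)
  also have "\<dots> = (\<Sum>k\<in>K. of_real ((norm (c k))\<^sup>2))"
  proof (rule sum.cong)
    fix k assume "k \<in> K"
    then have "fcoef (tpoly K c) k = c k"
      using fcoef_tpoly[OF assms, of k c] assms(2) by auto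
    then show "cnj (c k) * fcoef (tpoly K c) k = of_real ((norm (c k))\<^sup>2)"
      by (simp only: complex_norm_square mult.commute)
  qed simp
  also have "\<dots> = complex_of_real (\<Sum>k\<in>K. (norm (c k))\<^sup>2)" by simp
  finally show ?thesis by (simp only: of_real_eq_iff)
qed

text \<open>Pythagoras: the partial Fourier sum is the orthogonal projection onto the span of the
  characters in K.\<close>

lemma nsq_diff_tpoly:
  assumes "finite K" "K \<subseteq> dual_lattice" "u \<in> L2_torus"
  shows "nsq (\<lambda>x. u x - tpoly K (fcoef u) x) = nsq u - (\<Sum>k\<in>K. (norm (fcoef u k))\<^sup>2)"
proof -
  let ?w = "tpoly K (fcoef u)"
  have w: "?w \<in> L2_torus" by (intro L2_tpoly assms)
  have wu: "tint (\<lambda>x. cnj (?w x) * u x) = of_real (\<Sum>k\<in>K. (norm (fcoef u k))\<^sup>2)"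
    unfolding integral_cnj_tpoly[OF assms] of_real_sum
    by (intro sum.cong refl) (simp only: complex_norm_square mult.commute)
  have "tint (\<lambda>x. cnj (u x) * ?w x)
      = tint (\<lambda>x. cnj (cnj (?w x) * u x))"
    by (simp add: mult.commute)
  also have "\<dots> = cnj (tint (\<lambda>x. cnj (?w x) * u x))"
    by (intro integral_bounded_linear bounded_linear_cnj L2_prod L2_cnj w assms)
  finally have uw: "tint (\<lambda>x. cnj (u x) * ?w x) = of_real (\<Sum>k\<in>K. (norm (fcoef u k))\<^sup>2)"
    unfolding wu by simp
  have ww: "tint (\<lambda>x. cnj (?w x) * ?w x) = of_real (\<Sum>k\<in>K. (norm (fcoef u k))\<^sup>2)"
    unfolding of_real_nsq[symmetric] nsq_tpoly[OF assms(1,2)] ..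
  have uu: "tint (\<lambda>x. cnj (u x) * u x) = of_real (nsq u)"
    unfolding of_real_nsq ..
  have i: "integrable torus_measure (\<lambda>x. cnj (f x) * g x)" if "f \<in> L2_torus" "g \<in> L2_torus" for f g
    by (intro L2_prod L2_cnj that)
  have "complex_of_real (nsq (\<lambda>x. u x - ?w x))
     = tint (\<lambda>x. cnj (u x) * u x - cnj (u x) * ?w x - cnj (?w x) * u x + cnj (?w x) * ?w x)"
    unfolding of_real_nsq by (intro Bochner_Integration.integral_cong refl) (simp add: algebra_simps)
  also have "\<dots> = of_real (nsq u - (\<Sum>k\<in>K. (norm (fcoef u k))\<^sup>2))"
    by (simp add: i assms(3) w uu uw wu ww)
  finally show ?thesis by (simp only: of_real_eq_iff)
qed

lemma Bessel:
  assumes "finite K" "K \<subseteq> dual_lattice" "u \<in> L2_torus"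
  shows "(\<Sum>k\<in>K. (norm (fcoef u k))\<^sup>2) \<le> nsq u"
  using nsq_diff_tpoly[OF assms] nsq_nonneg[of "\<lambda>x. u x - tpoly K (fcoef u) x"] by linarith

lemma fcoef_diff_bound:
  assumes "u \<in> L2_torus" "v \<in> L2_torus" "k \<in> dual_lattice"
  shows "(norm (fcoef u k - fcoef v k))\<^sup>2 \<le> nsq (\<lambda>x. u x - v x)"
  using Bessel[of "{k}" "\<lambda>x. u x - v x"] assms by (simp add: fcoef_diff L2_diff)

lemma fcoef_tendsto:
  assumes "\<And>n. u n \<in> L2_torus" "v \<in> L2_torus" "(\<lambda>n. nsq (\<lambda>x. u n x - v x)) \<longlonglongrightarrow> 0" "k \<in> dual_lattice"
  shows "(\<lambda>n. fcoef (u n) k) \<longlonglongrightarrow> fcoef v k"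
proof -
  have "(\<lambda>n. (norm (fcoef (u n) k - fcoef v k))\<^sup>2) \<longlonglongrightarrow> 0"
    by (rule Lim_null_comparison[OF _ assms(3)])
      (use fcoef_diff_bound[OF assms(1,2,4)] in \<open>auto intro!: always_eventually\<close>)
  then have "(\<lambda>n. norm (fcoef (u n) k - fcoef v k)) \<longlonglongrightarrow> 0"
    using tendsto_real_sqrt[of "\<lambda>n. (norm (fcoef (u n) k - fcoef v k))\<^sup>2" 0 sequentially] by simp
  then show ?thesis
    using LIM_zero_cancel tendsto_norm_zero_cancel by metis
qed

text \<open>Unordered summation over the lattice specializes to square partial sums; for nonnegative
  terms \<open>has_sum_dual_boxI\<close> gives the converse.\<close>

lemma filterlim_dual_box: "filterlim dual_box (finite_subsets_at_top dual_lattice) sequentially"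
  unfolding filterlim_finite_subsets_at_top
proof safe
  fix K assume "finite K" "K \<subseteq> dual_lattice"
  then obtain n where n: "K \<subseteq> dual_box n" by (rule dual_box_exhaust)
  then have "K \<subseteq> dual_box m" if "m \<ge> n" for m using dual_box_mono[OF that] by blast
  then show "\<forall>\<^sub>F m in sequentially. finite (dual_box m) \<and> K \<subseteq> dual_box m \<and> dual_box m \<subseteq> dual_lattice"
    using dual_box_subset by (auto simp: eventually_sequentially)
qed

lemma has_sum_dual_boxD:
  "(f has_sum a) dual_lattice \<Longrightarrow> (\<lambda>n. \<Sum>k\<in>dual_box n. f k) \<longlonglongrightarrow> a"
  unfolding has_sum_def by (rule filterlim_compose[OF _ filterlim_dual_box])

lemma has_sum_dual_boxI:
  fixes f :: "real^2 \<Rightarrow> real"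
  assumes nn: "\<And>k. k \<in> dual_lattice \<Longrightarrow> 0 \<le> f k" and lim: "(\<lambda>n. \<Sum>k\<in>dual_box n. f k) \<longlonglongrightarrow> a"
  shows "(f has_sum a) dual_lattice"
proof -
  have mono: "incseq (\<lambda>n. \<Sum>k\<in>dual_box n. f k)"
    by (intro incseq_SucI sum_mono2 finite_dual_box dual_box_mono) (use nn dual_box_subset in auto)
  have "f summable_on dual_lattice"
  proof (rule nonneg_bdd_above_summable_on[OF nn])
    show "bdd_above (sum f ` {F. F \<subseteq> dual_lattice \<and> finite F})"
    proof (rule bdd_aboveI2[of _ _ a])
      fix F assume "F \<in> {F. F \<subseteq> dual_lattice \<and> finite F}"
      then obtain n where "F \<subseteq> dual_box n" by (auto elim: dual_box_exhaust)
      then have "sum f F \<le> sum f (dual_box n)"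
        using nn dual_box_subset by (intro sum_mono2) auto
      also have "\<dots> \<le> a" by (rule incseq_le[OF mono lim])
      finally show "sum f F \<le> a" .
    qed
  qed
  then obtain b where b: "(f has_sum b) dual_lattice" by (auto simp: summable_on_def)
  from has_sum_dual_boxD[OF b] lim have "a = b" by (rule LIMSEQ_unique[symmetric])
  then show ?thesis using b by simp
qed

text \<open>A difference of partial sums is again a trigonometric polynomial, so its squared norm is
  a difference of partial sums of the given numerical series.\<close>

lemma Riesz_Fischer:
  assumes c: "(\<lambda>k. (norm (c k))\<^sup>2) summable_on dual_lattice"
  obtains v where "v \<in> L2_torus" "(\<lambda>n. nsq (\<lambda>x. tpoly (dual_box n) c x - v x)) \<longlonglongrightarrow> 0"
    "\<And>k. k \<in> dual_lattice \<Longrightarrow> fcoef v k = c k"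
proof -
  let ?p = "\<lambda>n. tpoly (dual_box n) c"
  let ?s = "\<lambda>n. \<Sum>k\<in>dual_box n. (norm (c k))\<^sup>2"
  have p: "?p n \<in> L2_torus" for n by (intro L2_tpoly finite_dual_box dual_box_subset)
  obtain a where "((\<lambda>k. (norm (c k))\<^sup>2) has_sum a) dual_lattice" using c by (auto simp: summable_on_def)
  then have s_lim: "?s \<longlonglongrightarrow> a" by (rule has_sum_dual_boxD)
  have diff: "nsq (\<lambda>x. ?p m x - ?p n x) = ?s m - ?s n" if "n \<le> m" for m n
  proof -
    have "?p m x - ?p n x = tpoly (dual_box m - dual_box n) c x" for x
      unfolding tpoly_def using dual_box_mono[OF that] by (subst sum_diff) auto
    then have "nsq (\<lambda>x. ?p m x - ?p n x) = (\<Sum>k\<in>dual_box m - dual_box n. (norm (c k))\<^sup>2)"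
      using nsq_tpoly[of "dual_box m - dual_box n" c] dual_box_subset[of m] by auto
    then show ?thesis using dual_box_mono[OF that] by (simp add: sum_diff)
  qed
  have Cauchy: "\<exists>N. \<forall>m\<ge>N. \<forall>n\<ge>N. nsq (\<lambda>x. ?p m x - ?p n x) < e" if "0 < e" for e
  proof -
    have "Cauchy ?s" using s_lim by (rule LIMSEQ_imp_Cauchy)
    then obtain N where N: "\<And>m n. m \<ge> N \<Longrightarrow> n \<ge> N \<Longrightarrow> norm (?s m - ?s n) < e"
      using CauchyD[OF _ \<open>0 < e\<close>] by blast
    have "nsq (\<lambda>x. ?p m x - ?p n x) < e" if "m \<ge> N" "n \<ge> N" for m n
    proof (cases "n \<le> m")
      case True then show ?thesis using diff[OF True] N[OF that] by simp
    next
      case False then show ?thesis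
        using diff[of m n] N[OF that(2,1)] nsq_minus_commute[of "?p m" "?p n"] by simp
    qed
    then show ?thesis by blast
  qed
  obtain v r where v: "v \<in> L2_torus" "(\<lambda>n. nsq (\<lambda>x. ?p n x - v x)) \<longlonglongrightarrow> 0"
    by (rule L2_complete[of ?p, OF p Cauchy])
  have "fcoef v k = c k" if k: "k \<in> dual_lattice" for k
  proof -
    have l1: "(\<lambda>n. fcoef (?p n) k) \<longlonglongrightarrow> fcoef v k"
      by (rule fcoef_tendsto[OF p v k])
    obtain n where n: "{k} \<subseteq> dual_box n" using dual_box_exhaust[of "{k}"] k by auto
    have "fcoef (?p m) k = c k" if "m \<ge> n" for m
      using fcoef_tpoly[of "dual_box m" k c] dual_box_subset[of m] k n dual_box_mono[OF that] by auto
    then have "eventually (\<lambda>m. fcoef (?p m) k = c k) sequentially"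
      by (auto simp: eventually_sequentially)
    then have "(\<lambda>n. fcoef (?p n) k) \<longlonglongrightarrow> c k" by (rule tendsto_eventually)
    then show ?thesis using l1 LIMSEQ_unique by blast
  qed
  then show thesis using that v by blast
qed

lemma fcoef_summable:
  assumes "u \<in> L2_torus"
  shows "(\<lambda>k. (norm (fcoef u k))\<^sup>2) summable_on dual_lattice"
  by (rule nonneg_bdd_above_summable_on) (use Bessel[OF _ _ assms] in \<open>auto intro!: bdd_aboveI2[of _ _ "nsq u"]\<close>)

lemma L2_fcoef_unique:
  assumes "u \<in> L2_torus" "v \<in> L2_torus" "\<And>k. k \<in> dual_lattice \<Longrightarrow> fcoef u k = fcoef v k"
  shows "AE x in torus_measure. u x = v x"
proof -
  have d: "(\<lambda>x. u x - v x) \<in> L2_torus" by (intro L2_diff assms)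
  have "AE x in torus_measure. u x - v x = 0"
    by (rule fourier_uniqueness[OF L2_torusD(2)[OF d] L2_integrable[OF d]])
      (simp add: fcoef_diff assms)
  then show ?thesis by eventually_elim simp
qed

lemma nsq_cong_AE:
  assumes "AE x in torus_measure. u x = v x" "u \<in> borel_measurable borel" "v \<in> borel_measurable borel"
  shows "nsq u = nsq v"
proof -
  note assms(2,3)[measurable]
  show ?thesis unfolding nsq_def
    by (rule integral_cong_AE) (use assms(1) in \<open>auto elim: eventually_mono\<close>)
qed

text \<open>Completeness of the characters: the Riesz-Fischer sum of the coefficients of u has the
  same coefficients as u, so by uniqueness it equals u almost everywhere.\<close>

theorem fourier_series_tendsto:
  assumes u: "u \<in> L2_torus"
  shows "(\<lambda>n. nsq (\<lambda>x. tpoly (dual_box n) (fcoef u) x - u x)) \<longlonglongrightarrow> 0"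
proof -
  obtain v where v: "v \<in> L2_torus" "(\<lambda>n. nsq (\<lambda>x. tpoly (dual_box n) (fcoef u) x - v x)) \<longlonglongrightarrow> 0"
    and c: "\<And>k. k \<in> dual_lattice \<Longrightarrow> fcoef v k = fcoef u k"
    by (rule Riesz_Fischer[OF fcoef_summable[OF u]]) blast
  have ae: "AE x in torus_measure. v x = u x" by (rule L2_fcoef_unique[OF v(1) u c])
  have "nsq (\<lambda>x. tpoly (dual_box n) (fcoef u) x - v x) = nsq (\<lambda>x. tpoly (dual_box n) (fcoef u) x - u x)" for n
  proof (rule nsq_cong_AE)
    show "AE x in torus_measure. tpoly (dual_box n) (fcoef u) x - v x = tpoly (dual_box n) (fcoef u) x - u x"
      using ae by eventually_elim simp
    have "tpoly (dual_box n) (fcoef u) \<in> L2_torus"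
      by (intro L2_tpoly finite_dual_box dual_box_subset)
    then show "(\<lambda>x. tpoly (dual_box n) (fcoef u) x - v x) \<in> borel_measurable borel"
      "(\<lambda>x. tpoly (dual_box n) (fcoef u) x - u x) \<in> borel_measurable borel"
      using u v by (auto intro: L2_torusD(2) L2_diff)
  qed
  then show ?thesis using v by simp
qed

theorem Parseval:
  assumes u: "u \<in> L2_torus"
  shows "((\<lambda>k. (norm (fcoef u k))\<^sup>2) has_sum nsq u) dual_lattice"
proof (rule has_sum_dual_boxI)
  have "(\<lambda>n. nsq (tpoly (dual_box n) (fcoef u))) \<longlonglongrightarrow> nsq u"
    by (rule nsq_tendsto[OF _ u fourier_series_tendsto[OF u]]) (intro L2_tpoly finite_dual_box dual_box_subset)
  then show "(\<lambda>n. \<Sum>k\<in>dual_box n. (norm (fcoef u k))\<^sup>2) \<longlonglongrightarrow> nsq u"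
    by (simp add: nsq_tpoly dual_box_subset)
qed simp

subsection \<open>Weak gradients in Fourier space\<close>

lemma has_derivative_cos_wave:
  fixes k :: "real^2"
  shows "((\<lambda>x. a * cos (k \<bullet> x + s)) has_derivative (\<lambda>h. - a * sin (k \<bullet> x + s) * (k \<bullet> h))) (at x)"
  by (auto intro!: derivative_eq_intros)

text \<open>Each partial derivative multiplies by a component of k and advances the phase by
  \<pi>/2, which gives derivatives of all orders in one formula. The free phase s covers sine waves
  as well.\<close>

lemma cos_wave_test:
  assumes "k \<in> dual_lattice"
  shows "torus_test_function (\<lambda>x. cos (k \<bullet> x + s))"
  unfolding torus_test_function_def
proof
  show "torus_periodic (\<lambda>x. cos (k \<bullet> x + s))"
    unfolding torus_periodic_def
  proof safe
    fix x i
    have "torus_char k (x + axis i 1) = torus_char k x"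
      using torus_char_periodic[OF assms] by (simp add: torus_periodic_def)
    then show "cos (k \<bullet> (x + axis i 1) + s) = cos (k \<bullet> x + s)"
      unfolding torus_char_def by (simp add: cos_add complex_eq_iff)
  qed
  have inner2: "k \<bullet> h = k $ 1 * h $ 1 + k $ 2 * h $ 2" for h :: "real^2"
    by (simp add: inner_vec_def sum_2)
  define D where "D a b x = (k $ 1) ^ a * (k $ 2) ^ b * cos (k \<bullet> x + (s + real (a + b) * (pi / 2)))" for a b :: nat and x
  have shift: "cos (t + (s + real (Suc n) * (pi / 2))) = - sin (t + (s + real n * (pi / 2)))" for t n
  proof -
    have "t + (s + real (Suc n) * (pi / 2)) = (t + (s + real n * (pi / 2))) + pi / 2"
      by (simp add: algebra_simps add_divide_distrib)
    then show ?thesis by (simp only: cos_add) simp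
  qed
  have "(D a b has_derivative (\<lambda>h. D (Suc a) b x * h $ 1 + D a (Suc b) x * h $ 2)) (at x)" for a b x
  proof -
    have eq: "(\<lambda>h. - ((k $ 1) ^ a * (k $ 2) ^ b) * sin (k \<bullet> x + (s + real (a + b) * (pi / 2))) * (k \<bullet> h))
        = (\<lambda>h. D (Suc a) b x * h $ 1 + D a (Suc b) x * h $ 2)"
      unfolding D_def add_Suc add_Suc_right shift inner2 by (auto simp: fun_eq_iff algebra_simps)
    then show ?thesis
      using has_derivative_cos_wave[of "(k $ 1) ^ a * (k $ 2) ^ b" k "s + real (a + b) * (pi / 2)" x]
      unfolding eq by (simp add: D_def[abs_def])
  qed
  moreover have "D 0 0 = (\<lambda>x. cos (k \<bullet> x + s))"
    by (simp add: D_def fun_eq_iff)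
  ultimately show "smooth_plane (\<lambda>x. cos (k \<bullet> x + s))"
    unfolding smooth_plane_def by blast
qed

lemma frechet_cos_wave:
  fixes k :: "real^2"
  shows "frechet_derivative (\<lambda>x. cos (k \<bullet> x + s)) (at x) (axis i 1) = - (k $ i) * sin (k \<bullet> x + s)"
proof -
  have "frechet_derivative (\<lambda>x. cos (k \<bullet> x + s)) (at x) = (\<lambda>h. - sin (k \<bullet> x + s) * (k \<bullet> h))"
    using has_derivative_cos_wave[of 1 k s x] by (intro frechet_derivative_at[symmetric]) simp
  then show ?thesis by (simp add: inner_axis)
qed

lemma fcoef_real:
  assumes "u \<in> L2_torus"
  shows "fcoef (\<lambda>x. complex_of_real (u x)) k =
    Complex (tint (\<lambda>x. u x * cos (k \<bullet> x))) (- tint (\<lambda>x. u x * sin (k \<bullet> x)))"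
proof -
  note L2_torusD(2)[OF assms, measurable]
  have i: "integrable torus_measure (\<lambda>x. cnj (torus_char k x) * complex_of_real (u x))"
    by (rule Bochner_Integration.integrable_bound[OF L2_norm_integrable[OF assms]]) (auto simp: norm_mult)
  show ?thesis
    unfolding complex_eq_iff fcoef_def
    using integral_Re[OF i] integral_Im[OF i]
    by (simp add: torus_char_def mult.commute)
qed

lemma L2_component: "g \<in> L2_torus \<Longrightarrow> (\<lambda>x. (g x :: real^'n) $ i) \<in> L2_torus"
  by (rule L2_bounded_linear) (auto intro: bounded_linear_vec_nth)

lemma L2_inner: "g \<in> L2_torus \<Longrightarrow> (\<lambda>x. g x \<bullet> z) \<in> L2_torus"
  by (rule L2_bounded_linear) (auto intro: bounded_linear_inner_left)

text \<open>Testing with the cosine waves of phase 0 and -\<pi>/2 gives the real and the imaginary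
  part of the identity.\<close>

lemma weak_gradient_fcoef:
  assumes u: "u \<in> L2_torus" and g: "is_weak_gradient u g" and k: "k \<in> dual_lattice"
  shows "fcoef (\<lambda>x. complex_of_real (g x $ i)) k = \<i> * of_real (k $ i) * fcoef (\<lambda>x. complex_of_real (u x)) k"
proof -
  have gi: "(\<lambda>x. g x $ i) \<in> L2_torus" using g by (auto simp: is_weak_gradient_def intro: L2_component)
  have test: "tint (\<lambda>x. u x * (- (k $ i) * sin (k \<bullet> x + s)))
      = - tint (\<lambda>x. g x $ i * cos (k \<bullet> x + s))" for s
  proof -
    have "torus_integral (\<lambda>x. u x * frechet_derivative (\<lambda>x. cos (k \<bullet> x + s)) (at x) (axis i 1))
      = - torus_integral (\<lambda>x. g x $ i * cos (k \<bullet> x + s))"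
      using g cos_wave_test[OF k, of s] unfolding is_weak_gradient_def by blast
    then show ?thesis unfolding frechet_cos_wave torus_integral_eq .
  qed
  have pull: "tint (\<lambda>x. u x * (c * f x)) = c * tint (\<lambda>x. u x * f x)" for c :: real and f
    by (simp add: mult.left_commute)
  have "tint (\<lambda>x. g x $ i * cos (k \<bullet> x)) = k $ i * tint (\<lambda>x. u x * sin (k \<bullet> x))"
    using test[of 0] unfolding pull by simp
  moreover have "tint (\<lambda>x. g x $ i * sin (k \<bullet> x)) = - (k $ i) * tint (\<lambda>x. u x * cos (k \<bullet> x))"
    using test[of "- (pi/2)"] unfolding pull by (simp add: cos_diff sin_diff)
  ultimately show ?thesis
    by (simp add: fcoef_real[OF u] fcoef_real[OF gi] complex_eq_iff)
qed

lemma weak_gradient_fcoef_inner: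
  assumes u: "u \<in> L2_torus" and g: "is_weak_gradient u g" and k: "k \<in> dual_lattice"
  shows "fcoef (\<lambda>x. complex_of_real (g x \<bullet> z)) k = \<i> * of_real (k \<bullet> z) * fcoef (\<lambda>x. complex_of_real (u x)) k"
proof -
  have gi: "(\<lambda>x. complex_of_real (g x $ i)) \<in> L2_torus" for i
    using g by (auto simp: is_weak_gradient_def L2_of_real_iff intro: L2_component)
  have "(\<lambda>x. complex_of_real (g x \<bullet> z)) = (\<lambda>x. of_real (z $ 1) * of_real (g x $ 1) + of_real (z $ 2) * complex_of_real (g x $ 2))"
    by (simp add: inner_vec_def sum_2 mult.commute)
  then have "fcoef (\<lambda>x. complex_of_real (g x \<bullet> z)) k
      = fcoef (\<lambda>x. of_real (z $ 1) * of_real (g x $ 1)) k + fcoef (\<lambda>x. of_real (z $ 2) * of_real (g x $ 2)) k"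
    using fcoef_add[OF L2_cmult[OF gi] L2_cmult[OF gi] k] by simp
  also have "\<dots> = \<i> * of_real (k \<bullet> z) * fcoef (\<lambda>x. complex_of_real (u x)) k"
    unfolding fcoef_cmult weak_gradient_fcoef[OF assms] inner_vec_def sum_2 by (simp add: algebra_simps)
  finally show ?thesis .
qed

section \<open>Test functions and the Fourier characterization of weak gradients\<close>

lemma periodic_continuous_bounded:
  fixes f :: "real^2 \<Rightarrow> 'a::real_normed_vector"
  assumes "torus_periodic f" "continuous_on UNIV f"
  obtains B where "\<And>x. norm (f x) \<le> B"
proof -
  have "compact (f ` unit_cell)"
    unfolding unit_cell_def using assms(2) by (intro compact_continuous_image compact_cbox) (auto intro: continuous_on_subset)
  then have "bounded (f ` unit_cell)" by (rule compact_imp_bounded)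
  then obtain B where B: "\<And>x. x \<in> unit_cell \<Longrightarrow> norm (f x) \<le> B" unfolding bounded_iff by auto
  have "wrap x \<in> unit_cell" for x
    using wrap_in_cell[of x] by (auto simp: half_open_cell_def unit_cell_def mem_box_cart less_imp_le)
  then have "norm (f x) \<le> B" for x
    using B[of "wrap x"] periodic_wrap[OF assms(1)] by simp
  then show thesis using that by blast
qed

lemma periodic_derivative:
  assumes "torus_periodic f" "\<And>x. (f has_derivative f' x) (at x)"
  shows "torus_periodic f'"
  unfolding torus_periodic_def
proof safe
  fix x i
  have "((\<lambda>y. f (y + axis i 1)) has_derivative f' (x + axis i 1)) (at x)"
    by (rule has_derivative_compose[of "\<lambda>y. y + axis i 1" "\<lambda>h. h" x UNIV f, simplified])
      (use assms(2) in \<open>auto intro!: derivative_eq_intros\<close>)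
  moreover have "(\<lambda>y. f (y + axis i 1)) = f"
    using assms(1) by (auto simp: torus_periodic_def)
  ultimately have "(f has_derivative f' (x + axis i 1)) (at x)" by simp
  then show "f' (x + axis i 1) = f' x"
    using assms(2) has_derivative_unique by blast
qed

lemma test_function_props:
  assumes "torus_test_function \<phi>"
  shows "torus_periodic \<phi>" "continuous_on UNIV \<phi>"
    and "\<And>x. (\<phi> has_derivative frechet_derivative \<phi> (at x)) (at x)"
    and "torus_periodic (\<lambda>x. frechet_derivative \<phi> (at x) (axis i 1))"
    and "continuous_on UNIV (\<lambda>x. frechet_derivative \<phi> (at x) (axis i 1))"
proof -
  obtain D where D: "D 0 0 = \<phi>"
    "\<And>a b x. (D a b has_derivative (\<lambda>h. D (Suc a) b x * h $ 1 + D a (Suc b) x * h $ 2)) (at x)"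
    using assms unfolding torus_test_function_def smooth_plane_def by blast
  show per: "torus_periodic \<phi>" using assms by (simp add: torus_test_function_def)
  have cont: "continuous_on UNIV (D a b)" for a b
    using D(2) by (meson continuous_at_imp_continuous_on has_derivative_continuous)
  show "continuous_on UNIV \<phi>" using cont[of 0 0] D(1) by simp
  have der: "(\<phi> has_derivative (\<lambda>h. D 1 0 x * h $ 1 + D 0 1 x * h $ 2)) (at x)" for x
    using D(2)[of 0 0 x] D(1) by simp
  have fr: "frechet_derivative \<phi> (at x) = (\<lambda>h. D 1 0 x * h $ 1 + D 0 1 x * h $ 2)" for x
    using frechet_derivative_at[OF der[of x]] by simp
  show "(\<phi> has_derivative frechet_derivative \<phi> (at x)) (at x)" for x
    unfolding fr by (rule der)
  then have "torus_periodic (\<lambda>x. frechet_derivative \<phi> (at x))"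
    by (intro periodic_derivative[OF per])
  then show "torus_periodic (\<lambda>x. frechet_derivative \<phi> (at x) (axis i 1))"
    by (simp add: torus_periodic_def)
  show "continuous_on UNIV (\<lambda>x. frechet_derivative \<phi> (at x) (axis i 1))"
    unfolding fr by (intro continuous_intros cont)
qed

lemma has_vector_derivative_along:
  assumes "(f has_derivative f') (at x)"
  shows "((\<lambda>t. f (x + t *\<^sub>R v)) has_vector_derivative f' v) (at 0)"
proof -
  interpret bounded_linear f' using assms by (rule has_derivative_bounded_linear)
  have "((\<lambda>t. f (x + t *\<^sub>R v)) has_derivative (\<lambda>t. f' (t *\<^sub>R v))) (at 0)"
    by (rule has_derivative_compose[of "\<lambda>t. x + t *\<^sub>R v" "\<lambda>t. t *\<^sub>R v" 0 UNIV f, simplified])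
      (use assms in \<open>auto intro!: derivative_eq_intros\<close>)
  then show ?thesis by (simp add: has_vector_derivative_def scaleR)
qed

lemma torus_char_vector_derivative:
  "((\<lambda>t. torus_char k (x + t *\<^sub>R v)) has_vector_derivative \<i> * of_real (k \<bullet> v) * torus_char k x) (at 0)"
proof -
  have "((\<lambda>t::real. exp (\<i> * of_real (k \<bullet> x) + of_real t * (\<i> * of_real (k \<bullet> v)))) has_vector_derivative
      exp (\<i> * of_real (k \<bullet> x) + of_real 0 * (\<i> * of_real (k \<bullet> v))) * (\<i> * of_real (k \<bullet> v))) (at 0)"
    by (auto intro!: derivative_eq_intros has_vector_derivative_real_field)
  moreover have "torus_char k (x + t *\<^sub>R v) = exp (\<i> * of_real (k \<bullet> x) + of_real t * (\<i> * of_real (k \<bullet> v)))" for t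
    by (simp add: torus_char_def cis_conv_exp inner_add_right algebra_simps)
  ultimately show ?thesis
    by (simp add: torus_char_def cis_conv_exp mult.commute)
qed

lemma integral_parts_char:
  assumes k: "k \<in> dual_lattice" and \<phi>: "torus_test_function \<phi>"
  shows "tint (\<lambda>x. torus_char k x * of_real (frechet_derivative \<phi> (at x) (axis i 1)))
    = - (\<i> * of_real (k $ i)) * tint (\<lambda>x. torus_char k x * of_real (\<phi> x))"
proof -
  note p = test_function_props[OF \<phi>]
  let ?d\<phi> = "\<lambda>x. frechet_derivative \<phi> (at x) (axis i 1)"
  obtain B1 where B1: "\<And>x. norm (\<phi> x) \<le> B1" by (rule periodic_continuous_bounded[OF p(1,2)]) blast
  obtain B2 where B2: "\<And>x. norm (?d\<phi> x) \<le> B2" by (rule periodic_continuous_bounded[OF p(4,5)]) blast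
  have [measurable]: "\<phi> \<in> borel_measurable borel" "?d\<phi> \<in> borel_measurable borel"
    using p by (auto intro!: borel_measurable_continuous_onI)
  have B: "0 \<le> B1" "0 \<le> B2" using B1[of 0] B2[of 0] norm_ge_zero order_trans by blast+
  have "tint (\<lambda>x. \<i> * of_real (k $ i) * (torus_char k x * of_real (\<phi> x)) + torus_char k x * of_real (?d\<phi> x)) = 0"
  proof (rule torus_integral_derivative[where \<psi> = "\<lambda>x. torus_char k x * of_real (\<phi> x)" and v = "axis i 1" and B = "B1 + \<bar>k $ i\<bar> * B1 + B2"])
    show "torus_periodic (\<lambda>x. torus_char k x * of_real (\<phi> x))"
      using torus_char_periodic[OF k] p(1) by (simp add: torus_periodic_def)
    show "((\<lambda>t. torus_char k (x + t *\<^sub>R axis i 1) * of_real (\<phi> (x + t *\<^sub>R axis i 1))) has_vector_derivative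
        \<i> * of_real (k $ i) * (torus_char k x * of_real (\<phi> x)) + torus_char k x * of_real (?d\<phi> x)) (at 0)" for x
      using has_vector_derivative_mult[OF torus_char_vector_derivative[of k x "axis i 1"]
          has_vector_derivative_of_real[OF has_vector_derivative_along[OF p(3)[of x], of "axis i 1",
              unfolded has_real_derivative_iff_has_vector_derivative[symmetric]]]]
      by (simp add: inner_axis algebra_simps)
    show "norm (torus_char k x * of_real (\<phi> x)) \<le> B1 + \<bar>k $ i\<bar> * B1 + B2" for x
      using B1[of x] B by (simp add: norm_mult add_increasing2)
    show "norm (\<i> * of_real (k $ i) * (torus_char k x * of_real (\<phi> x)) + torus_char k x * of_real (?d\<phi> x)) \<le> B1 + \<bar>k $ i\<bar> * B1 + B2" for x
    proof -
      have "norm (\<i> * of_real (k $ i) * (torus_char k x * of_real (\<phi> x))) \<le> \<bar>k $ i\<bar> * B1"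
        using B1[of x] by (simp add: norm_mult mult_left_mono)
      moreover have "norm (torus_char k x * of_real (?d\<phi> x)) \<le> B2"
        using B2[of x] by (simp add: norm_mult)
      ultimately show ?thesis
        using norm_triangle_ineq[of "\<i> * of_real (k $ i) * (torus_char k x * of_real (\<phi> x))" "torus_char k x * of_real (?d\<phi> x)"] B
        by linarith
    qed
  qed measurable
  moreover have "integrable torus_measure (\<lambda>x. torus_char k x * of_real (\<phi> x))"
    by (rule torus.integrable_const_bound[where B = B1]) (use B1 in \<open>auto simp: norm_mult\<close>)
  moreover have "integrable torus_measure (\<lambda>x. torus_char k x * of_real (?d\<phi> x))"
    by (rule torus.integrable_const_bound[where B = B2]) (use B2 in \<open>auto simp: norm_mult\<close>)
  ultimately show ?thesis by (simp add: add_eq_0_iff)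
qed

text \<open>Converse of \<open>weak_gradient_fcoef\<close>. Against a character a test function is
  integrated by parts classically, so the identity holds for square partial sums, and L2 convergence
  of both Fourier series carries it over to u and g.\<close>

lemma is_weak_gradientI:
  assumes u: "u \<in> L2_torus" and g: "g \<in> L2_torus"
    and c: "\<And>k i. k \<in> dual_lattice \<Longrightarrow>
      fcoef (\<lambda>x. complex_of_real (g x $ i)) k = \<i> * of_real (k $ i) * fcoef (\<lambda>x. complex_of_real (u x)) k"
  shows "is_weak_gradient u g"
  unfolding is_weak_gradient_def
proof (intro conjI g allI impI)
  fix \<phi> i assume \<phi>: "torus_test_function \<phi>"
  note p = test_function_props[OF \<phi>]
  let ?d\<phi> = "\<lambda>x. frechet_derivative \<phi> (at x) (axis i 1)"
  let ?u = "\<lambda>x. complex_of_real (u x)" and ?g = "\<lambda>x. complex_of_real (g x $ i)"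
  obtain B1 where B1: "\<And>x. norm (\<phi> x) \<le> B1" by (rule periodic_continuous_bounded[OF p(1,2)]) blast
  obtain B2 where B2: "\<And>x. norm (?d\<phi> x) \<le> B2" by (rule periodic_continuous_bounded[OF p(4,5)]) blast
  have L\<phi>: "(\<lambda>x. complex_of_real (\<phi> x)) \<in> L2_torus" "(\<lambda>x. complex_of_real (?d\<phi> x)) \<in> L2_torus"
    unfolding L2_of_real_iff
    by (rule L2_bounded[OF p(1) borel_measurable_continuous_onI[OF p(2)] B1])
      (rule L2_bounded[OF p(4) borel_measurable_continuous_onI[OF p(5)] B2])
  have uL: "?u \<in> L2_torus" and gL: "?g \<in> L2_torus"
    using u L2_component[OF g] by (auto simp: L2_of_real_iff)
  have t: "tpoly (dual_box n) d \<in> L2_torus" for n d by (intro L2_tpoly finite_dual_box dual_box_subset)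
  have int_t: "tint (\<lambda>x. tpoly (dual_box n) d x * f x)
      = (\<Sum>k\<in>dual_box n. d k * tint (\<lambda>x. torus_char k x * f x))" if "f \<in> L2_torus" for n d f
  proof -
    have "tint (\<lambda>x. tpoly (dual_box n) d x * f x)
        = tint (\<lambda>x. \<Sum>k\<in>dual_box n. d k * (torus_char k x * f x))"
      unfolding tpoly_def by (simp add: sum_distrib_right mult.assoc)
    also have "\<dots> = (\<Sum>k\<in>dual_box n. d k * tint (\<lambda>x. torus_char k x * f x))"
      using dual_box_subset[of n] that
      by (subst Bochner_Integration.integral_sum) (auto intro!: integrable_mult_right L2_prod L2_torus_char)
    finally show ?thesis .
  qed
  have int_eq: "tint (\<lambda>x. tpoly (dual_box n) (fcoef ?u) x * of_real (?d\<phi> x))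
      = - tint (\<lambda>x. tpoly (dual_box n) (fcoef ?g) x * of_real (\<phi> x))" for n
    unfolding int_t[OF L\<phi>(1)] int_t[OF L\<phi>(2)] sum_negf[symmetric]
    using dual_box_subset[of n]
    by (intro sum.cong refl) (auto simp: integral_parts_char[OF _ \<phi>] c subset_iff)
  have "(\<lambda>n. tint (\<lambda>x. tpoly (dual_box n) (fcoef ?u) x * of_real (?d\<phi> x)))
      \<longlonglongrightarrow> tint (\<lambda>x. ?u x * of_real (?d\<phi> x))"
    by (rule L2_prod_tendsto[OF t uL fourier_series_tendsto[OF uL] L\<phi>(2) L\<phi>(2)]) (simp add: nsq_def)
  then have lim_u: "(\<lambda>n. - tint (\<lambda>x. tpoly (dual_box n) (fcoef ?g) x * of_real (\<phi> x)))
      \<longlonglongrightarrow> tint (\<lambda>x. ?u x * of_real (?d\<phi> x))"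
    by (simp only: int_eq)
  have lim_g: "(\<lambda>n. tint (\<lambda>x. tpoly (dual_box n) (fcoef ?g) x * of_real (\<phi> x)))
      \<longlonglongrightarrow> tint (\<lambda>x. ?g x * of_real (\<phi> x))"
    by (rule L2_prod_tendsto[OF t gL fourier_series_tendsto[OF gL] L\<phi>(1) L\<phi>(1)]) (simp add: nsq_def)
  have "tint (\<lambda>x. ?u x * of_real (?d\<phi> x)) = - tint (\<lambda>x. ?g x * of_real (\<phi> x))"
    by (rule LIMSEQ_unique[OF lim_u tendsto_minus[OF lim_g]])
  then have "complex_of_real (tint (\<lambda>x. u x * ?d\<phi> x)) = complex_of_real (- tint (\<lambda>x. g x $ i * \<phi> x))"
    by (simp flip: of_real_mult)
  then show "torus_integral (\<lambda>x. u x * ?d\<phi> x) = - torus_integral (\<lambda>x. g x $ i * \<phi> x)"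
    unfolding torus_integral_eq of_real_eq_iff .
qed

lemma norm_vec2: "(norm (v :: real^2))\<^sup>2 = (v $ 1)\<^sup>2 + (v $ 2)\<^sup>2"
  unfolding power2_norm_eq_inner by (simp add: inner_vec_def sum_2 power2_eq_square)

lemma nsq_vec2:
  assumes "(g :: real^2 \<Rightarrow> real^2) \<in> L2_torus"
  shows "nsq g = nsq (\<lambda>x. g x $ 1) + nsq (\<lambda>x. g x $ 2)"
  unfolding nsq_def using L2_torusD(3)[OF L2_component[OF assms]] by (simp add: norm_vec2)

lemma Parseval_gradient:
  assumes u: "u \<in> L2_torus" and g: "is_weak_gradient u g"
  shows "((\<lambda>k. (norm k)\<^sup>2 * (norm (fcoef (\<lambda>x. complex_of_real (u x)) k))\<^sup>2) has_sum nsq g) dual_lattice"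
proof -
  let ?u = "\<lambda>x. complex_of_real (u x)"
  have gL: "g \<in> L2_torus" using g by (simp add: is_weak_gradient_def)
  have "((\<lambda>k. (k $ i)\<^sup>2 * (norm (fcoef ?u k))\<^sup>2) has_sum nsq (\<lambda>x. g x $ i)) dual_lattice" for i
  proof -
    have "((\<lambda>k. (norm (fcoef (\<lambda>x. complex_of_real (g x $ i)) k))\<^sup>2) has_sum nsq (\<lambda>x. g x $ i)) dual_lattice"
      using Parseval[of "\<lambda>x. complex_of_real (g x $ i)"] L2_component[OF gL, of i]
      by (simp add: L2_of_real_iff nsq_of_real)
    then show ?thesis
      by (rule has_sum_cong[THEN iffD1, rotated])
        (simp add: weak_gradient_fcoef[OF u g] norm_mult power_mult_distrib)
  qed
  from has_sum_add[OF this[of 1] this[of 2]] show ?thesis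
    unfolding nsq_vec2[OF gL]
    by (simp add: norm_vec2 distrib_right)
qed

lemma fcoef_cnj: "fcoef (\<lambda>x. cnj (w x)) k = cnj (fcoef w (- k))"
  unfolding fcoef_def by (subst Bochner_Integration.integral_cnj[symmetric]) (simp add: torus_char_uminus)

lemma weak_gradient_exists:
  assumes u: "u \<in> L2_torus"
    and s: "(\<lambda>k. (norm k)\<^sup>2 * (norm (fcoef (\<lambda>x. complex_of_real (u x)) k))\<^sup>2) summable_on dual_lattice"
  obtains g where "is_weak_gradient u g"
proof -
  let ?u = "\<lambda>x. complex_of_real (u x)"
  have "\<exists>v::real^2\<Rightarrow>real. v \<in> L2_torus \<and> (\<forall>k\<in>dual_lattice. fcoef (\<lambda>x. complex_of_real (v x)) k = \<i> * of_real (k $ i) * fcoef ?u k)" for i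
  proof -
    have "(\<lambda>k. (norm (\<i> * of_real (k $ i) * fcoef ?u k))\<^sup>2) summable_on dual_lattice"
    proof (rule summable_on_comparison_test[OF s])
      fix k assume "k \<in> dual_lattice"
      have "\<bar>k $ i\<bar>\<^sup>2 \<le> (norm k)\<^sup>2" by (intro power_mono component_le_norm_cart) auto
      then show "(norm (\<i> * of_real (k $ i) * fcoef ?u k))\<^sup>2 \<le> (norm k)\<^sup>2 * (norm (fcoef ?u k))\<^sup>2"
        by (simp add: norm_mult power_mult_distrib mult_right_mono)
    qed simp
    then obtain w where w: "w \<in> L2_torus" "\<And>k. k \<in> dual_lattice \<Longrightarrow> fcoef w k = \<i> * of_real (k $ i) * fcoef ?u k"
      by (rule Riesz_Fischer) blast
    \<comment> \<open>The multiplier \<open>\<i> * k $ i\<close> is odd in k and imaginary, so the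
      new coefficients keep the conjugation symmetry of a real function. Passing to the real part of
      \<open>w\<close> therefore does not change them.\<close>
    have conj: "fcoef (\<lambda>x. cnj (w x)) k = fcoef w k" if k: "k \<in> dual_lattice" for k
      using fcoef_cnj[of w k] fcoef_cnj[of ?u k] w(2)[of "- k"] w(2)[OF k] k by simp
    have "(\<lambda>x. complex_of_real (Re (w x))) = (\<lambda>x. (1/2) * w x + (1/2) * cnj (w x))"
      by (auto simp: fun_eq_iff complex_eq_iff)
    then have "fcoef (\<lambda>x. complex_of_real (Re (w x))) k = \<i> * of_real (k $ i) * fcoef ?u k" if "k \<in> dual_lattice" for k
      using fcoef_add[OF L2_cmult[OF w(1)] L2_cmult[OF L2_cnj[OF w(1)]] that, of "1/2" "1/2"]
      unfolding fcoef_cmult conj[OF that] w(2)[OF that] by simp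
    moreover have "(\<lambda>x. Re (w x)) \<in> L2_torus" by (rule L2_bounded_linear[OF w(1) bounded_linear_Re])
    ultimately show ?thesis by blast
  qed
  then obtain v :: "2 \<Rightarrow> real^2 \<Rightarrow> real" where v: "\<And>i. v i \<in> L2_torus"
      "\<And>i k. k \<in> dual_lattice \<Longrightarrow> fcoef (\<lambda>x. complex_of_real (v i x)) k = \<i> * of_real (k $ i) * fcoef ?u k"
    by metis
  define g where "g x = (\<chi> i. v i x)" for x
  have "g = (\<lambda>x. \<Sum>i\<in>UNIV. v i x *\<^sub>R axis i 1)"
    by (simp add: g_def fun_eq_iff vec_eq_iff axis_def sum_2 forall_2)
  moreover have "(\<lambda>x. \<Sum>i\<in>UNIV. v i x *\<^sub>R (axis i 1 :: real^2)) \<in> L2_torus"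
    by (intro L2_sum L2_bounded_linear[OF v(1) bounded_linear_scaleR_left]) auto
  ultimately have "g \<in> L2_torus" by simp
  then have "is_weak_gradient u g"
    by (intro is_weak_gradientI[OF u]) (auto simp: g_def v)
  then show thesis using that by blast
qed

lemma H1_torusI:
  assumes "u \<in> L2_torus" "(\<lambda>k. (norm k)\<^sup>2 * (norm (fcoef (\<lambda>x. complex_of_real (u x)) k))\<^sup>2) summable_on dual_lattice"
  shows "u \<in> H1_torus"
  using weak_gradient_exists[OF assms] assms(1) unfolding H1_torus_def by blast

lemma H1_torusD:
  assumes "u \<in> H1_torus"
  shows "u \<in> L2_torus" "is_weak_gradient u (weak_gradient u)" "weak_gradient u \<in> L2_torus"
proof -
  show "u \<in> L2_torus" using assms by (simp add: H1_torus_def)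
  show "is_weak_gradient u (weak_gradient u)"
    using assms someI_ex[of "is_weak_gradient u"] by (simp add: H1_torus_def weak_gradient_def)
  then show "weak_gradient u \<in> L2_torus" by (simp add: is_weak_gradient_def)
qed

lemma weak_gradient_unique:
  assumes u: "u \<in> L2_torus" and "is_weak_gradient u g" "is_weak_gradient u h"
  shows "AE x in torus_measure. g x = h x"
proof -
  have "AE x in torus_measure. complex_of_real (g x $ i) = complex_of_real (h x $ i)" for i
    by (rule L2_fcoef_unique)
      (use assms in \<open>auto simp: weak_gradient_fcoef[OF u] L2_of_real_iff is_weak_gradient_def intro: L2_component\<close>)
  then have "AE x in torus_measure. \<forall>i. g x $ i = h x $ i"
    by (simp add: forall_2)
  then show ?thesis by eventually_elim (simp add: vec_eq_iff)
qed

text \<open>Serves the explicit competitor, whose classical gradient has to be compared with the one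
  selected by \<open>weak_gradient\<close>.\<close>

lemma classical_weak_gradient:
  fixes u :: "real^2 \<Rightarrow> real"
  assumes per: "torus_periodic u" and der: "\<And>x. (u has_derivative (\<lambda>h. g x \<bullet> h)) (at x)"
    and cont: "continuous_on UNIV g"
  shows "is_weak_gradient u g" "u \<in> L2_torus"
proof -
  have u_cont: "continuous_on UNIV u"
    using der by (meson continuous_at_imp_continuous_on has_derivative_continuous)
  have g_per: "torus_periodic g"
  proof -
    have *: "torus_periodic (\<lambda>x h. g x \<bullet> h)" by (rule periodic_derivative[OF per der])
    have "g (x + axis i 1) \<bullet> h = g x \<bullet> h" for x i h
      using * unfolding torus_periodic_def by metis
    then show ?thesis unfolding torus_periodic_def using vector_eq_rdot by blast
  qed
  obtain Bu where Bu: "\<And>x. norm (u x) \<le> Bu" by (rule periodic_continuous_bounded[OF per u_cont]) blast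
  obtain Bg where Bg: "\<And>x. norm (g x) \<le> Bg" by (rule periodic_continuous_bounded[OF g_per cont]) blast
  have B: "0 \<le> Bu" "0 \<le> Bg" using Bu[of 0] Bg[of 0] norm_ge_zero order_trans by blast+
  have [measurable]: "u \<in> borel_measurable borel" "g \<in> borel_measurable borel"
    using u_cont cont by (auto intro: borel_measurable_continuous_onI)
  show uL: "u \<in> L2_torus" using per Bu by (intro L2_bounded[where B = Bu]) auto
  have gL: "g \<in> L2_torus" using g_per Bg by (intro L2_bounded[where B = Bg]) auto
  show "is_weak_gradient u g"
  proof (rule is_weak_gradientI[OF uL gL])
    fix k :: "real^2" and i :: 2 assume k: "k \<in> dual_lattice"
    have [measurable]: "(\<lambda>x. g x $ i) \<in> borel_measurable borel"
      using L2_torusD(2)[OF L2_component[OF gL]] .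
    have comp: "\<bar>g x $ i\<bar> \<le> Bg" for x
      using component_le_norm_cart[of "g x" i] Bg[of x] by linarith
    have "tint (\<lambda>x. - (\<i> * of_real (k $ i)) * (cnj (torus_char k x) * of_real (u x)) + cnj (torus_char k x) * of_real (g x $ i)) = 0"
    proof (rule torus_integral_derivative[where \<psi> = "\<lambda>x. torus_char (- k) x * of_real (u x)" and v = "axis i 1" and B = "Bu + \<bar>k $ i\<bar> * Bu + Bg"])
      show "torus_periodic (\<lambda>x. torus_char (- k) x * complex_of_real (u x))"
        using torus_char_periodic[of "- k"] k per by (simp add: torus_periodic_def)
      show "((\<lambda>t. torus_char (- k) (x + t *\<^sub>R axis i 1) * of_real (u (x + t *\<^sub>R axis i 1))) has_vector_derivative
        - (\<i> * of_real (k $ i)) * (cnj (torus_char k x) * of_real (u x)) + cnj (torus_char k x) * of_real (g x $ i)) (at 0)" for x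
        using has_vector_derivative_mult[OF torus_char_vector_derivative[of "- k" x "axis i 1"]
          has_vector_derivative_of_real[OF has_vector_derivative_along[OF der[of x], of "axis i 1",
              unfolded has_real_derivative_iff_has_vector_derivative[symmetric]]]]
        by (simp add: inner_axis torus_char_uminus algebra_simps)
      show "norm (torus_char (- k) x * complex_of_real (u x)) \<le> Bu + \<bar>k $ i\<bar> * Bu + Bg" for x
        using Bu[of x] B by (simp add: norm_mult add_increasing2)
      show "norm (- (\<i> * of_real (k $ i)) * (cnj (torus_char k x) * of_real (u x)) + cnj (torus_char k x) * of_real (g x $ i)) \<le> Bu + \<bar>k $ i\<bar> * Bu + Bg" for x
      proof -
        have "norm (- (\<i> * of_real (k $ i)) * (cnj (torus_char k x) * of_real (u x))) \<le> \<bar>k $ i\<bar> * Bu"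
          using Bu[of x] by (simp add: norm_mult mult_left_mono)
        moreover have "norm (cnj (torus_char k x) * complex_of_real (g x $ i)) \<le> Bg"
          using comp[of x] by (simp add: norm_mult)
        ultimately show ?thesis
          using norm_triangle_ineq[of "- (\<i> * of_real (k $ i)) * (cnj (torus_char k x) * of_real (u x))" "cnj (torus_char k x) * complex_of_real (g x $ i)"] B
          by linarith
      qed
    qed measurable
    moreover have "integrable torus_measure (\<lambda>x. cnj (torus_char k x) * complex_of_real (u x))"
      using fcoef_integrable[of "\<lambda>x. complex_of_real (u x)" k] uL k by (simp add: L2_of_real_iff)
    moreover have "integrable torus_measure (\<lambda>x. cnj (torus_char k x) * complex_of_real (g x $ i))"
      using fcoef_integrable[of "\<lambda>x. complex_of_real (g x $ i)" k] L2_component[OF gL] k by (simp add: L2_of_real_iff)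
    ultimately show "fcoef (\<lambda>x. complex_of_real (g x $ i)) k = \<i> * of_real (k $ i) * fcoef (\<lambda>x. complex_of_real (u x)) k"
      unfolding fcoef_def by simp
  qed
qed

subsection \<open>Translations of Sobolev functions\<close>

lemma norm_cis_diff_sq: "(norm (cis t - 1))\<^sup>2 = 2 - 2 * cos t"
proof -
  have "(norm (cis t - 1))\<^sup>2 = (cos t - 1)\<^sup>2 + (sin t)\<^sup>2"
    by (simp add: cmod_power2)
  then show ?thesis
    using sin_cos_squared_add[of t] by (simp add: power2_eq_square algebra_simps)
qed

lemma two_minus_cos_le: "2 - 2 * cos t \<le> (t::real)\<^sup>2"
proof -
  have "2 - 2 * cos t = 4 * (sin (t / 2))\<^sup>2"
    using cos_double_sin[of "t / 2"] by simp
  also have "\<dots> \<le> 4 * (t / 2)\<^sup>2"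
    by (intro mult_left_mono abs_le_square_iff[THEN iffD1] abs_sin_x_le_abs_x) simp
  finally show ?thesis by (simp add: power_divide)
qed

lemma norm_cis_minus_one: "norm (cis t - 1) \<le> \<bar>t\<bar>"
proof -
  have "(norm (cis t - 1))\<^sup>2 \<le> \<bar>t\<bar>\<^sup>2"
    using two_minus_cos_le[of t] by (simp add: norm_cis_diff_sq)
  then show ?thesis by (rule power2_le_imp_le) simp
qed

lemma torus_shift_periodic: "torus_periodic f \<Longrightarrow> torus_periodic (\<lambda>x. f (x + z))"
  unfolding torus_periodic_def by (metis add.assoc add.commute)

lemma L2_shift:
  assumes "f \<in> L2_torus"
  shows "(\<lambda>x. f (x + z)) \<in> L2_torus" "nsq (\<lambda>x. f (x + z)) = nsq f"
proof -
  note L2_torusD(2)[OF assms, measurable]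
  have p: "torus_periodic (\<lambda>x. (norm (f x))\<^sup>2)" "(\<lambda>x. (norm (f x))\<^sup>2) \<in> borel_measurable borel"
    using L2_torusD(1)[OF assms] by (auto simp: torus_periodic_def)
  show "(\<lambda>x. f (x + z)) \<in> L2_torus"
  proof (rule L2_torusI)
    show "torus_periodic (\<lambda>x. f (x + z))" by (intro torus_shift_periodic L2_torusD(1)[OF assms])
    show "integrable torus_measure (\<lambda>x. (norm (f (x + z)))\<^sup>2)"
      using torus_shift(2)[OF p, of z] L2_torusD(3)[OF assms] by simp
  qed measurable
  show "nsq (\<lambda>x. f (x + z)) = nsq f"
    unfolding nsq_def using torus_shift(1)[OF p, of z] .
qed

text \<open>Telescoping, each increment being a translate of the first one and thus of equal L1
  norm. Read backwards, a shift by z is controlled by n times a shift by z/n, which is a difference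
  quotient.\<close>

lemma shift_L1_mult:
  fixes f :: "real^2 \<Rightarrow> 'a::euclidean_space"
  assumes f: "f \<in> L2_torus"
  shows "tint (\<lambda>x. norm (f (x + real j *\<^sub>R w) - f x))
    \<le> real j * tint (\<lambda>x. norm (f (x + w) - f x))"
proof (induction j)
  case (Suc j)
  have d: "(\<lambda>x. f (x + w') - f x) \<in> L2_torus" for w'
    by (intro L2_diff L2_shift f)
  note L2_torusD(2)[OF d, measurable]
  have p: "torus_periodic (\<lambda>x. norm (f (x + w) - f x))"
    using L2_torusD(1)[OF d[of w]] by (simp add: torus_periodic_def)
  have sh: "tint (\<lambda>x. norm (f (x + real j *\<^sub>R w + w) - f (x + real j *\<^sub>R w)))
     = tint (\<lambda>x. norm (f (x + w) - f x))"
    and shi: "integrable torus_measure (\<lambda>x. norm (f (x + real j *\<^sub>R w + w) - f (x + real j *\<^sub>R w)))"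
    using torus_shift[OF p, of "real j *\<^sub>R w"] L2_norm_integrable[OF d[of w]] by simp_all
  have "tint (\<lambda>x. norm (f (x + real (Suc j) *\<^sub>R w) - f x))
    \<le> tint (\<lambda>x. norm (f (x + real j *\<^sub>R w + w) - f (x + real j *\<^sub>R w)) + norm (f (x + real j *\<^sub>R w) - f x))"
  proof (rule integral_mono)
    show "integrable torus_measure (\<lambda>x. norm (f (x + real (Suc j) *\<^sub>R w) - f x))"
      by (rule L2_norm_integrable[OF d])
    show "integrable torus_measure (\<lambda>x. norm (f (x + real j *\<^sub>R w + w) - f (x + real j *\<^sub>R w)) + norm (f (x + real j *\<^sub>R w) - f x))"
      by (intro Bochner_Integration.integrable_add shi L2_norm_integrable[OF d])
    show "norm (f (x + real (Suc j) *\<^sub>R w) - f x)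
      \<le> norm (f (x + real j *\<^sub>R w + w) - f (x + real j *\<^sub>R w)) + norm (f (x + real j *\<^sub>R w) - f x)" for x
      using norm_triangle_ineq[of "f (x + real j *\<^sub>R w + w) - f (x + real j *\<^sub>R w)" "f (x + real j *\<^sub>R w) - f x"]
      by (simp add: algebra_simps)
  qed
  also have "\<dots> = tint (\<lambda>x. norm (f (x + w) - f x)) + tint (\<lambda>x. norm (f (x + real j *\<^sub>R w) - f x))"
    using shi L2_norm_integrable[OF d[of "real j *\<^sub>R w"]] sh by simp
  finally show ?case using Suc by (simp add: algebra_simps)
qed simp

lemma tpoly_vector_derivative:
  "((\<lambda>t. tpoly K c (x + t *\<^sub>R v)) has_vector_derivative tpoly K (\<lambda>k. \<i> * of_real (k \<bullet> v) * c k) x) (at 0)"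
proof -
  have "((\<lambda>t. \<Sum>k\<in>K. c k * torus_char k (x + t *\<^sub>R v)) has_vector_derivative
      (\<Sum>k\<in>K. c k * (\<i> * of_real (k \<bullet> v) * torus_char k x))) (at 0)"
    by (intro has_vector_derivative_sum has_vector_derivative_mult_right torus_char_vector_derivative)
  then show ?thesis by (simp add: tpoly_def mult_ac)
qed

lemma norm_tpoly_shift_diff:
  "norm (tpoly K c (x + t *\<^sub>R v) - tpoly K c x) \<le> \<bar>t\<bar> * (\<Sum>k\<in>K. norm (c k) * \<bar>k \<bullet> v\<bar>)"
proof -
  have "tpoly K c (x + t *\<^sub>R v) - tpoly K c x = (\<Sum>k\<in>K. c k * torus_char k x * (cis (t * (k \<bullet> v)) - 1))"
    unfolding tpoly_def sum_subtractf[symmetric] torus_char_shift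
    by (intro sum.cong refl) (simp add: torus_char_def algebra_simps)
  also have "norm \<dots> \<le> (\<Sum>k\<in>K. norm (c k) * \<bar>t * (k \<bullet> v)\<bar>)"
    by (rule sum_norm_le) (auto simp: norm_mult intro!: mult_left_mono norm_cis_minus_one[simplified])
  finally show ?thesis by (simp add: sum_distrib_left abs_mult mult_ac)
qed

text \<open>By \<open>shift_L1_mult\<close> the left side is at most the norm of the difference
  quotient with step 1/(n+1), for every n, and the quotients converge to the directional derivative.
  No integration along the segment from x to x + z occurs.\<close>

lemma tpoly_translate_L1:
  assumes K: "finite K" "K \<subseteq> dual_lattice"
  shows "tint (\<lambda>x. norm (tpoly K c (x + z) - tpoly K c x))
    \<le> tint (\<lambda>x. norm (tpoly K (\<lambda>k. \<i> * of_real (k \<bullet> z) * c k) x))"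
proof -
  let ?P = "tpoly K c" and ?T = "tpoly K (\<lambda>k. \<i> * of_real (k \<bullet> z) * c k)"
  let ?B = "\<Sum>k\<in>K. norm (c k) * \<bar>k \<bullet> z\<bar>"
  have P: "?P \<in> L2_torus" and T: "?T \<in> L2_torus" by (intro L2_tpoly K)+
  note L2_torusD(2)[OF P, measurable] L2_torusD(2)[OF T, measurable]
  have lim: "(\<lambda>n. tint (\<lambda>x. norm (real (Suc n) *\<^sub>R (?P (x + (1 / real (Suc n)) *\<^sub>R z) - ?P x))))
      \<longlonglongrightarrow> tint (\<lambda>x. norm (?T x))"
  proof (rule integral_dominated_convergence[where w = "\<lambda>_. ?B"])
    show "AE x in torus_measure. (\<lambda>n. norm (real (Suc n) *\<^sub>R (?P (x + (1 / real (Suc n)) *\<^sub>R z) - ?P x))) \<longlonglongrightarrow> norm (?T x)"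
      using vector_derivative_quotient_seq[OF tpoly_vector_derivative[of K c _ z]]
      by (intro AE_I2 tendsto_norm) simp
    show "AE x in torus_measure. norm (norm (real (Suc n) *\<^sub>R (?P (x + (1 / real (Suc n)) *\<^sub>R z) - ?P x))) \<le> ?B" for n
    proof (rule AE_I2)
      fix x
      have "norm (real (Suc n) *\<^sub>R (?P (x + (1 / real (Suc n)) *\<^sub>R z) - ?P x))
          = real (Suc n) * norm (?P (x + (1 / real (Suc n)) *\<^sub>R z) - ?P x)"
        by (simp only: norm_scaleR abs_of_nat)
      also have "\<dots> \<le> real (Suc n) * (\<bar>1 / real (Suc n)\<bar> * ?B)"
        by (intro mult_left_mono norm_tpoly_shift_diff) simp
      also have "\<dots> = ?B" by (simp del: of_nat_Suc)
      finally show "norm (norm (real (Suc n) *\<^sub>R (?P (x + (1 / real (Suc n)) *\<^sub>R z) - ?P x))) \<le> ?B" by simp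
    qed
  qed measurable
  have le: "tint (\<lambda>x. norm (?P (x + z) - ?P x))
      \<le> tint (\<lambda>x. norm (real (Suc n) *\<^sub>R (?P (x + (1 / real (Suc n)) *\<^sub>R z) - ?P x)))" for n
    using shift_L1_mult[OF P, of "Suc n" "(1 / real (Suc n)) *\<^sub>R z"]
    by (simp del: of_nat_Suc)
  show ?thesis
    by (rule LIMSEQ_le_const[OF lim]) (use le in blast)
qed

lemma L1_norm_tendsto:
  assumes f: "\<And>n. F n \<in> L2_torus" "f \<in> L2_torus" "(\<lambda>n. nsq (\<lambda>x. F n x - f x)) \<longlonglongrightarrow> 0"
  shows "(\<lambda>n. tint (\<lambda>x. norm (F n x))) \<longlonglongrightarrow> tint (\<lambda>x. norm (f x))"
proof (rule LIM_zero_cancel, rule Lim_null_comparison)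
  show "(\<lambda>n. sqrt (nsq (\<lambda>x. F n x - f x))) \<longlonglongrightarrow> 0"
    using tendsto_real_sqrt[OF f(3)] by simp
  show "\<forall>\<^sub>F n in sequentially. norm (tint (\<lambda>x. norm (F n x)) - tint (\<lambda>x. norm (f x)))
     \<le> sqrt (nsq (\<lambda>x. F n x - f x))"
  proof (intro always_eventually allI)
    fix n
    have d: "(\<lambda>x. F n x - f x) \<in> L2_torus" by (intro L2_diff f)
    have "norm (tint (\<lambda>x. norm (F n x)) - tint (\<lambda>x. norm (f x)))
        = norm (tint (\<lambda>x. norm (F n x) - norm (f x)))"
      by (simp add: L2_norm_integrable f)
    moreover have "norm (tint (\<lambda>x. norm (F n x) - norm (f x))) \<le> tint (\<lambda>x. norm (norm (F n x) - norm (f x)))"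
      by (rule integral_norm_bound)
    moreover have "tint (\<lambda>x. norm (norm (F n x) - norm (f x))) \<le> tint (\<lambda>x. norm (F n x - f x))"
    proof (rule integral_mono)
      show "integrable torus_measure (\<lambda>x. norm (norm (F n x) - norm (f x)))"
        by (rule integrable_norm, rule Bochner_Integration.integrable_diff) (rule L2_norm_integrable[OF f(1)] L2_norm_integrable[OF f(2)])+
    qed (auto simp: norm_triangle_ineq3 L2_norm_integrable[OF d])
    ultimately show "norm (tint (\<lambda>x. norm (F n x)) - tint (\<lambda>x. norm (f x))) \<le> sqrt (nsq (\<lambda>x. F n x - f x))"
      using L1_le_L2[OF d] by linarith
  qed
qed

lemma fourier_series_gradient:
  assumes u: "u \<in> L2_torus" and g: "is_weak_gradient u g"
  shows "(\<lambda>n. nsq (\<lambda>x. tpoly (dual_box n) (\<lambda>k. \<i> * of_real (k \<bullet> z) * fcoef (\<lambda>x. complex_of_real (u x)) k) x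
      - complex_of_real (g x \<bullet> z))) \<longlonglongrightarrow> 0"
proof -
  have gL: "(\<lambda>x. complex_of_real (g x \<bullet> z)) \<in> L2_torus"
    using g by (auto simp: L2_of_real_iff is_weak_gradient_def intro: L2_inner)
  have "tpoly (dual_box n) (fcoef (\<lambda>x. complex_of_real (g x \<bullet> z))) x
     = tpoly (dual_box n) (\<lambda>k. \<i> * of_real (k \<bullet> z) * fcoef (\<lambda>x. complex_of_real (u x)) k) x" for n x
    unfolding tpoly_def using dual_box_subset[of n]
    by (intro sum.cong refl) (auto simp: weak_gradient_fcoef_inner[OF u g])
  then show ?thesis
    using fourier_series_tendsto[OF gL] by simp
qed

text \<open>Both sides of \<open>tpoly_translate_L1\<close> are L1 norms of square partial sums
  converging in L2, so the inequality passes to the limit.\<close>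

lemma translate_L1:
  assumes u: "u \<in> L2_torus" and g: "is_weak_gradient u g"
  shows "tint (\<lambda>x. \<bar>u (x + z) - u x\<bar>) \<le> tint (\<lambda>x. \<bar>g x \<bullet> z\<bar>)"
proof -
  let ?u = "\<lambda>x. complex_of_real (u x)" and ?g = "\<lambda>x. complex_of_real (g x \<bullet> z)"
  let ?P = "\<lambda>n. tpoly (dual_box n) (fcoef ?u)"
  let ?T = "\<lambda>n. tpoly (dual_box n) (\<lambda>k. \<i> * of_real (k \<bullet> z) * fcoef ?u k)"
  have uL: "?u \<in> L2_torus" using u by (simp add: L2_of_real_iff)
  have gL: "?g \<in> L2_torus"
    using g by (auto simp: L2_of_real_iff is_weak_gradient_def intro: L2_inner)
  have PL: "?P n \<in> L2_torus" and TL: "?T n \<in> L2_torus" for n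
    by (intro L2_tpoly finite_dual_box dual_box_subset)+
  have "(\<lambda>n. nsq (\<lambda>x. (?P n (x + z) - ?P n x) - (?u (x + z) - ?u x))) \<longlonglongrightarrow> 0"
  proof (rule Lim_null_comparison)
    show "(\<lambda>n. 4 * nsq (\<lambda>x. ?P n x - ?u x)) \<longlonglongrightarrow> 0"
      using tendsto_mult_right_zero[OF fourier_series_tendsto[OF uL]] .
    show "\<forall>\<^sub>F n in sequentially. norm (nsq (\<lambda>x. (?P n (x + z) - ?P n x) - (?u (x + z) - ?u x))) \<le> 4 * nsq (\<lambda>x. ?P n x - ?u x)"
    proof (intro always_eventually allI)
      fix n
      have d: "(\<lambda>x. ?P n x - ?u x) \<in> L2_torus" by (intro L2_diff PL uL)
      have "nsq (\<lambda>x. (?P n (x + z) - ?u (x + z)) + (-1) *\<^sub>R (?P n x - ?u x))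
          \<le> 2 * nsq (\<lambda>x. ?P n (x + z) - ?u (x + z)) + 2 * nsq (\<lambda>x. (-1) *\<^sub>R (?P n x - ?u x))"
        using L2_shift(1)[OF d, of z] L2_scaleR[OF d, of "-1"] by (rule nsq_add_le)
      also have "\<dots> = 4 * nsq (\<lambda>x. ?P n x - ?u x)"
        using L2_shift(2)[OF d, of z] by (simp add: nsq_def norm_minus_commute)
      finally show "norm (nsq (\<lambda>x. (?P n (x + z) - ?P n x) - (?u (x + z) - ?u x))) \<le> 4 * nsq (\<lambda>x. ?P n x - ?u x)"
        by (simp add: algebra_simps)
    qed
  qed
  then have l1: "(\<lambda>n. tint (\<lambda>x. norm (?P n (x + z) - ?P n x))) \<longlonglongrightarrow> tint (\<lambda>x. norm (?u (x + z) - ?u x))"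
    by (intro L1_norm_tendsto L2_diff L2_shift PL uL)
  have l2: "(\<lambda>n. tint (\<lambda>x. norm (?T n x))) \<longlonglongrightarrow> tint (\<lambda>x. norm (?g x))"
    by (intro L1_norm_tendsto TL gL fourier_series_gradient u g)
  have "tint (\<lambda>x. norm (?u (x + z) - ?u x)) \<le> tint (\<lambda>x. norm (?g x))"
    by (rule LIMSEQ_le[OF l1 l2]) (use tpoly_translate_L1[OF finite_dual_box dual_box_subset] in blast)
  then show ?thesis by (simp flip: of_real_diff)
qed

subsection \<open>Sphere-valued maps\<close>

lemma continuous_tpoly: "continuous_on S (tpoly K c)"
  unfolding tpoly_def[abs_def] torus_char_def cis_conv_exp by (intro continuous_intros)

text \<open>The derivative of a character times the square of the polynomial integrates to 0 over
  the torus; the product rule turns this into the claim.\<close>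

lemma square_gradient_tpoly:
  assumes K: "finite K" "K \<subseteq> dual_lattice" and k: "k \<in> dual_lattice"
  shows "tint (\<lambda>x. cnj (torus_char k x) * tpoly K c x * tpoly K (\<lambda>k. \<i> * of_real (k \<bullet> z) * c k) x)
    = (\<i> / 2) * of_real (k \<bullet> z) * tint (\<lambda>x. cnj (torus_char k x) * tpoly K c x * tpoly K c x)"
proof -
  let ?P = "tpoly K c" and ?T = "tpoly K (\<lambda>k. \<i> * of_real (k \<bullet> z) * c k)"
  let ?\<psi> = "\<lambda>x. torus_char (- k) x * ?P x * ?P x"
  let ?d = "\<lambda>x. 2 * (torus_char (- k) x * ?P x * ?T x) - \<i> * of_real (k \<bullet> z) * (torus_char (- k) x * ?P x * ?P x)"
  have P: "?P \<in> L2_torus" and T: "?T \<in> L2_torus" by (intro L2_tpoly K)+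
  have ch: "torus_char (- k) \<in> L2_torus" using k by (intro L2_torus_char) simp
  have chc: "continuous_on UNIV (torus_char (- k))"
    unfolding torus_char_def[abs_def] cis_conv_exp by (intro continuous_intros)
  note per = L2_torusD(1)[OF P] L2_torusD(1)[OF T] L2_torusD(1)[OF ch]
  have p: "torus_periodic ?\<psi>" "torus_periodic ?d"
    using per by (auto simp: torus_periodic_def)
  have cc: "continuous_on UNIV ?\<psi>" "continuous_on UNIV ?d"
    by (intro continuous_intros chc continuous_tpoly)+
  obtain B1 where B1: "\<And>x. norm (?\<psi> x) \<le> B1" by (rule periodic_continuous_bounded[OF p(1) cc(1)]) blast
  obtain B2 where B2: "\<And>x. norm (?d x) \<le> B2" by (rule periodic_continuous_bounded[OF p(2) cc(2)]) blast
  have "tint ?d = 0"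
  proof (rule torus_integral_derivative[where \<psi> = ?\<psi> and v = z and B = "max B1 B2"])
    show "((\<lambda>t. ?\<psi> (x + t *\<^sub>R z)) has_vector_derivative ?d x) (at 0)" for x
      using has_vector_derivative_mult[OF has_vector_derivative_mult[OF torus_char_vector_derivative[of "- k" x z]
            tpoly_vector_derivative[of K c x z]] tpoly_vector_derivative[of K c x z]]
      by (simp add: algebra_simps)
    show "?\<psi> \<in> borel_measurable borel" "?d \<in> borel_measurable borel"
      using cc by (auto intro: borel_measurable_continuous_onI)
    show "torus_periodic ?\<psi>" by (rule p)
    show "norm (?\<psi> x) \<le> max B1 B2" "norm (?d x) \<le> max B1 B2" for x
      using B1[of x] B2[of x] by (simp_all add: le_max_iff_disj)
  qed
  moreover have "integrable torus_measure (\<lambda>x. torus_char (- k) x * ?P x * ?T x)"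
    "integrable torus_measure (\<lambda>x. torus_char (- k) x * ?P x * ?P x)"
    by (intro L2_prod L2_mult_bounded[where B = 1] P T per(3) L2_torusD(2)[OF ch]; simp)+
  ultimately have "2 * tint (\<lambda>x. torus_char (- k) x * ?P x * ?T x)
      = \<i> * of_real (k \<bullet> z) * tint (\<lambda>x. torus_char (- k) x * ?P x * ?P x)"
    by simp
  then show ?thesis by (simp add: torus_char_uminus mult.commute[of 2])
qed

text \<open>The chain rule for u^2 in Fourier form. The product of u with its gradient is merely
  integrable, so it is tested with one character at a time instead of being approximated in
  L2.\<close>

lemma square_gradient_fcoef:
  assumes u: "u \<in> L2_torus" and g: "is_weak_gradient u g" and k: "k \<in> dual_lattice"
  shows "fcoef (\<lambda>x. complex_of_real (u x * (g x \<bullet> z))) k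
     = (\<i> / 2) * of_real (k \<bullet> z) * fcoef (\<lambda>x. complex_of_real ((u x)\<^sup>2)) k"
proof -
  let ?u = "\<lambda>x. complex_of_real (u x)" and ?g = "\<lambda>x. complex_of_real (g x \<bullet> z)"
  let ?P = "\<lambda>n. tpoly (dual_box n) (fcoef ?u)"
  let ?T = "\<lambda>n. tpoly (dual_box n) (\<lambda>k. \<i> * of_real (k \<bullet> z) * fcoef ?u k)"
  have uL: "?u \<in> L2_torus" using u by (simp add: L2_of_real_iff)
  have gL: "?g \<in> L2_torus"
    using g by (auto simp: L2_of_real_iff is_weak_gradient_def intro: L2_inner)
  have PL: "?P n \<in> L2_torus" and TL: "?T n \<in> L2_torus" for n
    by (intro L2_tpoly finite_dual_box dual_box_subset)+
  have ch: "cnj \<circ> torus_char k \<in> L2_torus" using L2_cnj[OF L2_torus_char[OF k]] by (simp add: o_def)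
  have chm: "(\<lambda>x. cnj (torus_char k x) * f x) \<in> L2_torus" if "f \<in> L2_torus" for f
    using L2_mult_bounded[OF that, of "cnj \<circ> torus_char k" 1] L2_torusD[OF ch] by simp
  have lim: "(\<lambda>n. nsq (\<lambda>x. cnj (torus_char k x) * ?P n x - cnj (torus_char k x) * ?u x)) \<longlonglongrightarrow> 0"
  proof -
    have "nsq (\<lambda>x. cnj (torus_char k x) * ?P n x - cnj (torus_char k x) * ?u x) = nsq (\<lambda>x. ?P n x - ?u x)" for n
      unfolding nsq_def right_diff_distrib[symmetric] norm_mult by simp
    then show ?thesis using fourier_series_tendsto[OF uL] by simp
  qed
  have l1: "(\<lambda>n. tint (\<lambda>x. cnj (torus_char k x) * ?P n x * ?T n x))
      \<longlonglongrightarrow> tint (\<lambda>x. cnj (torus_char k x) * ?u x * ?g x)"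
    by (rule L2_prod_tendsto[OF chm[OF PL] chm[OF uL] lim TL gL fourier_series_gradient[OF u g]])
  have l2: "(\<lambda>n. tint (\<lambda>x. cnj (torus_char k x) * ?P n x * ?P n x))
      \<longlonglongrightarrow> tint (\<lambda>x. cnj (torus_char k x) * ?u x * ?u x)"
    by (rule L2_prod_tendsto[OF chm[OF PL] chm[OF uL] lim PL uL fourier_series_tendsto[OF uL]])
  have "tint (\<lambda>x. cnj (torus_char k x) * ?u x * ?g x)
      = (\<i> / 2) * of_real (k \<bullet> z) * tint (\<lambda>x. cnj (torus_char k x) * ?u x * ?u x)"
    by (rule LIMSEQ_unique[OF l1[unfolded square_gradient_tpoly[OF finite_dual_box dual_box_subset k]]
          tendsto_mult_left[OF l2]])
  then show ?thesis
    unfolding fcoef_def by (simp add: power2_eq_square mult.assoc)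
qed

lemma AE_torusI: "(AE x in lborel. P x) \<Longrightarrow> AE x in torus_measure. P x"
  unfolding torus_measure_def by (subst AE_restrict_space_iff) (auto elim: eventually_mono)

lemma sphere_norm:
  assumes "m \<in> L1_torus_sphere"
  shows "AE x in torus_measure. norm (m x) = 1"
  using assms by (intro AE_torusI) (simp add: L1_torus_sphere_def)

lemma sphere_sum_squares: "(norm (v :: real^3))\<^sup>2 = (\<Sum>j\<in>UNIV. (v $ j)\<^sup>2)"
  unfolding power2_norm_eq_inner by (simp add: inner_vec_def power2_eq_square)

lemma H1_sphereD:
  assumes "m \<in> H1_torus_sphere"
  shows "(\<lambda>x. m x $ j) \<in> L2_torus"
    "is_weak_gradient (\<lambda>x. m x $ j) (weak_gradient (\<lambda>x. m x $ j))"
    "weak_gradient (\<lambda>x. m x $ j) \<in> L2_torus"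
  using H1_torusD[of "\<lambda>x. m x $ j"] assms by (auto simp: H1_torus_sphere_def)

text \<open>The coefficients of the sum are those of |m|^2 = 1 multiplied by (\<i>/2)(k \<bullet>
  z). The former vanish for k \<noteq> 0 and the latter for k = 0.\<close>

lemma sphere_gradient_orthogonal:
  assumes m: "m \<in> H1_torus_sphere"
  shows "AE x in torus_measure. (\<Sum>j\<in>UNIV. m x $ j * (weak_gradient (\<lambda>y. m y $ j) x \<bullet> z)) = 0"
proof -
  let ?g = "\<lambda>j. weak_gradient (\<lambda>y. m y $ j)"
  note mL = H1_sphereD[OF m]
  have gz: "(\<lambda>x. ?g j x \<bullet> z) \<in> L2_torus" for j by (intro L2_inner mL)
  have int: "integrable torus_measure (\<lambda>x. m x $ j * (?g j x \<bullet> z))" for j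
    by (intro L2_prod mL gz)
  have meas [measurable]: "(\<lambda>x. m x $ j) \<in> borel_measurable borel" "(\<lambda>x. ?g j x \<bullet> z) \<in> borel_measurable borel" for j
    using L2_torusD(2)[OF mL(1)] L2_torusD(2)[OF gz] by auto
  have "AE x in torus_measure. complex_of_real (\<Sum>j\<in>UNIV. m x $ j * (?g j x \<bullet> z)) = 0"
  proof (rule fourier_uniqueness)
    show "integrable torus_measure (\<lambda>x. complex_of_real (\<Sum>j\<in>UNIV. m x $ j * (?g j x \<bullet> z)))"
      by (intro integrable_of_real Bochner_Integration.integrable_sum int)
    fix k assume k: "k \<in> dual_lattice"
    have bd: "integrable torus_measure (\<lambda>x. cnj (torus_char k x) * complex_of_real (f x))"
      if "integrable torus_measure f" "f \<in> borel_measurable borel" for f :: "real^2 \<Rightarrow> real"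
    proof -
      note that(2)[measurable]
      show ?thesis by (rule Bochner_Integration.integrable_bound[OF that(1)]) (auto simp: norm_mult)
    qed
    have sq: "integrable torus_measure (\<lambda>x. (m x $ j)\<^sup>2)" for j
      using L2_torusD(3)[OF mL(1)[of j]] by simp
    have "fcoef (\<lambda>x. complex_of_real (\<Sum>j\<in>UNIV. m x $ j * (?g j x \<bullet> z))) k
        = (\<Sum>j\<in>UNIV. fcoef (\<lambda>x. complex_of_real (m x $ j * (?g j x \<bullet> z))) k)"
      unfolding fcoef_def of_real_sum sum_distrib_left
      by (rule Bochner_Integration.integral_sum) (intro bd int; measurable)
    also have "\<dots> = (\<i> / 2) * of_real (k \<bullet> z) * (\<Sum>j\<in>UNIV. fcoef (\<lambda>x. complex_of_real ((m x $ j)\<^sup>2)) k)"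
      unfolding sum_distrib_left by (intro sum.cong refl square_gradient_fcoef mL k)
    also have "(\<Sum>j\<in>UNIV. fcoef (\<lambda>x. complex_of_real ((m x $ j)\<^sup>2)) k)
        = fcoef (\<lambda>x. complex_of_real (\<Sum>j\<in>UNIV. (m x $ j)\<^sup>2)) k"
      unfolding fcoef_def of_real_sum sum_distrib_left
      by (rule Bochner_Integration.integral_sum[symmetric]) (intro bd sq; measurable)
    also have "\<dots> = fcoef (torus_char 0) k"
      unfolding fcoef_def
    proof (rule integral_cong_AE)
      show "AE x in torus_measure. cnj (torus_char k x) * complex_of_real (\<Sum>j\<in>UNIV. (m x $ j)\<^sup>2) = cnj (torus_char k x) * torus_char 0 x"
        using sphere_norm[of m] m unfolding H1_torus_sphere_def
        by (auto simp: sphere_sum_squares[symmetric] elim!: eventually_mono)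
    qed measurable
    also have "\<dots> = of_bool (0 = k)" by (rule fcoef_char) (simp_all add: k)
    finally show "fcoef (\<lambda>x. complex_of_real (\<Sum>j\<in>UNIV. m x $ j * (?g j x \<bullet> z))) k = 0"
      by (cases "k = 0") auto
  qed measurable
  then show ?thesis by eventually_elim (simp only: of_real_eq_0_iff)
qed

text \<open>Orthogonality expresses m3 times its partial derivative through the other two
  components. Cauchy-Schwarz for these together with m1^2 + m2^2 = 1 - m3^2 gives the bound for each
  partial derivative.\<close>

lemma sphere_gradient_bound:
  assumes m: "m \<in> H1_torus_sphere"
  shows "AE x in torus_measure. (norm (weak_gradient (\<lambda>y. m y $ 3) x))\<^sup>2
    \<le> (1 - (m x $ 3)\<^sup>2) * (\<Sum>j\<in>UNIV. (norm (weak_gradient (\<lambda>y. m y $ j) x))\<^sup>2)"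
proof -
  let ?g = "\<lambda>j. weak_gradient (\<lambda>y. m y $ j)"
  have o: "AE x in torus_measure. (\<Sum>j\<in>UNIV. m x $ j * (?g j x $ i)) = 0" for i
    using sphere_gradient_orthogonal[OF m, of "axis i 1"] by (simp add: inner_axis)
  have n: "AE x in torus_measure. norm (m x) = 1"
    using m by (intro sphere_norm) (simp add: H1_torus_sphere_def)
  have alg: "c3\<^sup>2 \<le> (1 - a3\<^sup>2) * (c1\<^sup>2 + c2\<^sup>2 + c3\<^sup>2)"
    if "a1 * c1 + a2 * c2 + a3 * c3 = 0" "a1\<^sup>2 + a2\<^sup>2 + a3\<^sup>2 = 1" for a1 a2 a3 c1 c2 c3 :: real
  proof -
    have "a3 * c3 = - (a1 * c1 + a2 * c2)" using that(1) by linarith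
    then have "a3\<^sup>2 * c3\<^sup>2 = (a1 * c1 + a2 * c2)\<^sup>2"
      by (metis power_mult_distrib power2_minus)
    moreover have "(a1\<^sup>2 + a2\<^sup>2) * (c1\<^sup>2 + c2\<^sup>2) - (a1 * c1 + a2 * c2)\<^sup>2 = (a1 * c2 - a2 * c1)\<^sup>2"
      by (simp add: power2_eq_square algebra_simps)
    ultimately have "a3\<^sup>2 * c3\<^sup>2 \<le> (a1\<^sup>2 + a2\<^sup>2) * (c1\<^sup>2 + c2\<^sup>2)"
      using zero_le_power2[of "a1 * c2 - a2 * c1"] by linarith
    moreover have "a1\<^sup>2 + a2\<^sup>2 = 1 - a3\<^sup>2" using that(2) by linarith
    ultimately show ?thesis by (simp add: algebra_simps)
  qed
  show ?thesis
    using o[of 1] o[of 2] n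
  proof eventually_elim
    case (elim x)
    have "(m x $ 1)\<^sup>2 + (m x $ 2)\<^sup>2 + (m x $ 3)\<^sup>2 = 1"
      using sphere_sum_squares[of "m x"] elim(3) by (simp add: sum_3)
    from alg[OF elim(1)[unfolded sum_3] this] alg[OF elim(2)[unfolded sum_3] this]
    show ?case
      unfolding sum_3 norm_vec2 by (simp add: algebra_simps)
  qed
qed

section \<open>Local energy and total variation\<close>

lemma local_energy_integrable:
  assumes m: "m \<in> H1_torus_sphere"
  shows "integrable torus_measure (\<lambda>x. (norm (weak_gradient (\<lambda>y. m y $ j) x))\<^sup>2)"
    and "integrable torus_measure (\<lambda>x. 1 - (m x $ 3)\<^sup>2)"
  using L2_torusD(3)[OF H1_sphereD(3)[OF m]] L2_torusD(3)[OF H1_sphereD(1)[OF m, of 3]] by simp_all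

lemma local_energy_eq:
  assumes m: "m \<in> H1_torus_sphere"
  shows "local_energy \<epsilon> m = \<epsilon> / 2 * (\<Sum>j\<in>UNIV. nsq (weak_gradient (\<lambda>y. m y $ j)))
     + 1 / (2 * \<epsilon>) * tint (\<lambda>x. 1 - (m x $ 3)\<^sup>2)"
proof -
  note i = local_energy_integrable[OF m]
  have "local_energy \<epsilon> m = tint (\<lambda>x. \<epsilon> / 2 * (\<Sum>j\<in>UNIV. (norm (weak_gradient (\<lambda>y. m y $ j) x))\<^sup>2))
      + tint (\<lambda>x. 1 / (2 * \<epsilon>) * (1 - (m x $ 3)\<^sup>2))"
    unfolding local_energy_def torus_integral_eq
    by (intro Bochner_Integration.integral_add integrable_mult_right Bochner_Integration.integrable_sum i)
  also have "tint (\<lambda>x. \<epsilon> / 2 * (\<Sum>j\<in>UNIV. (norm (weak_gradient (\<lambda>y. m y $ j) x))\<^sup>2))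
      = \<epsilon> / 2 * (\<Sum>j\<in>UNIV. nsq (weak_gradient (\<lambda>y. m y $ j)))"
    unfolding nsq_def by (subst integral_mult_right_zero, subst Bochner_Integration.integral_sum) (use i in auto)
  finally show ?thesis by (simp only: integral_mult_right_zero)
qed

lemma sphere_m3_le:
  assumes m: "m \<in> L1_torus_sphere"
  shows "AE x in torus_measure. \<bar>m x $ 3\<bar> \<le> 1"
  using sphere_norm[OF m] by eventually_elim (metis component_le_norm_cart)

text \<open>By \<open>sphere_gradient_bound\<close> the length of the gradient of m3 is at most the
  geometric mean of \<epsilon> |grad m|^2 and (1 - m3^2)/\<epsilon>. The local energy density is
  their arithmetic mean.\<close>

lemma total_variation_le_local_energy:
  assumes m: "m \<in> H1_torus_sphere" and "0 < \<epsilon>"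
  shows "total_variation_m3 m \<le> local_energy \<epsilon> m"
  unfolding total_variation_m3_def local_energy_def torus_integral_eq
proof (rule integral_mono_AE)
  note i = local_energy_integrable[OF m]
  show "integrable torus_measure (\<lambda>x. norm (weak_gradient (\<lambda>y. m y $ 3) x))"
    by (intro L2_norm_integrable H1_sphereD[OF m])
  show "integrable torus_measure (\<lambda>x. \<epsilon> / 2 * (\<Sum>j\<in>UNIV. (norm (weak_gradient (\<lambda>y. m y $ j) x))\<^sup>2) + 1 / (2 * \<epsilon>) * (1 - (m x $ 3)\<^sup>2))"
    by (intro Bochner_Integration.integrable_add integrable_mult_right Bochner_Integration.integrable_sum i)
  have alg: "t \<le> \<epsilon> / 2 * S + 1 / (2 * \<epsilon>) * w" if "t\<^sup>2 \<le> w * S" "0 \<le> S" "0 \<le> w" for t S w :: real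
  proof (rule power2_le_imp_le)
    have "(\<epsilon> / 2 * S + 1 / (2 * \<epsilon>) * w)\<^sup>2 - w * S = (\<epsilon> / 2 * S - 1 / (2 * \<epsilon>) * w)\<^sup>2"
      using assms(2) by (simp add: power2_eq_square field_simps)
    then show "t\<^sup>2 \<le> (\<epsilon> / 2 * S + 1 / (2 * \<epsilon>) * w)\<^sup>2"
      using that(1) zero_le_power2[of "\<epsilon> / 2 * S - 1 / (2 * \<epsilon>) * w"] by linarith
    show "0 \<le> \<epsilon> / 2 * S + 1 / (2 * \<epsilon>) * w" using that assms(2) by simp
  qed
  have m1: "m \<in> L1_torus_sphere" using m by (simp add: H1_torus_sphere_def)
  show "AE x in torus_measure. norm (weak_gradient (\<lambda>y. m y $ 3) x)
      \<le> \<epsilon> / 2 * (\<Sum>j\<in>UNIV. (norm (weak_gradient (\<lambda>y. m y $ j) x))\<^sup>2) + 1 / (2 * \<epsilon>) * (1 - (m x $ 3)\<^sup>2)"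
    using sphere_gradient_bound[OF m] sphere_m3_le[OF m1]
    by eventually_elim (intro alg sum_nonneg, auto simp: abs_square_le_1)
qed

subsection \<open>The nonlocal energy bound\<close>

text \<open>The exceptional set is encoded as a periodic function with values 0 and 1, whose
  integral is invariant under the shift.\<close>

lemma AE_torus_shift_le:
  fixes u :: "real^2 \<Rightarrow> real"
  assumes u: "torus_periodic u" "u \<in> borel_measurable borel" and ae: "AE x in torus_measure. u x \<le> B"
  shows "AE x in torus_measure. u (x + z) \<le> B"
proof -
  note u(2)[measurable]
  let ?A = "\<lambda>x. if u x \<le> B then 0 else (1::real)"
  have p: "torus_periodic ?A" using u(1) by (simp add: torus_periodic_def)
  have m: "?A \<in> borel_measurable borel" by measurable
  have b: "integrable torus_measure ?A"
    by (rule torus.integrable_const_bound[where B = 1]) auto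
  have "tint ?A = tint (\<lambda>_. 0::real)"
    by (rule integral_cong_AE) (use ae in \<open>auto elim: eventually_mono\<close>)
  then have "tint (\<lambda>x. ?A (x + z)) = 0"
    using torus_shift(1)[OF p m, of z] by simp
  moreover have "integrable torus_measure (\<lambda>x. ?A (x + z))"
    using torus_shift(2)[OF p m, of z] b by blast
  ultimately have "AE x in torus_measure. ?A (x + z) = 0"
    by (subst (asm) integral_nonneg_eq_0_iff_AE) auto
  then show ?thesis by eventually_elim (simp split: if_splits)
qed

lemma fcoef_shift:
  assumes u: "u \<in> L2_torus" and k: "k \<in> dual_lattice"
  shows "fcoef (\<lambda>x. u (x + z)) k = torus_char k z * fcoef u k"
proof -
  note L2_torusD(2)[OF u, measurable]
  let ?F = "\<lambda>x. torus_char k z * (cnj (torus_char k x) * u x)"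
  have p: "torus_periodic ?F"
    using L2_torusD(1)[OF u] torus_char_periodic[OF k] by (simp add: torus_periodic_def)
  have m: "?F \<in> borel_measurable borel" by measurable
  have one: "torus_char k z * cnj (torus_char k z) = 1"
    using complex_norm_square[of "torus_char k z"] by simp
  have "?F (x + z) = cnj (torus_char k x) * u (x + z)" for x
  proof -
    have "?F (x + z) = (torus_char k z * cnj (torus_char k z)) * (cnj (torus_char k x) * u (x + z))"
      by (simp add: torus_char_shift mult_ac)
    then show ?thesis unfolding one by simp
  qed
  then have "fcoef (\<lambda>x. u (x + z)) k = tint (\<lambda>x. ?F (x + z))"
    unfolding fcoef_def by (intro Bochner_Integration.integral_cong refl) (rule sym)
  also have "\<dots> = tint ?F" by (rule torus_shift(1)[OF p m])
  finally show ?thesis unfolding fcoef_def by simp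
qed

text \<open>For b \<ge> 0 this is the primitive of |exp (i b t) - 1|^2 / t^2 on t > 0 that vanishes
  at 0, in closed form through the sine integral. Its limit \<pi> b at infinity replaces an improper
  integral over the half-line.\<close>

definition dir_kernel :: "real \<Rightarrow> real \<Rightarrow> real" where
  "dir_kernel b t = 2 * b * Si (b * t) - (2 - 2 * cos (b * t)) / t"

lemma dir_kernel_deriv:
  assumes "0 < t" "0 \<le> b"
  shows "(dir_kernel b has_real_derivative (2 - 2 * cos (b * t)) / t\<^sup>2) (at t)"
proof (cases "b = 0")
  case True
  then show ?thesis unfolding dir_kernel_def[abs_def] by simp
next
  case False
  have "((\<lambda>t. Si (b * t)) has_real_derivative sinc (b * t) * b) (at t)"
    by (rule DERIV_chain2[OF DERIV_Si]) (auto intro!: derivative_eq_intros)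
  moreover have "((\<lambda>t. (2 - 2 * cos (b * t)) / t) has_real_derivative
      ((2 * sin (b * t) * b) * t - (2 - 2 * cos (b * t)) * 1) / (t * t)) (at t)"
    using assms(1) by (auto intro!: derivative_eq_intros)
  ultimately have "(dir_kernel b has_real_derivative 2 * b * (sinc (b * t) * b)
      - ((2 * sin (b * t) * b) * t - (2 - 2 * cos (b * t)) * 1) / (t * t)) (at t)"
    unfolding dir_kernel_def[abs_def] by (intro DERIV_diff DERIV_cmult)
  moreover have "2 * b * (sinc (b * t) * b) - ((2 * sin (b * t) * b) * t - (2 - 2 * cos (b * t)) * 1) / (t * t)
      = (2 - 2 * cos (b * t)) / t\<^sup>2"
    using assms False by (simp add: field_simps power2_eq_square)
  ultimately show ?thesis by simp
qed

lemma dir_kernel_at_0: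
  assumes "0 \<le> b"
  shows "(dir_kernel b \<longlongrightarrow> 0) (at_right 0)"
proof -
  have "((\<lambda>t. Si (b * t)) \<longlongrightarrow> Si (b * 0)) (at_right 0)"
    by (intro isCont_tendsto_compose[OF isCont_Si] tendsto_intros)
  then have "((\<lambda>t. 2 * b * Si (b * t)) \<longlongrightarrow> 2 * b * 0) (at_right 0)"
    using Si_neg[of 0] by (intro tendsto_intros) simp
  moreover have "((\<lambda>t. (2 - 2 * cos (b * t)) / t) \<longlongrightarrow> 0) (at_right 0)"
  proof (rule Lim_null_comparison)
    show "((\<lambda>t. b\<^sup>2 * t) \<longlongrightarrow> 0) (at_right (0::real))" by (auto intro!: tendsto_eq_intros)
    have "norm ((2 - 2 * cos (b * t)) / t) \<le> b\<^sup>2 * t" if "0 < t" for t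
    proof -
      have "2 - 2 * cos (b * t) \<le> b\<^sup>2 * t\<^sup>2"
        using two_minus_cos_le[of "b * t"] by (simp add: power_mult_distrib)
      then have "(2 - 2 * cos (b * t)) / t \<le> b\<^sup>2 * t"
        using that by (simp add: divide_le_eq power2_eq_square mult_ac)
      moreover have "0 \<le> (2 - 2 * cos (b * t)) / t" using that by simp
      ultimately show ?thesis by simp
    qed
    then show "\<forall>\<^sub>F t in at_right 0. norm ((2 - 2 * cos (b * t)) / t) \<le> b\<^sup>2 * t"
      by (auto simp: eventually_at_filter intro: always_eventually)
  qed
  ultimately have "((\<lambda>t. 2 * b * Si (b * t) - (2 - 2 * cos (b * t)) / t) \<longlongrightarrow> 2 * b * 0 - 0) (at_right 0)"
    by (rule tendsto_diff)
  then show ?thesis by (simp add: dir_kernel_def[abs_def])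
qed

lemma dir_kernel_at_top:
  assumes "0 \<le> b"
  shows "(dir_kernel b \<longlongrightarrow> pi * b) at_top"
proof (cases "b = 0")
  case True
  then show ?thesis by (simp add: dir_kernel_def[abs_def])
next
  case False
  then have b: "0 < b" using assms by simp
  have "filterlim (\<lambda>t. b * t) at_top at_top"
    using b by (intro filterlim_tendsto_pos_mult_at_top[OF tendsto_const]) (auto simp: filterlim_ident)
  then have "((\<lambda>t. 2 * b * Si (b * t)) \<longlongrightarrow> 2 * b * (pi / 2)) at_top"
    by (intro tendsto_intros filterlim_compose[OF Si_at_top])
  moreover have "((\<lambda>t. (2 - 2 * cos (b * t)) / t) \<longlongrightarrow> 0) at_top"
  proof (rule Lim_null_comparison)
    show "((\<lambda>t. 4 / t) \<longlongrightarrow> (0::real)) at_top"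
      by (intro tendsto_divide_0[OF tendsto_const] filterlim_at_top_imp_at_infinity filterlim_ident)
    have "norm ((2 - 2 * cos (b * t)) / t) \<le> 4 / t" if "0 < t" for t :: real
    proof -
      have "0 \<le> 2 - 2 * cos (b * t)" "2 - 2 * cos (b * t) \<le> 4"
        using cos_ge_minus_one[of "b * t"] cos_le_one[of "b * t"] by linarith+
      then show ?thesis using that divide_right_mono[of "2 - 2 * cos (b * t)" 4 t] by simp
    qed
    then show "\<forall>\<^sub>F t in at_top. norm ((2 - 2 * cos (b * t)) / t) \<le> 4 / t"
      by (rule eventually_mono[OF eventually_gt_at_top[of 0]])
  qed
  ultimately have "((\<lambda>t. 2 * b * Si (b * t) - (2 - 2 * cos (b * t)) / t) \<longlongrightarrow> 2 * b * (pi / 2) - 0) at_top"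
    by (rule tendsto_diff)
  then show ?thesis by (simp add: dir_kernel_def[abs_def] mult.commute)
qed

text \<open>The three bounds are used on \<open>(0, r)\<close>, \<open>(r, R)\<close> and \<open>(R, \<infinity>)\<close> respectively.\<close>

lemma three_scale_bound:
  fixes \<Phi> :: "real \<Rightarrow> real"
  assumes der: "\<And>t. 0 < t \<Longrightarrow> (\<Phi> has_real_derivative \<Phi>' t) (at t)"
    and b: "\<And>t. 0 < t \<Longrightarrow> \<Phi>' t \<le> D" "\<And>t. 0 < t \<Longrightarrow> \<Phi>' t \<le> 2 * P / t" "\<And>t. 0 < t \<Longrightarrow> \<Phi>' t \<le> 4 / t\<^sup>2"
    and l0: "(\<Phi> \<longlongrightarrow> 0) (at_right 0)" and l1: "(\<Phi> \<longlongrightarrow> L) at_top"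
    and r: "0 < r" "r \<le> R"
  shows "L \<le> r * D + 2 * P * ln (R / r) + 4 / R"
proof -
  have "\<Phi> r - r * D \<le> \<Phi> s - s * D" if "0 < s" "s \<le> r" for s
  proof (rule DERIV_nonpos_imp_nonincreasing[OF that(2)])
    fix t assume "s \<le> t" "t \<le> r"
    then have t: "0 < t" using that by simp
    have "((\<lambda>t. \<Phi> t - t * D) has_real_derivative \<Phi>' t - D) (at t)"
      by (auto intro!: derivative_eq_intros der t)
    then show "\<exists>y. ((\<lambda>t. \<Phi> t - t * D) has_real_derivative y) (at t) \<and> y \<le> 0"
      using b(1)[OF t] by fastforce
  qed
  then have "\<forall>\<^sub>F s in at_right 0. \<Phi> r - r * D \<le> \<Phi> s - s * D"
    using r(1) eventually_at_right_less[of 0] by (auto simp: eventually_at_right_field intro: exI[of _ r])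
  moreover have "((\<lambda>s. \<Phi> s - s * D) \<longlongrightarrow> 0) (at_right 0)"
    using l0 by (auto intro!: tendsto_eq_intros)
  ultimately have 1: "\<Phi> r - r * D \<le> 0"
    by (intro tendsto_lowerbound[of _ _ "at_right 0"]) auto
  have 2: "\<Phi> R - 2 * P * ln R \<le> \<Phi> r - 2 * P * ln r"
  proof (rule DERIV_nonpos_imp_nonincreasing[OF r(2)])
    fix t assume "r \<le> t" "t \<le> R"
    then have t: "0 < t" using r by simp
    have "((\<lambda>t. \<Phi> t - 2 * P * ln t) has_real_derivative \<Phi>' t - 2 * P * (1 / t)) (at t)"
      by (intro DERIV_diff DERIV_cmult der t DERIV_ln_divide)
    then show "\<exists>y. ((\<lambda>t. \<Phi> t - 2 * P * ln t) has_real_derivative y) (at t) \<and> y \<le> 0"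
      using b(2)[OF t] by fastforce
  qed
  have "\<Phi> T + 4 / T \<le> \<Phi> R + 4 / R" if "R \<le> T" for T
  proof (rule DERIV_nonpos_imp_nonincreasing[OF that])
    fix t assume "R \<le> t" "t \<le> T"
    then have t: "0 < t" using r by simp
    have "((\<lambda>t. 4 / t) has_real_derivative - (4 / t\<^sup>2)) (at t)"
      using t by (auto intro!: derivative_eq_intros simp: power2_eq_square)
    from DERIV_add[OF der[OF t] this]
    show "\<exists>y. ((\<lambda>t. \<Phi> t + 4 / t) has_real_derivative y) (at t) \<and> y \<le> 0"
      using b(3)[OF t] by fastforce
  qed
  then have "\<forall>\<^sub>F T in at_top. \<Phi> T + 4 / T \<le> \<Phi> R + 4 / R"
    unfolding eventually_at_top_linorder by blast
  moreover have "((\<lambda>t. 4 / t) \<longlongrightarrow> (0::real)) at_top"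
    by (intro tendsto_divide_0[OF tendsto_const] filterlim_at_top_imp_at_infinity filterlim_ident)
  then have "((\<lambda>T. \<Phi> T + 4 / T) \<longlongrightarrow> L + 0) at_top" by (intro tendsto_add l1)
  ultimately have 3: "L + 0 \<le> \<Phi> R + 4 / R"
    by (intro tendsto_upperbound[of _ _ at_top]) auto
  have "ln (R / r) = ln R - ln r" using r by (intro ln_divide_pos) auto
  then have "2 * P * ln (R / r) = 2 * P * ln R - 2 * P * ln r"
    by (simp add: right_diff_distrib)
  then show ?thesis using 1 2 3 by linarith
qed

text \<open>By \<open>fcoef_shift\<close> and Bessel's inequality, \<open>Q t\<close> is at most the
  squared L2 norm of the increment of u along t e. As K is finite, the primitive
  \<open>\<Phi>\<close>, its derivative and its limits are formed term by term, and convergence of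
  the half-gradient series is not presupposed.\<close>

lemma directional_bound:
  fixes u :: "real^2 \<Rightarrow> real"
  assumes u: "u \<in> L2_torus" and u1: "AE x in torus_measure. \<bar>u x\<bar> \<le> 1" and g: "is_weak_gradient u g"
    and K: "finite K" "K \<subseteq> dual_lattice" and e: "norm e = 1" and r: "0 < r" "r \<le> R"
  shows "pi * (\<Sum>k\<in>K. \<bar>k \<bullet> e\<bar> * (norm (fcoef (\<lambda>x. complex_of_real (u x)) k))\<^sup>2)
    \<le> r * nsq g + 2 * tint (\<lambda>x. \<bar>g x \<bullet> e\<bar>) * ln (R / r) + 4 / R"
proof -
  let ?U = "\<lambda>x. complex_of_real (u x)"
  define w where "w k = (norm (fcoef ?U k))\<^sup>2" for k
  define Q where "Q t = (\<Sum>k\<in>K. w k * (2 - 2 * cos (\<bar>k \<bullet> e\<bar> * t)))" for t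
  define \<Phi> where "\<Phi> t = (\<Sum>k\<in>K. w k * dir_kernel \<bar>k \<bullet> e\<bar> t)" for t
  let ?P = "tint (\<lambda>x. \<bar>g x \<bullet> e\<bar>)"
  have UL: "?U \<in> L2_torus" using u by (simp add: L2_of_real_iff)
  have gL: "g \<in> L2_torus" using g by (simp add: is_weak_gradient_def)
  note um = L2_torusD(2)[OF u, measurable]
  have w0: "0 \<le> w k" for k by (simp add: w_def)
  have cosab: "cos (\<bar>k \<bullet> e\<bar> * t) = cos (k \<bullet> (t *\<^sub>R e))" for k t
    by (cases "k \<bullet> e \<ge> 0") (auto simp: mult.commute abs_if)
  have Q_shift: "Q t \<le> nsq (\<lambda>x. ?U (x + t *\<^sub>R e) - ?U x)" for t
  proof -
    have sL: "(\<lambda>x. ?U (x + t *\<^sub>R e)) \<in> L2_torus" by (rule L2_shift(1)[OF UL])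
    have "Q t = (\<Sum>k\<in>K. (norm (fcoef (\<lambda>x. ?U (x + t *\<^sub>R e) - ?U x) k))\<^sup>2)"
      unfolding Q_def
    proof (rule sum.cong)
      fix k assume "k \<in> K"
      then have k: "k \<in> dual_lattice" using K by auto
      have "fcoef (\<lambda>x. ?U (x + t *\<^sub>R e) - ?U x) k = (cis (k \<bullet> (t *\<^sub>R e)) - 1) * fcoef ?U k"
        by (simp add: fcoef_diff[OF sL UL k] fcoef_shift[OF UL k] torus_char_def algebra_simps)
      then show "w k * (2 - 2 * cos (\<bar>k \<bullet> e\<bar> * t)) = (norm (fcoef (\<lambda>x. ?U (x + t *\<^sub>R e) - ?U x) k))\<^sup>2"
        unfolding cosab w_def by (simp add: norm_mult power_mult_distrib norm_cis_diff_sq)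
    qed simp
    also have "\<dots> \<le> nsq (\<lambda>x. ?U (x + t *\<^sub>R e) - ?U x)"
      by (intro Bessel K L2_diff sL UL)
    finally show ?thesis .
  qed
  have nsq_shift: "nsq (\<lambda>x. ?U (x + t *\<^sub>R e) - ?U x) = tint (\<lambda>x. (u (x + t *\<^sub>R e) - u x)\<^sup>2)" for t
    unfolding nsq_def by (simp flip: of_real_diff)
  have absp: "torus_periodic (\<lambda>x. \<bar>u x\<bar>)" using L2_torusD(1)[OF u] by (simp add: torus_periodic_def)
  have absm: "(\<lambda>x. \<bar>u x\<bar>) \<in> borel_measurable borel" by measurable
  have ae2: "AE x in torus_measure. \<bar>u (x + t *\<^sub>R e) - u x\<bar> \<le> 2" for t
    using u1 AE_torus_shift_le[OF absp absm u1, of "t *\<^sub>R e"] by eventually_elim auto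
  have dL: "(\<lambda>x. u (x + t *\<^sub>R e) - u x) \<in> L2_torus" for t
    by (intro L2_diff L2_shift u)
  \<comment> \<open>This bound is read off in Fourier space from 2 - 2 cos s \<le> s^2, without
    passing through increments of u.\<close>
  have Q1: "Q t \<le> t\<^sup>2 * nsq g" for t
  proof -
    have "Q t \<le> (\<Sum>k\<in>K. t\<^sup>2 * (norm (fcoef (\<lambda>x. complex_of_real (g x \<bullet> e)) k))\<^sup>2)"
      unfolding Q_def
    proof (rule sum_mono)
      fix k assume "k \<in> K"
      then have k: "k \<in> dual_lattice" using K by auto
      have "w k * (2 - 2 * cos (\<bar>k \<bullet> e\<bar> * t)) \<le> w k * (\<bar>k \<bullet> e\<bar> * t)\<^sup>2"
        by (intro mult_left_mono two_minus_cos_le w0)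
      also have "\<dots> = t\<^sup>2 * (norm (fcoef (\<lambda>x. complex_of_real (g x \<bullet> e)) k))\<^sup>2"
        unfolding weak_gradient_fcoef_inner[OF u g k] w_def
        by (simp add: norm_mult power_mult_distrib mult_ac)
      finally show "w k * (2 - 2 * cos (\<bar>k \<bullet> e\<bar> * t)) \<le> t\<^sup>2 * (norm (fcoef (\<lambda>x. complex_of_real (g x \<bullet> e)) k))\<^sup>2" .
    qed
    also have "\<dots> \<le> t\<^sup>2 * nsq (\<lambda>x. complex_of_real (g x \<bullet> e))"
      unfolding sum_distrib_left[symmetric]
      by (intro mult_left_mono Bessel K) (auto simp: L2_of_real_iff L2_inner gL)
    \<comment> \<open>Replacing the component along e by the full gradient loses a factor 2 after
      averaging, but only in the term with r, which the local energy still absorbs.\<close>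
    also have "\<dots> \<le> t\<^sup>2 * nsq g"
    proof (rule mult_left_mono)
      have "norm (g x \<bullet> e) \<le> norm (g x)" for x
        using Cauchy_Schwarz_ineq2[of "g x" e] e by simp
      then show "nsq (\<lambda>x. complex_of_real (g x \<bullet> e)) \<le> nsq g"
        unfolding nsq_of_real unfolding nsq_def
        by (intro integral_mono L2_torusD(3) L2_inner gL power_mono) auto
    qed simp
    finally show ?thesis .
  qed
  have Q2: "Q t \<le> 2 * t * ?P" if "0 < t" for t
  proof -
    have "tint (\<lambda>x. (u (x + t *\<^sub>R e) - u x)\<^sup>2) \<le> tint (\<lambda>x. 2 * \<bar>u (x + t *\<^sub>R e) - u x\<bar>)"
    proof (rule integral_mono_AE)
      show "integrable torus_measure (\<lambda>x. (u (x + t *\<^sub>R e) - u x)\<^sup>2)"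
        using L2_torusD(3)[OF dL[of t]] by simp
      show "integrable torus_measure (\<lambda>x. 2 * \<bar>u (x + t *\<^sub>R e) - u x\<bar>)"
        using L2_norm_integrable[OF dL[of t]] by simp
      show "AE x in torus_measure. (u (x + t *\<^sub>R e) - u x)\<^sup>2 \<le> 2 * \<bar>u (x + t *\<^sub>R e) - u x\<bar>"
        using ae2[of t]
      proof eventually_elim
        case (elim x)
        have "\<bar>u (x + t *\<^sub>R e) - u x\<bar> * \<bar>u (x + t *\<^sub>R e) - u x\<bar> \<le> 2 * \<bar>u (x + t *\<^sub>R e) - u x\<bar>"
          using elim by (intro mult_right_mono) auto
        then show ?case by (simp add: power2_eq_square)
      qed
    qed
    also have "\<dots> = 2 * tint (\<lambda>x. \<bar>u (x + t *\<^sub>R e) - u x\<bar>)" by simp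
    also have "\<dots> \<le> 2 * tint (\<lambda>x. \<bar>g x \<bullet> (t *\<^sub>R e)\<bar>)"
      using translate_L1[OF u g, of "t *\<^sub>R e"] by simp
    also have "\<dots> = 2 * t * ?P" using that by (simp add: abs_mult)
    finally show ?thesis using Q_shift[of t] nsq_shift[of t] by simp
  qed
  have Q3: "Q t \<le> 4" for t
  proof -
    have "tint (\<lambda>x. (u (x + t *\<^sub>R e) - u x)\<^sup>2) \<le> tint (\<lambda>x. 4::real)"
    proof (rule integral_mono_AE)
      show "integrable torus_measure (\<lambda>x. (u (x + t *\<^sub>R e) - u x)\<^sup>2)"
        using L2_torusD(3)[OF dL[of t]] by simp
      show "AE x in torus_measure. (u (x + t *\<^sub>R e) - u x)\<^sup>2 \<le> 4"
        using ae2[of t]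
      proof eventually_elim
        case (elim x)
        have "\<bar>u (x + t *\<^sub>R e) - u x\<bar>\<^sup>2 \<le> 2\<^sup>2" by (rule power_mono[OF elim]) simp
        then show ?case by simp
      qed
    qed simp
    also have "\<dots> = 4" using torus.prob_space by simp
    finally show ?thesis using Q_shift[of t] nsq_shift[of t] by simp
  qed
  have "(\<Sum>k\<in>K. w k * (pi * \<bar>k \<bullet> e\<bar>)) \<le> r * nsq g + 2 * ?P * ln (R / r) + 4 / R"
  proof (rule three_scale_bound[where \<Phi> = \<Phi> and \<Phi>' = "\<lambda>t. Q t / t\<^sup>2", OF _ _ _ _ _ _ r])
    fix t :: real assume t: "0 < t"
    have "(\<Phi> has_real_derivative (\<Sum>k\<in>K. w k * ((2 - 2 * cos (\<bar>k \<bullet> e\<bar> * t)) / t\<^sup>2))) (at t)"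
      unfolding \<Phi>_def[abs_def] by (intro DERIV_sum DERIV_cmult dir_kernel_deriv t) simp
    then show "(\<Phi> has_real_derivative Q t / t\<^sup>2) (at t)"
      by (simp add: Q_def sum_divide_distrib)
    show "Q t / t\<^sup>2 \<le> nsq g" using Q1[of t] t by (simp add: divide_le_eq mult.commute)
    show "Q t / t\<^sup>2 \<le> 2 * ?P / t"
      using Q2[OF t] t by (simp add: divide_le_eq power2_eq_square mult_ac)
    show "Q t / t\<^sup>2 \<le> 4 / t\<^sup>2" using Q3[of t] by (intro divide_right_mono) auto
  next
    have "(\<Phi> \<longlongrightarrow> (\<Sum>k\<in>K. w k * 0)) (at_right 0)"
      unfolding \<Phi>_def[abs_def] by (intro tendsto_sum tendsto_mult_left dir_kernel_at_0) simp
    then show "(\<Phi> \<longlongrightarrow> 0) (at_right 0)" by simp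
    show "(\<Phi> \<longlongrightarrow> (\<Sum>k\<in>K. w k * (pi * \<bar>k \<bullet> e\<bar>))) at_top"
      unfolding \<Phi>_def[abs_def] by (intro tendsto_sum tendsto_mult_left dir_kernel_at_top) simp
  qed
  then show ?thesis
    unfolding w_def by (simp add: sum_distrib_left mult_ac)
qed

subsection \<open>Averaging over directions\<close>

definition dirv :: "real \<Rightarrow> real^2" where
  "dirv t = (\<chi> i. if i = 1 then cos t else sin t)"

lemma norm_dirv: "norm (dirv t) = 1"
proof -
  have "(norm (dirv t))\<^sup>2 = 1" unfolding norm_vec2 by (simp add: dirv_def)
  then show ?thesis by (simp add: power2_eq_1_iff) (metis norm_ge_zero not_one_le_zero neg_0_le_iff_le le_minus_one_simps(3))
qed

text \<open>The value 4 over a period 2 \<pi> is the mean 2/\<pi> that determines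
  \<open>lambda_c\<close>.\<close>

lemma integral_abs_cos: "((\<lambda>t. \<bar>cos t\<bar>) has_integral 4) {0..2 * pi}"
proof -
  have 1: "((\<lambda>t. \<bar>cos t\<bar>) has_integral (sin (pi/2) - sin 0)) {0..pi/2}"
  proof -
    have "(cos has_integral (sin (pi/2) - sin 0)) {0..pi/2}"
      by (rule fundamental_theorem_of_calculus) (auto intro!: derivative_eq_intros simp: has_real_derivative_iff_has_vector_derivative[symmetric])
    then show ?thesis
      by (rule has_integral_eq[rotated]) (auto simp: cos_ge_zero)
  qed
  have 2: "((\<lambda>t. \<bar>cos t\<bar>) has_integral (- sin (3*pi/2) - - sin (pi/2))) {pi/2..3*pi/2}"
  proof -
    have "((\<lambda>t. - cos t) has_integral (- sin (3*pi/2) - - sin (pi/2))) {pi/2..3*pi/2}"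
      by (rule fundamental_theorem_of_calculus) (auto intro!: derivative_eq_intros simp: has_real_derivative_iff_has_vector_derivative[symmetric])
    then show ?thesis
    proof (rule has_integral_eq[rotated])
      fix t assume t: "t \<in> {pi/2..3*pi/2}"
      have "0 \<le> cos (t - pi)" by (rule cos_ge_zero) (use t in auto)
      then show "- cos t = \<bar>cos t\<bar>" by (simp add: cos_diff)
    qed
  qed
  have 3: "((\<lambda>t. \<bar>cos t\<bar>) has_integral (sin (2*pi) - sin (3*pi/2))) {3*pi/2..2*pi}"
  proof -
    have "(cos has_integral (sin (2*pi) - sin (3*pi/2))) {3*pi/2..2*pi}"
      by (rule fundamental_theorem_of_calculus) (auto intro!: derivative_eq_intros simp: has_real_derivative_iff_has_vector_derivative[symmetric])
    then show ?thesis
    proof (rule has_integral_eq[rotated])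
      fix t assume t: "t \<in> {3*pi/2..2*pi}"
      have "0 \<le> cos (t - 2 * pi)" by (rule cos_ge_zero) (use t in auto)
      then show "cos t = \<bar>cos t\<bar>" by (simp add: cos_diff)
    qed
  qed
  have s: "sin (3 * pi / 2) = -1"
  proof -
    have "sin (3 * pi / 2) = sin (pi + pi / 2)" by (simp add: field_simps)
    then show ?thesis unfolding sin_add by simp
  qed
  have "((\<lambda>t. \<bar>cos t\<bar>) has_integral ((sin (pi/2) - sin 0) + (- sin (3*pi/2) - - sin (pi/2)))) {0..3*pi/2}"
    by (rule has_integral_combine[OF _ _ 1 2]) auto
  from has_integral_combine[OF _ _ this 3]
  show ?thesis by (simp add: s)
qed

text \<open>The integral over a window of length 2 \<pi> has derivative f (t + 2 \<pi>) - f t = 0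
  with respect to its left end.\<close>

lemma periodic_integral_shift:
  fixes f :: "real \<Rightarrow> real"
  assumes cont: "continuous_on UNIV f" and per: "\<And>t. f (t + 2 * pi) = f t"
  shows "((\<lambda>t. f (t + \<phi>)) has_integral integral {0..2 * pi} f) {0..2 * pi}"
proof -
  \<comment> \<open>The base interval is wide enough for all windows starting in an open interval
    that contains both 0 and \<open>\<phi>\<close>.\<close>
  define a where "a = - \<bar>\<phi>\<bar> - 2"
  define b where "b = \<bar>\<phi>\<bar> + 2 + 2 * pi"
  define F where "F t = integral {a..t} f" for t
  have ci: "continuous_on T f" for T using cont continuous_on_subset by blast
  have int: "f integrable_on {c..d}" for c d
    by (intro integrable_continuous_interval ci)
  have DF: "(F has_real_derivative f t) (at t)" if "a < t" "t < b" for t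
  proof -
    have "(F has_real_derivative f t) (at t within {a..b})"
      unfolding F_def using that by (intro integral_has_real_derivative ci) auto
    then show ?thesis
      using that by (metis at_within_Icc_at)
  qed
  define B where "B t = F (t + 2 * pi) - F t" for t
  let ?I = "{- \<bar>\<phi>\<bar> - 1<..<\<bar>\<phi>\<bar> + 1}"
  have pi: "0 < 2 * pi" by simp
  have DB: "(B has_real_derivative 0) (at t)" if "t \<in> ?I" for t
  proof -
    have t: "a < t" "t < b" "a < t + 2 * pi" "t + 2 * pi < b"
      using that pi unfolding a_def b_def greaterThanLessThan_iff by linarith+
    have "((\<lambda>t. F (t + 2 * pi)) has_real_derivative f (t + 2 * pi)) (at t)"
      using DF[OF t(3,4)] by (simp add: DERIV_shift)
    from DERIV_diff[OF this DF[OF t(1,2)]]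
    show ?thesis unfolding B_def[abs_def] by (simp add: per)
  qed
  have const: "B \<phi> = B 0"
  proof (rule has_derivative_zero_unique[where s = ?I and f = B])
    show "convex ?I" by simp
    show "(B has_derivative (\<lambda>h. 0)) (at x within ?I)" if "x \<in> ?I" for x
    proof -
      have "(*) 0 = (\<lambda>h::real. 0)" by auto
      then show ?thesis
        using DB[OF that] unfolding has_field_derivative_def by (metis has_derivative_at_withinI)
    qed
  qed auto
  have B_int: "B t = integral {t..t + 2 * pi} f" if "a \<le> t" for t
  proof -
    have "integral {a..t} f + integral {t..t + 2 * pi} f = integral {a..t + 2 * pi} f"
      using that pi by (intro Henstock_Kurzweil_Integration.integral_combine int) auto
    then show ?thesis by (simp add: B_def F_def)
  qed
  have "a \<le> \<phi>" "a \<le> 0" unfolding a_def by linarith+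
  then have "integral {\<phi>..\<phi> + 2 * pi} f = integral {0..2 * pi} f"
    using B_int[of \<phi>] B_int[of 0] const by simp
  then have "(f has_integral integral {0..2 * pi} f) (cbox \<phi> (\<phi> + 2 * pi))"
    using int[of \<phi> "\<phi> + 2 * pi"] by (metis has_integral_integral interval_cbox)
  from has_integral_affinity[OF this, of 1 \<phi>]
  show ?thesis by (simp add: add.commute)
qed

definition dir_measure :: "real measure" where
  "dir_measure = restrict_space lborel {0..2 * pi}"

lemma finite_dir_measure: "finite_measure dir_measure"
  by (rule finite_measureI) (simp add: dir_measure_def emeasure_restrict_space space_restrict_space)

lemma integral_dir_measure:
  assumes "continuous_on UNIV f" "(f has_integral I) {0..2 * pi}"
  shows "integral\<^sup>L dir_measure f = (I :: real)" "integrable dir_measure f"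
proof -
  have s: "set_integrable lborel {0..2 * pi} f"
    using borel_integrable_compact[of "{0..2*pi}" f] assms(1)
    by (auto simp: set_integrable_def indicator_def if_distrib cong: if_cong intro: continuous_on_subset)
  then show "integrable dir_measure f"
    by (simp add: dir_measure_def integrable_restrict_space set_integrable_def)
  have "integral\<^sup>L dir_measure f = set_lebesgue_integral lborel {0..2 * pi} f"
    by (simp add: dir_measure_def integral_restrict_space set_lebesgue_integral_def)
  also have "\<dots> = integral {0..2 * pi} f" using s by (rule set_borel_integral_eq_integral(2))
  also have "\<dots> = I" using assms(2) by (rule integral_unique)
  finally show "integral\<^sup>L dir_measure f = I" .
qed

text \<open>In polar form the integrand is |v| times |cos|, shifted by the angle of v; by
  periodicity the shift does not affect the integral.\<close>

lemma integral_abs_inner_dirv: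
  "integral\<^sup>L dir_measure (\<lambda>t. \<bar>v \<bullet> dirv t\<bar>) = 4 * norm v"
  "integrable dir_measure (\<lambda>t. \<bar>v \<bullet> dirv t\<bar>)"
proof -
  define z where "z = Complex (v $ 1) (v $ 2)"
  have nz: "norm z = norm v"
    unfolding z_def complex_norm by (simp add: norm_vec2[symmetric])
  have eq: "\<bar>v \<bullet> dirv t\<bar> = norm v * \<bar>cos (t - Arg z)\<bar>" for t
  proof -
    have "z = of_real (norm v) * cis (Arg z)"
      using rcis_cmod_Arg[of z] by (simp add: rcis_def nz)
    then have "v $ 1 = norm v * cos (Arg z)" "v $ 2 = norm v * sin (Arg z)"
      unfolding z_def complex_eq_iff by simp_all
    then have "v \<bullet> dirv t = norm v * (cos (Arg z) * cos t + sin (Arg z) * sin t)"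
      unfolding inner_vec_def sum_2 dirv_def by (simp add: algebra_simps)
    then show ?thesis by (simp add: cos_diff abs_mult mult.commute)
  qed
  have "((\<lambda>t. \<bar>cos (t + - Arg z)\<bar>) has_integral integral {0..2 * pi} (\<lambda>t. \<bar>cos t\<bar>)) {0..2 * pi}"
    by (rule periodic_integral_shift) (auto intro!: continuous_intros)
  then have "((\<lambda>t. \<bar>cos (t - Arg z)\<bar>) has_integral 4) {0..2 * pi}"
    using integral_unique[OF integral_abs_cos] by simp
  then have "((\<lambda>t. norm v * \<bar>cos (t - Arg z)\<bar>) has_integral norm v * 4) {0..2 * pi}"
    by (rule has_integral_mult_right)
  then have *: "((\<lambda>t. \<bar>v \<bullet> dirv t\<bar>) has_integral norm v * 4) {0..2 * pi}"
    by (simp add: eq)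
  have c: "continuous_on UNIV (\<lambda>t. \<bar>v \<bullet> dirv t\<bar>)"
    unfolding eq by (intro continuous_intros)
  show "integral\<^sup>L dir_measure (\<lambda>t. \<bar>v \<bullet> dirv t\<bar>) = 4 * norm v" "integrable dir_measure (\<lambda>t. \<bar>v \<bullet> dirv t\<bar>)"
    using integral_dir_measure[OF c *] by simp_all
qed

lemma integral_dir_const: "integral\<^sup>L dir_measure (\<lambda>t. c) = 2 * pi * (c::real)" "integrable dir_measure (\<lambda>t. c)"
proof -
  have "((\<lambda>t. c) has_integral 2 * pi * c) {0..2 * pi}"
    using has_integral_const_real[of c 0 "2 * pi"] by simp
  from integral_dir_measure[OF _ this]
  show "integral\<^sup>L dir_measure (\<lambda>t. c) = 2 * pi * c" "integrable dir_measure (\<lambda>t. c)" by simp_all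
qed

text \<open>Averaging the directional variations recovers the total variation, as in Crofton's
  formula.\<close>

lemma average_directional_variation:
  assumes g: "g \<in> L2_torus"
  shows "integral\<^sup>L dir_measure (\<lambda>t. tint (\<lambda>x. \<bar>g x \<bullet> dirv t\<bar>))
      = 4 * tint (\<lambda>x. norm (g x))"
    "integrable dir_measure (\<lambda>t. tint (\<lambda>x. \<bar>g x \<bullet> dirv t\<bar>))"
proof -
  interpret D: finite_measure dir_measure by (rule finite_dir_measure)
  interpret P: pair_sigma_finite torus_measure dir_measure ..
  note L2_torusD(2)[OF g, measurable]
  have dm [measurable]: "dirv \<in> borel_measurable borel"
  proof -
    have "dirv = (\<lambda>t. cos t *\<^sub>R axis 1 1 + sin t *\<^sub>R axis 2 1)"
      by (simp add: dirv_def fun_eq_iff vec_eq_iff axis_def forall_2)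
    then show ?thesis by (rule ssubst) measurable
  qed
  have id [measurable]: "(\<lambda>t. t) \<in> measurable dir_measure borel"
    unfolding dir_measure_def by (rule measurable_restrict_space1) simp
  have m: "case_prod (\<lambda>x t. \<bar>g x \<bullet> dirv t\<bar>) \<in> borel_measurable (torus_measure \<Otimes>\<^sub>M dir_measure)"
    by measurable
  have int: "integrable (torus_measure \<Otimes>\<^sub>M dir_measure) (case_prod (\<lambda>x t. \<bar>g x \<bullet> dirv t\<bar>))"
    by (rule P.Fubini_integrable[OF m])
      (simp_all add: integral_abs_inner_dirv L2_norm_integrable[OF g])
  show "integral\<^sup>L dir_measure (\<lambda>t. tint (\<lambda>x. \<bar>g x \<bullet> dirv t\<bar>))
      = 4 * tint (\<lambda>x. norm (g x))"
    using P.Fubini_integral[OF int] by (simp add: integral_abs_inner_dirv)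
  show "integrable dir_measure (\<lambda>t. tint (\<lambda>x. \<bar>g x \<bullet> dirv t\<bar>))"
    using P.integrable_snd[OF int] by simp
qed

text \<open>\<open>directional_bound\<close> is integrated over all directions for finite K. The
  result does not depend on K, so the series converges, the \<open>infsum\<close> has its proper
  value and inherits the bound. Convergence is recorded separately for later comparisons of single
  terms and tails.\<close>

theorem half_gradient_energy_bound:
  fixes u :: "real^2 \<Rightarrow> real"
  assumes u: "u \<in> L2_torus" and u1: "AE x in torus_measure. \<bar>u x\<bar> \<le> 1" and g: "is_weak_gradient u g"
    and r: "0 < r" "r \<le> R"
  shows "half_gradient_energy u \<le> r / 2 * nsq g + 2 / pi * ln (R / r) * tint (\<lambda>x. norm (g x)) + 2 / R"
    and "((\<lambda>k. norm k * (norm (fourier_coeff u k))\<^sup>2) has_sum half_gradient_energy u) dual_lattice"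
proof -
  let ?c = "\<lambda>k. (norm (fcoef (\<lambda>x. complex_of_real (u x)) k))\<^sup>2"
  let ?P = "tint (\<lambda>x. norm (g x))"
  let ?B = "r / 2 * nsq g + 2 / pi * ln (R / r) * ?P + 2 / R"
  have gL: "g \<in> L2_torus" using g by (simp add: is_weak_gradient_def)
  have fin: "(\<Sum>k\<in>K. norm k * ?c k) \<le> ?B" if K: "finite K" "K \<subseteq> dual_lattice" for K
  proof -
    have "integral\<^sup>L dir_measure (\<lambda>t. pi * (\<Sum>k\<in>K. \<bar>k \<bullet> dirv t\<bar> * ?c k))
      \<le> integral\<^sup>L dir_measure (\<lambda>t. (r * nsq g + 4 / R) + 2 * ln (R / r) * tint (\<lambda>x. \<bar>g x \<bullet> dirv t\<bar>))"
    proof (rule integral_mono)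
      show "integrable dir_measure (\<lambda>t. pi * (\<Sum>k\<in>K. \<bar>k \<bullet> dirv t\<bar> * ?c k))"
        by (intro integrable_mult_right Bochner_Integration.integrable_sum integrable_mult_left integral_abs_inner_dirv)
      show "integrable dir_measure (\<lambda>t. (r * nsq g + 4 / R) + 2 * ln (R / r) * tint (\<lambda>x. \<bar>g x \<bullet> dirv t\<bar>))"
        by (intro Bochner_Integration.integrable_add integral_dir_const integrable_mult_right average_directional_variation gL)
      show "pi * (\<Sum>k\<in>K. \<bar>k \<bullet> dirv t\<bar> * ?c k)
          \<le> (r * nsq g + 4 / R) + 2 * ln (R / r) * tint (\<lambda>x. \<bar>g x \<bullet> dirv t\<bar>)" for t
        using directional_bound[OF u u1 g K norm_dirv r] by (simp add: algebra_simps)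
    qed
    also have "\<dots> = 2 * pi * (r * nsq g + 4 / R) + 2 * ln (R / r) * (4 * ?P)"
      unfolding Bochner_Integration.integral_add[OF integral_dir_const(2)
          integrable_mult_right[OF average_directional_variation(2)[OF gL]]]
        integral_mult_right_zero integral_dir_const(1) average_directional_variation(1)[OF gL] ..
    also have "integral\<^sup>L dir_measure (\<lambda>t. pi * (\<Sum>k\<in>K. \<bar>k \<bullet> dirv t\<bar> * ?c k)) = pi * (\<Sum>k\<in>K. 4 * norm k * ?c k)"
      by (subst integral_mult_right_zero, subst Bochner_Integration.integral_sum)
        (simp_all add: integral_abs_inner_dirv)
    finally have "pi * (4 * (\<Sum>k\<in>K. norm k * ?c k)) \<le> 2 * pi * (r * nsq g + 4 / R) + 2 * ln (R / r) * (4 * ?P)"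
      by (simp add: sum_distrib_left mult_ac)
    then have "4 * (\<Sum>k\<in>K. norm k * ?c k) \<le> (2 * pi * (r * nsq g + 4 / R) + 2 * ln (R / r) * (4 * ?P)) / pi"
      by (simp add: pos_le_divide_eq mult.commute)
    also have "\<dots> = 2 * (r * nsq g) + 8 * (1 / R) + 8 * (ln (R / r) * ?P / pi)"
      by (simp add: field_simps)
    finally have "4 * (\<Sum>k\<in>K. norm k * ?c k) \<le> 2 * (r * nsq g) + 8 * (1 / R) + 8 * (ln (R / r) * ?P / pi)" .
    moreover have "?B = (r * nsq g) / 2 + 2 * (ln (R / r) * ?P / pi) + 2 * (1 / R)"
      by (simp add: field_simps)
    ultimately show ?thesis by linarith
  qed
  have sm: "(\<lambda>k. norm k * ?c k) summable_on dual_lattice"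
    by (rule nonneg_bdd_above_summable_on) (use fin in \<open>auto intro!: bdd_aboveI2[of _ _ ?B]\<close>)
  have hs: "((\<lambda>k. norm k * ?c k) has_sum half_gradient_energy u) dual_lattice"
    using has_sum_infsum[OF sm] unfolding half_gradient_energy_def fourier_coeff_eq .
  show "half_gradient_energy u \<le> ?B"
    by (rule has_sum_le_finite_sums[OF hs]) (use fin in blast)
  show "((\<lambda>k. norm k * (norm (fourier_coeff u k))\<^sup>2) has_sum half_gradient_energy u) dual_lattice"
    using hs unfolding fourier_coeff_eq .
qed

subsection \<open>Coercivity\<close>

text \<open>The finite value of \<open>F_energy\<close> on \<open>H1_torus_sphere\<close>, which
  keeps the estimates out of the extended reals.\<close>

definition energy :: "real \<Rightarrow> real \<Rightarrow> (real^2 \<Rightarrow> real^3) \<Rightarrow> real" where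
  "energy \<epsilon> l m = local_energy \<epsilon> m - nonlocal_energy \<epsilon> l m"

lemma H1_sphere_L1: "m \<in> H1_torus_sphere \<Longrightarrow> m \<in> L1_torus_sphere"
  by (simp add: H1_torus_sphere_def)

lemma total_variation_eq:
  "total_variation_m3 m = tint (\<lambda>x. norm (weak_gradient (\<lambda>y. m y $ 3) x))"
  by (simp add: total_variation_m3_def torus_integral_eq)

lemma total_variation_nonneg: "0 \<le> total_variation_m3 m"
  by (simp add: total_variation_eq)

lemma anisotropy_nonneg:
  assumes "m \<in> L1_torus_sphere"
  shows "0 \<le> tint (\<lambda>x. 1 - (m x $ 3)\<^sup>2)"
  by (rule integral_nonneg_AE) (use sphere_m3_le[OF assms] in \<open>auto simp: abs_square_le_1 elim: eventually_mono\<close>)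

lemma gradient_le_local_energy:
  assumes m: "m \<in> H1_torus_sphere" and "0 < \<epsilon>"
  shows "\<epsilon> / 2 * (\<Sum>j\<in>UNIV. nsq (weak_gradient (\<lambda>y. m y $ j))) \<le> local_energy \<epsilon> m"
    "\<epsilon> / 2 * nsq (weak_gradient (\<lambda>y. m y $ j)) \<le> local_energy \<epsilon> m"
proof -
  show 1: "\<epsilon> / 2 * (\<Sum>j\<in>UNIV. nsq (weak_gradient (\<lambda>y. m y $ j))) \<le> local_energy \<epsilon> m"
    using anisotropy_nonneg[OF H1_sphere_L1[OF m]] assms(2) by (simp add: local_energy_eq[OF m])
  have "nsq (weak_gradient (\<lambda>y. m y $ j)) \<le> (\<Sum>j\<in>UNIV. nsq (weak_gradient (\<lambda>y. m y $ j)))"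
    by (rule member_le_sum) auto
  then have "\<epsilon> / 2 * nsq (weak_gradient (\<lambda>y. m y $ j)) \<le> \<epsilon> / 2 * (\<Sum>j\<in>UNIV. nsq (weak_gradient (\<lambda>y. m y $ j)))"
    using assms(2) by (intro mult_left_mono) auto
  with 1 show "\<epsilon> / 2 * nsq (weak_gradient (\<lambda>y. m y $ j)) \<le> local_energy \<epsilon> m" by linarith
qed

section \<open>The nonlocal energy at the perimeter scale\<close>

lemma lambda_c_pos: "0 < lambda_c" by (simp add: lambda_c_def)

lemma perimeter_scale_exp:
  assumes "0 < \<epsilon>" "\<epsilon> < 1"
  shows "perimeter_scale \<epsilon> l = exp (\<bar>ln \<epsilon>\<bar> * ((l - lambda_c) / l))"
proof -
  have "\<bar>ln \<epsilon>\<bar> = - ln \<epsilon>" using assms by simp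
  then show ?thesis
    unfolding perimeter_scale_def powr_def using assms(1) by (simp add: field_simps minus_divide_left[symmetric])
qed

lemma perimeter_scale_pos: "0 < \<epsilon> \<Longrightarrow> 0 < perimeter_scale \<epsilon> l"
  by (simp add: perimeter_scale_def)

text \<open>This is \<open>half_gradient_energy_bound\<close> with r = \<epsilon> and R = exp (- b)
  / S, where S is the perimeter scale. The condition on b is exactly \<epsilon> \<le> R, the term
  with r goes into the local energy, and 2 / R becomes 2 exp b S.\<close>

lemma nonlocal_energy_bound:
  assumes m: "m \<in> H1_torus_sphere" and \<epsilon>: "0 < \<epsilon>" "\<epsilon> < 1" and l: "lambda_c < l"
    and b: "b \<le> lambda_c * \<bar>ln \<epsilon>\<bar> / l"
  shows "nonlocal_energy \<epsilon> l m \<le> total_variation_m3 m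
    + l / \<bar>ln \<epsilon>\<bar> * (local_energy \<epsilon> m - b / lambda_c * total_variation_m3 m + 2 * exp b * perimeter_scale \<epsilon> l)"
proof -
  define L where "L = \<bar>ln \<epsilon>\<bar>"
  have L: "0 < L" "ln \<epsilon> = - L" using \<epsilon> by (simp_all add: L_def)
  have lc: "0 < lambda_c" by (rule lambda_c_pos)
  have l0: "0 < l" using l lc by simp
  let ?P = "total_variation_m3 m" and ?E = "local_energy \<epsilon> m" and ?S = "perimeter_scale \<epsilon> l"
  let ?g = "weak_gradient (\<lambda>y. m y $ 3)"
  define R where "R = exp (- b - L * ((l - lambda_c) / l))"
  have S: "?S = exp (L * ((l - lambda_c) / l))" using perimeter_scale_exp[OF \<epsilon>] by (simp add: L_def)
  \<comment> \<open>The exponent in S is such that this logarithm is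
    \<open>L * (lambda_c / l)\<close> up to \<open>b\<close>; multiplied by
    \<open>l / (L * lambda_c)\<close> its main part becomes 1.\<close>
  have lnR: "ln (R / \<epsilon>) = L * (lambda_c / l) - b"
  proof -
    have "ln (R / \<epsilon>) = ln R - ln \<epsilon>" using \<epsilon> by (simp add: R_def ln_div)
    also have "\<dots> = - b - L * ((l - lambda_c) / l) + L" by (simp add: R_def L)
    also have "\<dots> = L * (lambda_c / l) - b" using l0 by (simp add: field_simps)
    finally show ?thesis .
  qed
  have "\<epsilon> \<le> R"
  proof -
    have "0 \<le> ln (R / \<epsilon>)" using b unfolding lnR L_def by (simp add: mult.commute)
    moreover have "0 < R / \<epsilon>" using \<epsilon> by (simp add: R_def)
    ultimately have "1 \<le> R / \<epsilon>" by (simp add: ln_ge_zero_iff)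
    then show ?thesis using \<epsilon> by (simp add: le_divide_eq)
  qed
  have RS: "2 / R = 2 * exp b * ?S"
    unfolding R_def S by (simp add: exp_diff exp_minus field_simps)
  have "half_gradient_energy (\<lambda>x. m x $ 3) \<le> \<epsilon> / 2 * nsq ?g + 2 / pi * ln (R / \<epsilon>) * ?P + 2 / R"
    unfolding total_variation_eq
    by (intro half_gradient_energy_bound(1) H1_sphereD m sphere_m3_le H1_sphere_L1 \<epsilon> \<open>\<epsilon> \<le> R\<close>)
  also have "\<dots> \<le> ?E + 2 / pi * ln (R / \<epsilon>) * ?P + 2 / R"
    using gradient_le_local_energy(2)[OF m \<epsilon>(1), of 3] by simp
  also have "2 / pi = 1 / lambda_c" by (simp add: lambda_c_def)
  also have "?E + 1 / lambda_c * ln (R / \<epsilon>) * ?P + 2 / R = L / l * ?P + (?E - b / lambda_c * ?P + 2 * exp b * ?S)"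
    unfolding lnR RS using lc l0 by (simp add: field_simps)
  finally have "l / L * half_gradient_energy (\<lambda>x. m x $ 3) \<le> l / L * (L / l * ?P + (?E - b / lambda_c * ?P + 2 * exp b * ?S))"
    using l0 L by (intro mult_left_mono) auto
  also have "\<dots> = ?P + l / L * (?E - b / lambda_c * ?P + 2 * exp b * ?S)"
    using l0 L unfolding distrib_left by simp
  finally show ?thesis unfolding nonlocal_energy_def L_def .
qed

text \<open>This form shows what b decides: the sign of the coefficient of the total variation, at
  the price of a factor exp b in front of the perimeter scale.\<close>

lemma energy_lower_bound:
  assumes m: "m \<in> H1_torus_sphere" and \<epsilon>: "0 < \<epsilon>" "\<epsilon> < 1" and l: "lambda_c < l"
    and b: "b \<le> lambda_c * \<bar>ln \<epsilon>\<bar> / l"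
  defines "k \<equiv> l / \<bar>ln \<epsilon>\<bar>"
  shows "(1 - k) * (local_energy \<epsilon> m - total_variation_m3 m) + k * (b / lambda_c - 1) * total_variation_m3 m
      - 2 * k * exp b * perimeter_scale \<epsilon> l \<le> energy \<epsilon> l m"
  using nonlocal_energy_bound[OF m \<epsilon> l b] unfolding energy_def k_def[symmetric]
  by (simp add: algebra_simps)

text \<open>The cost 2 exp b for b = 2 \<open>lambda_c\<close>, the value at which
  \<open>b / lambda_c - 1\<close> equals 1.\<close>

definition coercivity_const :: real where
  "coercivity_const = 2 * exp (2 * lambda_c)"

lemma coercivity_const_ge_2: "2 \<le> coercivity_const"
  unfolding coercivity_const_def using lambda_c_pos by simp

lemma energy_coercive:
  assumes m: "m \<in> H1_torus_sphere" and \<epsilon>: "0 < \<epsilon>" "\<epsilon> < 1" and l: "lambda_c < l"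
    and k: "l < 1 / 2 * \<bar>ln \<epsilon>\<bar>"
  shows "l / \<bar>ln \<epsilon>\<bar> * (local_energy \<epsilon> m - coercivity_const * perimeter_scale \<epsilon> l) \<le> energy \<epsilon> l m"
proof -
  define k where "k = l / \<bar>ln \<epsilon>\<bar>"
  define E where "E = local_energy \<epsilon> m"
  define P where "P = total_variation_m3 m"
  define S where "S = perimeter_scale \<epsilon> l"
  have l0: "0 < l" using l lambda_c_pos by simp
  have L: "0 < \<bar>ln \<epsilon>\<bar>" using \<epsilon> by simp
  have k2: "k \<le> 1 / 2"
    using L assms(5) by (simp add: k_def divide_le_eq)
  \<comment> \<open>The choice b = 2 \<open>lambda_c\<close> is admissible because l is below half
    of |ln \<epsilon>|.\<close>
  have "2 * lambda_c \<le> lambda_c * \<bar>ln \<epsilon>\<bar> / l"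
    using assms(5) l0 lambda_c_pos by (simp add: le_divide_eq)
  from energy_lower_bound[OF m \<epsilon> l this]
  have "(1 - k) * (E - P) + k * 1 * P - 2 * k * exp (2 * lambda_c) * S \<le> energy \<epsilon> l m"
    using lambda_c_pos by (simp add: k_def E_def P_def S_def)
  \<comment> \<open>Lowering \<open>1 - k\<close> to \<open>k\<close> makes the coefficients of
    \<open>E - P\<close> and \<open>P\<close> equal, so that only \<open>E\<close> remains.\<close>
  moreover have "k * (E - P) \<le> (1 - k) * (E - P)"
  proof (rule mult_right_mono)
    show "k \<le> 1 - k" using k2 by linarith
  qed (use total_variation_le_local_energy[OF m \<epsilon>(1)] in \<open>simp add: E_def P_def\<close>)
  ultimately have "k * (E - P) + k * P - 2 * k * exp (2 * lambda_c) * S \<le> energy \<epsilon> l m"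
    by linarith
  then have "k * (E - coercivity_const * S) \<le> energy \<epsilon> l m"
    by (simp add: coercivity_const_def algebra_simps)
  then show ?thesis by (simp add: k_def E_def S_def)
qed

text \<open>After taking logarithms, the upper bound on \<epsilon> says that the perimeter scale
  exceeds K.\<close>

lemma regimeD:
  assumes "regime \<delta> K \<epsilon> l" "\<delta> \<le> 1 / 2" "1 < K"
  shows "0 < \<epsilon>" "\<epsilon> < 1" "lambda_c < l" "l < \<delta> * \<bar>ln \<epsilon>\<bar>" "l < 1 / 2 * \<bar>ln \<epsilon>\<bar>" "0 < l" "0 < \<bar>ln \<epsilon>\<bar>"
    "K < perimeter_scale \<epsilon> l" "0 < l / \<bar>ln \<epsilon>\<bar>" "l / \<bar>ln \<epsilon>\<bar> < \<delta>"
proof -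
  show e0: "0 < \<epsilon>" and l: "lambda_c < l" and d: "l < \<delta> * \<bar>ln \<epsilon>\<bar>" using assms(1) by (simp_all add: regime_def)
  show l0: "0 < l" using l lambda_c_pos by simp
  have ee: "\<epsilon> < K powr (- (l / (l - lambda_c)))" using assms(1) by (simp add: regime_def)
  have q: "0 < l / (l - lambda_c)" using l l0 by simp
  have "ln \<epsilon> < ln (K powr (- (l / (l - lambda_c))))"
    using ee e0 assms(3) by (subst ln_less_cancel_iff) auto
  then have lnlt: "ln \<epsilon> < - (l / (l - lambda_c)) * ln K" using assms(3) by (simp add: ln_powr)
  moreover have "0 < ln K" using assms(3) by simp
  then have "0 < (l / (l - lambda_c)) * ln K" using q by (rule mult_pos_pos[rotated])
  ultimately have "ln \<epsilon> < 0" by simp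
  then show e1: "\<epsilon> < 1" using e0 by simp
  then show L: "0 < \<bar>ln \<epsilon>\<bar>" using e0 by simp
  have "\<delta> * \<bar>ln \<epsilon>\<bar> \<le> 1 / 2 * \<bar>ln \<epsilon>\<bar>" using assms(2) by (intro mult_right_mono) auto
  then show "l < 1 / 2 * \<bar>ln \<epsilon>\<bar>" using d by linarith
  show "0 < l / \<bar>ln \<epsilon>\<bar>" using l0 L by simp
  show "l / \<bar>ln \<epsilon>\<bar> < \<delta>" using d L by (simp add: divide_less_eq)
  have "(l / (l - lambda_c)) * ln K < \<bar>ln \<epsilon>\<bar>" using lnlt \<open>ln \<epsilon> < 0\<close> by linarith
  then have "ln K < \<bar>ln \<epsilon>\<bar> * ((l - lambda_c) / l)"
    using l l0 by (simp add: field_simps)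
  then have "exp (ln K) < perimeter_scale \<epsilon> l" unfolding perimeter_scale_exp[OF e0 e1] by simp
  then show "K < perimeter_scale \<epsilon> l" using assms(3) by simp
qed

section \<open>Scaling of maps with sufficiently negative energy\<close>

lemma energy_scale_eq: "energy_scale \<epsilon> l = l / \<bar>ln \<epsilon>\<bar> * perimeter_scale \<epsilon> l"
  by (simp add: energy_scale_def)

text \<open>The value \<open>b = - scaling_shift \<gamma>\<close> in the lower bound of the energy ensures \<open>2 exp b \<le> \<gamma> / 2\<close>.\<close>

definition scaling_shift :: "real \<Rightarrow> real" where
  "scaling_shift \<gamma> = max 0 (- ln (\<gamma> / 4))"

text \<open>The constant obtained by solving (\<gamma>/2) S \<le> (1 + b / \<open>lambda_c\<close>)
  P for P, with b = \<open>scaling_shift \<gamma>\<close>.\<close>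

definition scaling_lower :: "real \<Rightarrow> real" where
  "scaling_lower \<gamma> = \<gamma> / 2 / (1 + scaling_shift \<gamma> / lambda_c)"

lemma scaling_lower_pos: "0 < \<gamma> \<Longrightarrow> 0 < scaling_lower \<gamma>"
  unfolding scaling_lower_def scaling_shift_def using lambda_c_pos
  by (intro divide_pos_pos add_pos_nonneg) auto

text \<open>Three values of b enter: 2 \<open>lambda_c\<close>, through
  \<open>energy_coercive\<close>, for the upper bounds; minus \<open>scaling_shift \<gamma>\<close>
  for the lower bound; and 0 for the closeness of the three quantities. Since P \<le> E \<le> N, it
  is enough to bound P from below, N from above, and N - P.\<close>

lemma scaling_bounds:
  assumes r: "regime \<delta> K \<epsilon> l" "\<delta> \<le> 1 / 2" "1 < K" and \<gamma>: "0 < \<gamma>"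
    and m: "m \<in> H1_torus_sphere" and F: "energy \<epsilon> l m \<le> - \<gamma> * energy_scale \<epsilon> l"
  defines "P \<equiv> total_variation_m3 m" and "E \<equiv> local_energy \<epsilon> m" and "N \<equiv> nonlocal_energy \<epsilon> l m"
    and "S \<equiv> perimeter_scale \<epsilon> l" and "k \<equiv> l / \<bar>ln \<epsilon>\<bar>"
  shows "P \<le> E" "E \<le> N" "scaling_lower \<gamma> * S \<le> P" "N \<le> 2 * coercivity_const * S"
    "N - P \<le> k * ((3 * coercivity_const + 4) * S)"
proof -
  note R = regimeD[OF r]
  have S: "0 < S" unfolding S_def by (rule perimeter_scale_pos[OF R(1)])
  have k: "0 < k" "k < 1 / 2" unfolding k_def using R r(2) by auto
  show PE: "P \<le> E" unfolding P_def E_def by (rule total_variation_le_local_energy[OF m R(1)])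
  have P0: "0 \<le> P" unfolding P_def by (rule total_variation_nonneg)
  have F': "E - N \<le> - \<gamma> * (k * S)"
    using F by (simp add: energy_def energy_scale_eq E_def N_def k_def S_def)
  moreover have "0 < \<gamma> * (k * S)" using \<gamma> k S by simp
  ultimately have neg: "E - N < 0" by simp
  then show "E \<le> N" by simp
  let ?C = coercivity_const
  have co: "k * (E - ?C * S) \<le> E - N"
    using energy_coercive[OF m R(1,2,3,5)] by (simp add: energy_def E_def N_def k_def S_def)
  then have "k * (E - ?C * S) < 0" using neg by linarith
  then have EC: "E \<le> ?C * S" using k by (simp add: mult_less_0_iff)
  have "0 \<le> k * E" using k PE P0 by simp
  then have NE: "N - E \<le> k * (?C * S)" using co by (simp add: right_diff_distrib)
  have CS: "0 \<le> ?C * S" using coercivity_const_ge_2 S by simp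
  have "k * (?C * S) \<le> 1 * (?C * S)" using k CS by (intro mult_right_mono) auto
  then show "N \<le> 2 * ?C * S" using NE EC by simp
  have lb: "(1 - k) * (E - P) + k * (b / lambda_c - 1) * P - 2 * k * exp b * S \<le> E - N" if "b \<le> 0" for b
  proof -
    have "b \<le> lambda_c * \<bar>ln \<epsilon>\<bar> / l"
      using that R lambda_c_pos by (meson divide_nonneg_pos less_imp_le mult_nonneg_nonneg order_trans)
    from energy_lower_bound[OF m R(1,2,3) this] show ?thesis
      by (simp add: energy_def E_def N_def k_def S_def P_def)
  qed
  show "scaling_lower \<gamma> * S \<le> P"
  proof -
    let ?b = "scaling_shift \<gamma>"
    have b0: "0 \<le> ?b" by (simp add: scaling_shift_def)
    have "exp (- ?b) \<le> exp (ln (\<gamma> / 4))" by (simp add: scaling_shift_def)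
    then have eb: "exp (- ?b) \<le> \<gamma> / 4" using \<gamma> by simp
    have "(1 - k) * (E - P) + k * (- ?b / lambda_c - 1) * P - 2 * k * exp (- ?b) * S \<le> - \<gamma> * (k * S)"
      using lb[of "- ?b"] b0 F' by linarith
    moreover have "0 \<le> (1 - k) * (E - P)" using k PE by simp
    \<comment> \<open>The error uses up half of the given negative energy; the other half has to be
      paid by \<open>P\<close>.\<close>
    moreover have "2 * k * exp (- ?b) * S \<le> \<gamma> / 2 * (k * S)"
      using mult_right_mono[OF eb, of "2 * (k * S)"] k S by (simp add: mult_ac)
    ultimately have "k * (- ?b / lambda_c - 1) * P \<le> - (\<gamma> / 2) * (k * S)" by simp
    then have "k * (\<gamma> / 2 * S) \<le> k * ((1 + ?b / lambda_c) * P)"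
      by (simp add: algebra_simps)
    then have *: "\<gamma> / 2 * S \<le> (1 + ?b / lambda_c) * P" using k by simp
    have D: "0 < 1 + ?b / lambda_c" using b0 lambda_c_pos by (simp add: add_pos_nonneg)
    have "\<gamma> / 2 * S / (1 + ?b / lambda_c) \<le> P"
      unfolding pos_divide_le_eq[OF D] using * by (simp only: mult.commute)
    then show ?thesis
      unfolding scaling_lower_def by (simp only: times_divide_eq_left)
  qed
  \<comment> \<open>With b = 0 the quantity \<open>(1 - k) * (E - P)\<close> is at most
    \<open>k * P + 2 * k * S\<close>. The factor \<open>k\<close> is the gain over the bound of
    order \<open>S\<close> known for each term.\<close>
  have "(1 - k) * (E - P) - k * P - 2 * k * S \<le> 0" using lb[of 0] neg by simp
  moreover have "1 / 2 * (E - P) \<le> (1 - k) * (E - P)" using k PE by (intro mult_right_mono) auto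
  moreover have "k * P \<le> k * (?C * S)" using k PE EC by (intro mult_left_mono) auto
  ultimately have "E - P \<le> 2 * (k * (?C * S)) + 4 * (k * S)" by simp
  then show "N - P \<le> k * ((3 * ?C + 4) * S)" using NE by (simp add: algebra_simps)
qed

subsection \<open>Existence of minimizers\<close>

lemma dual_box_compl:
  assumes "k \<in> dual_lattice" "k \<notin> dual_box n"
  shows "2 * pi * real n \<le> norm k"
proof -
  obtain i where "2 * pi * real n < \<bar>k $ i\<bar>" using assms by (auto simp: dual_box_def not_le)
  then show ?thesis using component_le_norm_cart[of k i] by linarith
qed

text \<open>The tail of a is dominated by the full sum of b, because in the applications only that
  total, a gradient norm, is controlled.\<close>

lemma has_sum_dual_box_tail:
  fixes a b :: "real^2 \<Rightarrow> real"
  assumes a: "(a has_sum A) dual_lattice" and b: "(b has_sum B) dual_lattice"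
    and nn: "\<And>k. k \<in> dual_lattice \<Longrightarrow> 0 \<le> b k"
    and le: "\<And>k. k \<in> dual_lattice \<Longrightarrow> k \<notin> dual_box n \<Longrightarrow> a k \<le> b k"
  shows "A \<le> (\<Sum>k\<in>dual_box n. a k) + B"
proof -
  have f: "((\<lambda>k. if k \<in> dual_box n then a k else 0) has_sum (\<Sum>k\<in>dual_box n. a k)) dual_lattice"
    using has_sum_finite[OF finite_dual_box, of a n] dual_box_subset[of n]
    by (subst has_sum_cong_neutral[where T = "dual_box n" and g = a]) auto
  show ?thesis
    by (rule has_sum_mono[OF a has_sum_add[OF f b]]) (use nn le in auto)
qed

text \<open>High frequencies are paid for by the gradient; this is the source of compactness in
  \<open>sphere_compactness\<close>.\<close>

lemma nsq_tail:
  assumes u: "u \<in> L2_torus" and g: "is_weak_gradient u g" and n: "0 < n"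
  shows "nsq u \<le> (\<Sum>k\<in>dual_box n. (norm (fcoef (\<lambda>x. complex_of_real (u x)) k))\<^sup>2) + nsq g / (2 * pi * real n)\<^sup>2"
proof -
  have p: "((\<lambda>k. (norm (fcoef (\<lambda>x. complex_of_real (u x)) k))\<^sup>2) has_sum nsq u) dual_lattice"
    using Parseval[of "\<lambda>x. complex_of_real (u x)"] u by (simp add: L2_of_real_iff nsq_of_real)
  show ?thesis
  proof (rule has_sum_dual_box_tail[OF p has_sum_divide_const[OF Parseval_gradient[OF u g]]])
    fix k assume k: "k \<in> dual_lattice" "k \<notin> dual_box n"
    have "(2 * pi * real n)\<^sup>2 \<le> (norm k)\<^sup>2" by (intro power_mono dual_box_compl k) simp
    then have "(2 * pi * real n)\<^sup>2 * (norm (fcoef (\<lambda>x. complex_of_real (u x)) k))\<^sup>2 \<le> (norm k)\<^sup>2 * (norm (fcoef (\<lambda>x. complex_of_real (u x)) k))\<^sup>2"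
      by (rule mult_right_mono) simp
    then show "(norm (fcoef (\<lambda>x. complex_of_real (u x)) k))\<^sup>2 \<le> (norm k)\<^sup>2 * (norm (fcoef (\<lambda>x. complex_of_real (u x)) k))\<^sup>2 / (2 * pi * real n)\<^sup>2"
      using n by (simp add: pos_le_divide_eq mult.commute)
  qed simp
qed

text \<open>Outside the box |k| \<le> |k|^2 / (2 \<pi> n). Under a gradient bound the nonlocal term
  is thus determined by finitely many frequencies up to a small error, so its minus sign does no
  harm to lower semicontinuity.\<close>

lemma half_gradient_tail:
  assumes u: "u \<in> L2_torus" "AE x in torus_measure. \<bar>u x\<bar> \<le> 1" and g: "is_weak_gradient u g" and n: "0 < n"
  shows "half_gradient_energy u \<le> (\<Sum>k\<in>dual_box n. norm k * (norm (fcoef (\<lambda>x. complex_of_real (u x)) k))\<^sup>2)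
      + nsq g / (2 * pi * real n)"
proof -
  \<comment> \<open>The cutoffs r = R = 1 are an admissible choice for reading off convergence of
    the series.\<close>
  note hs = half_gradient_energy_bound(2)[OF u g zero_less_one order_refl, unfolded fourier_coeff_eq]
  show ?thesis
  proof (rule has_sum_dual_box_tail[OF hs has_sum_divide_const[OF Parseval_gradient[OF u(1) g]]])
    fix k assume k: "k \<in> dual_lattice" "k \<notin> dual_box n"
    have "2 * pi * real n * norm k \<le> norm k * norm k" by (intro mult_right_mono dual_box_compl k) simp
    then have "(2 * pi * real n * norm k) * (norm (fcoef (\<lambda>x. complex_of_real (u x)) k))\<^sup>2
        \<le> (norm k * norm k) * (norm (fcoef (\<lambda>x. complex_of_real (u x)) k))\<^sup>2"
      by (rule mult_right_mono) simp
    then show "norm k * (norm (fcoef (\<lambda>x. complex_of_real (u x)) k))\<^sup>2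
        \<le> (norm k)\<^sup>2 * (norm (fcoef (\<lambda>x. complex_of_real (u x)) k))\<^sup>2 / (2 * pi * real n)"
      using n by (simp add: pos_le_divide_eq power2_eq_square mult_ac)
  qed simp
qed

lemma half_gradient_box_le:
  assumes u: "u \<in> L2_torus" "AE x in torus_measure. \<bar>u x\<bar> \<le> 1" and g: "is_weak_gradient u g"
  shows "(\<Sum>k\<in>dual_box n. norm k * (norm (fcoef (\<lambda>x. complex_of_real (u x)) k))\<^sup>2) \<le> half_gradient_energy u"
proof -
  note hs = half_gradient_energy_bound(2)[OF u g zero_less_one order_refl, unfolded fourier_coeff_eq]
  show ?thesis
    by (rule finite_sum_le_has_sum[OF hs finite_dual_box dual_box_subset]) simp
qed

lemma weak_gradient_diff:
  assumes u: "u \<in> L2_torus" "is_weak_gradient u g" and v: "v \<in> L2_torus" "is_weak_gradient v h"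
  shows "is_weak_gradient (\<lambda>x. u x - v x) (\<lambda>x. g x - h x)"
proof (rule is_weak_gradientI)
  have L: "g \<in> L2_torus" "h \<in> L2_torus" using u v by (simp_all add: is_weak_gradient_def)
  show "(\<lambda>x. u x - v x) \<in> L2_torus" "(\<lambda>x. g x - h x) \<in> L2_torus" by (intro L2_diff u v L)+
  fix k :: "real^2" and i :: 2 assume k: "k \<in> dual_lattice"
  have c: "(\<lambda>x. complex_of_real (u x)) \<in> L2_torus" "(\<lambda>x. complex_of_real (v x)) \<in> L2_torus"
    "(\<lambda>x. complex_of_real (g x $ i)) \<in> L2_torus" "(\<lambda>x. complex_of_real (h x $ i)) \<in> L2_torus"
    using u v L by (auto simp: L2_of_real_iff intro: L2_component)
  show "fcoef (\<lambda>x. complex_of_real ((g x - h x) $ i)) k = \<i> * of_real (k $ i) * fcoef (\<lambda>x. complex_of_real (u x - v x)) k"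
    using fcoef_diff[OF c(1,2) k] fcoef_diff[OF c(3,4) k] weak_gradient_fcoef[OF u k, of i] weak_gradient_fcoef[OF v k, of i]
    by (simp add: right_diff_distrib)
qed

lemma nsq_vec3:
  assumes "\<And>j. (\<lambda>x. (m x :: real^3) $ j) \<in> L2_torus"
  shows "nsq m = (\<Sum>j\<in>UNIV. nsq (\<lambda>x. m x $ j))"
  unfolding nsq_def sphere_sum_squares
  by (subst Bochner_Integration.integral_sum) (use L2_torusD(3)[OF assms] in auto)

lemma L1_sphere_L2:
  assumes m: "m \<in> L1_torus_sphere"
  shows "m \<in> L2_torus"
proof (rule L2_torusI)
  show "torus_periodic m" "m \<in> borel_measurable borel" using m by (simp_all add: L1_torus_sphere_def)
  then have [measurable]: "m \<in> borel_measurable borel" by simp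
  show "integrable torus_measure (\<lambda>x. (norm (m x))\<^sup>2)"
    by (rule torus.integrable_const_bound[where B = 1]) (use sphere_norm[OF m] in \<open>auto elim: eventually_mono\<close>)
qed

lemma nsq_component_le:
  assumes "m \<in> L2_torus"
  shows "nsq (\<lambda>x. (m x :: real^3) $ j) \<le> nsq m"
proof -
  have "nsq (\<lambda>x. m x $ j) \<le> (\<Sum>j\<in>UNIV. nsq (\<lambda>x. m x $ j))" by (rule member_le_sum) auto
  then show ?thesis using nsq_vec3[of m] L2_component[OF assms] by simp
qed

text \<open>Rellich's theorem by frequencies: a diagonal subsequence makes every coefficient
  converge and the gradient bound makes the tails uniformly small, so the subsequence is Cauchy in
  L2.\<close>

lemma sphere_compactness:
  assumes m: "\<And>n. m n \<in> H1_torus_sphere"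
    and D: "\<And>n j. nsq (weak_gradient (\<lambda>x. m n x $ j)) \<le> D"
  obtains \<phi> w where "strict_mono (\<phi> :: nat \<Rightarrow> nat)" "w \<in> L1_torus_sphere"
    "(\<lambda>n. nsq (\<lambda>x. m (\<phi> n) x - w x)) \<longlonglongrightarrow> 0"
proof -
  let ?c = "\<lambda>n j k. fcoef (\<lambda>x. complex_of_real (m n x $ j)) k"
  have mL: "m n \<in> L2_torus" for n using m by (intro L1_sphere_L2 H1_sphere_L1)
  have cL: "(\<lambda>x. complex_of_real (m n x $ j)) \<in> L2_torus" for n j
    using H1_sphereD(1)[OF m] by (simp add: L2_of_real_iff)
  have nsqm: "nsq (m n) = 1" for n
  proof -
    have [measurable]: "m n \<in> borel_measurable borel" using L2_torusD(2)[OF mL] .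
    have "nsq (m n) = tint (\<lambda>_. 1::real)"
      unfolding nsq_def by (rule integral_cong_AE) (use sphere_norm[OF H1_sphere_L1[OF m[of n]]] in \<open>auto elim: eventually_mono\<close>)
    then show ?thesis using torus.prob_space by simp
  qed
  have c1: "norm (?c n j k) \<le> 1" if "k \<in> dual_lattice" for n j k
  proof -
    have "(norm (?c n j k))\<^sup>2 \<le> nsq (\<lambda>x. complex_of_real (m n x $ j))"
      using Bessel[of "{k}", OF _ _ cL] that by simp
    also have "\<dots> \<le> 1" using nsq_component_le[OF mL[of n], of j] by (simp add: nsq_of_real nsqm)
    finally show ?thesis using power2_le_imp_le[of _ "1::real"] by simp
  qed
  obtain \<phi> :: "nat \<Rightarrow> nat" where \<phi>: "strict_mono \<phi>"
    and conv: "\<And>p. p \<in> UNIV \<times> dual_lattice \<Longrightarrow> \<exists>l. (\<lambda>n. case p of (j, k) \<Rightarrow> ?c (\<phi> n) j k) \<longlonglongrightarrow> l"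
  proof (rule function_convergent_subsequence[of "(UNIV :: 3 set) \<times> dual_lattice" "\<lambda>n p. case p of (j, k) \<Rightarrow> ?c n j k" 1])
    show "countable ((UNIV :: 3 set) \<times> dual_lattice)"
      by (intro countable_SIGMA countable_finite countable_dual_lattice) simp
    show "norm (case p of (j, k) \<Rightarrow> ?c n j k) \<le> 1" if "p \<in> UNIV \<times> dual_lattice" for n p
      using that c1 by auto
  qed blast
  have Cauchy_c: "Cauchy (\<lambda>n. ?c (\<phi> n) j k)" if "k \<in> dual_lattice" for j k
    using conv[of "(j, k)"] that by (auto intro: LIMSEQ_imp_Cauchy)
  have D0: "0 \<le> D" using D[of 0 1] nsq_nonneg order_trans by blast
  have comp: "\<exists>N. \<forall>a\<ge>N. \<forall>b\<ge>N. nsq (\<lambda>x. m (\<phi> a) x $ j - m (\<phi> b) x $ j) < e" if e: "0 < e" for e j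
  proof -
    \<comment> \<open>The cutoff is fitted to differences of two members of the sequence, whose
      squared gradient norm is at most \<open>4 * D\<close>.\<close>
    obtain M where M: "4 * D / (e / 2) < real M" using reals_Archimedean2 by blast
    have M0: "0 < M" using M D0 e by (metis divide_nonneg_nonneg half_gt_zero less_imp_le mult_nonneg_nonneg not_le of_nat_0 of_nat_le_0_iff zero_le_numeral neq0_conv)
    have tail: "4 * D / (2 * pi * real M)\<^sup>2 < e / 2"
    proof -
      have "real M * 1 \<le> real M * real M" using M0 by (intro mult_left_mono) auto
      moreover have "1 * (real M * real M) \<le> (2 * pi)\<^sup>2 * (real M * real M)"
        using pi_gt3 by (intro mult_right_mono one_le_power) auto
      ultimately have "real M \<le> (2 * pi * real M)\<^sup>2" by (simp add: power2_eq_square mult_ac)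
      then have "4 * D / (e / 2) < (2 * pi * real M)\<^sup>2" using M by linarith
      then show ?thesis using e M0 by (simp add: divide_less_eq mult.commute)
    qed
    have "\<exists>N. \<forall>a\<ge>N. \<forall>b\<ge>N. norm (?c (\<phi> a) j k - ?c (\<phi> b) j k) < sqrt (e / 2 / (1 + real (card (dual_box M))))"
      if "k \<in> dual_box M" for k
      using Cauchy_c[of k j] that dual_box_subset[of M] e unfolding Cauchy_def dist_norm by (auto simp: subset_iff)
    then obtain N where N: "\<And>k a b. k \<in> dual_box M \<Longrightarrow> a \<ge> N k \<Longrightarrow> b \<ge> N k \<Longrightarrow>
        norm (?c (\<phi> a) j k - ?c (\<phi> b) j k) < sqrt (e / 2 / (1 + real (card (dual_box M))))"
      by metis
    define N0 where "N0 = (\<Sum>k\<in>dual_box M. N k)"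
    have N0: "N k \<le> N0" if "k \<in> dual_box M" for k
      unfolding N0_def using that by (intro member_le_sum) auto
    have "nsq (\<lambda>x. m (\<phi> a) x $ j - m (\<phi> b) x $ j) < e" if ab: "a \<ge> N0" "b \<ge> N0" for a b
    proof -
      let ?u = "\<lambda>x. m (\<phi> a) x $ j" and ?v = "\<lambda>x. m (\<phi> b) x $ j"
      note U = H1_sphereD[OF m[of "\<phi> a"], of j] and V = H1_sphereD[OF m[of "\<phi> b"], of j]
      have uv: "(\<lambda>x. ?u x - ?v x) \<in> L2_torus" by (intro L2_diff U V)
      have "nsq (\<lambda>x. weak_gradient ?u x - weak_gradient ?v x) \<le> 2 * nsq (weak_gradient ?u) + 2 * nsq (\<lambda>x. (-1) *\<^sub>R weak_gradient ?v x)"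
        using nsq_add_le[OF U(3) L2_scaleR[OF V(3), of "-1"]] by simp
      also have "\<dots> = 2 * nsq (weak_gradient ?u) + 2 * nsq (weak_gradient ?v)" by (simp add: nsq_def)
      also have "\<dots> \<le> 4 * D" using D[of "\<phi> a" j] D[of "\<phi> b" j] by simp
      finally have g4: "nsq (\<lambda>x. weak_gradient ?u x - weak_gradient ?v x) \<le> 4 * D" .
      have "nsq (\<lambda>x. ?u x - ?v x) \<le> (\<Sum>k\<in>dual_box M. (norm (fcoef (\<lambda>x. complex_of_real (?u x - ?v x)) k))\<^sup>2)
          + nsq (\<lambda>x. weak_gradient ?u x - weak_gradient ?v x) / (2 * pi * real M)\<^sup>2"
        by (rule nsq_tail[OF uv weak_gradient_diff[OF U(1,2) V(1,2)] M0])
      also have "(\<Sum>k\<in>dual_box M. (norm (fcoef (\<lambda>x. complex_of_real (?u x - ?v x)) k))\<^sup>2)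
          \<le> (\<Sum>k\<in>dual_box M. e / 2 / (1 + real (card (dual_box M))))"
      proof (rule sum_mono)
        fix k assume k: "k \<in> dual_box M"
        then have kl: "k \<in> dual_lattice" using dual_box_subset by blast
        have "norm (?c (\<phi> a) j k - ?c (\<phi> b) j k) < sqrt (e / 2 / (1 + real (card (dual_box M))))"
          using N[OF k] N0[OF k] ab by auto
        then have "(norm (?c (\<phi> a) j k - ?c (\<phi> b) j k))\<^sup>2 \<le> (sqrt (e / 2 / (1 + real (card (dual_box M)))))\<^sup>2"
          by (intro power_mono) auto
        then show "(norm (fcoef (\<lambda>x. complex_of_real (?u x - ?v x)) k))\<^sup>2 \<le> e / 2 / (1 + real (card (dual_box M)))"
          using fcoef_diff[OF cL cL kl, of "\<phi> a" j "\<phi> b" j] e by simp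
      qed
      also have "\<dots> \<le> e / 2" using e by (simp add: divide_le_eq algebra_simps)
      also have "nsq (\<lambda>x. weak_gradient ?u x - weak_gradient ?v x) / (2 * pi * real M)\<^sup>2 \<le> 4 * D / (2 * pi * real M)\<^sup>2"
        using g4 by (intro divide_right_mono) auto
      finally show ?thesis using tail by simp
    qed
    then show ?thesis by blast
  qed
  have Cauchy_m: "\<exists>N. \<forall>a\<ge>N. \<forall>b\<ge>N. nsq (\<lambda>x. m (\<phi> a) x - m (\<phi> b) x) < e" if e: "0 < e" for e
  proof -
    have "\<exists>N. \<forall>a\<ge>N. \<forall>b\<ge>N. nsq (\<lambda>x. m (\<phi> a) x $ j - m (\<phi> b) x $ j) < e / 3" for j
      using comp[of "e / 3" j] e by simp
    then obtain N where N: "\<And>j a b. a \<ge> N j \<Longrightarrow> b \<ge> N j \<Longrightarrow> nsq (\<lambda>x. m (\<phi> a) x $ j - m (\<phi> b) x $ j) < e / 3"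
      by metis
    define N0 where "N0 = (\<Sum>j\<in>UNIV. N j)"
    have N0: "N j \<le> N0" for j unfolding N0_def by (intro member_le_sum) auto
    have "nsq (\<lambda>x. m (\<phi> a) x - m (\<phi> b) x) < e" if ab: "a \<ge> N0" "b \<ge> N0" for a b
    proof -
      have "nsq (\<lambda>x. m (\<phi> a) x - m (\<phi> b) x) = (\<Sum>j\<in>UNIV. nsq (\<lambda>x. (m (\<phi> a) x - m (\<phi> b) x) $ j))"
        by (intro nsq_vec3 L2_component L2_diff mL)
      also have "\<dots> < (\<Sum>j\<in>(UNIV :: 3 set). e / 3)"
      proof (rule sum_strict_mono)
        show "nsq (\<lambda>x. (m (\<phi> a) x - m (\<phi> b) x) $ j) < e / 3" for j
          using N[of j a b] N0[of j] ab by simp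
      qed auto
      finally show ?thesis by simp
    qed
    then show ?thesis by blast
  qed
  obtain v r where v: "v \<in> L2_torus" "(\<lambda>n. nsq (\<lambda>x. m (\<phi> n) x - v x)) \<longlonglongrightarrow> 0"
    and vr: "strict_mono (r :: nat \<Rightarrow> nat)" "AE x in torus_measure. (\<lambda>n. m (\<phi> (r n)) x) \<longlonglongrightarrow> v x"
    by (rule L2_complete[of "\<lambda>n. m (\<phi> n)", OF mL Cauchy_m])
  have "AE x in torus_measure. \<forall>n. norm (m n x) = 1"
    unfolding AE_all_countable using sphere_norm[OF H1_sphere_L1[OF m]] by blast
  with vr(2) have v1: "AE x in torus_measure. norm (v x) = 1"
  proof eventually_elim
    case (elim x)
    from tendsto_norm[OF elim(1)] elim(2) show ?case by (simp add: LIMSEQ_const_iff)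
  qed
  \<comment> \<open>\<open>v\<close> is known to have unit length only almost everywhere in the
    cell. Replacing it by a fixed unit vector where this fails gives unit length at every point of
    the plane and preserves periodicity.\<close>
  define w where "w x = (if norm (v x) = 1 then v x else axis 1 1)" for x
  note L2_torusD(2)[OF v(1), measurable]
  have wm [measurable]: "w \<in> borel_measurable borel" unfolding w_def by measurable
  have wn: "norm (w x) = 1" for x unfolding w_def by (simp add: norm_axis_1)
  have wp: "torus_periodic w" using L2_torusD(1)[OF v(1)] by (simp add: w_def torus_periodic_def)
  have "w \<in> L1_torus_sphere"
    unfolding L1_torus_sphere_def torus_integrable_eq
    using wp wn by (auto intro!: torus.integrable_const_bound[where B = 1])
  moreover have "nsq (\<lambda>x. m (\<phi> n) x - w x) = nsq (\<lambda>x. m (\<phi> n) x - v x)" for n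
  proof (rule nsq_cong_AE)
    have [measurable]: "m (\<phi> n) \<in> borel_measurable borel" using L2_torusD(2)[OF mL] .
    show "AE x in torus_measure. m (\<phi> n) x - w x = m (\<phi> n) x - v x"
      using v1 by eventually_elim (simp add: w_def)
    show "(\<lambda>x. m (\<phi> n) x - w x) \<in> borel_measurable borel" "(\<lambda>x. m (\<phi> n) x - v x) \<in> borel_measurable borel"
      by measurable
  qed
  ultimately show thesis using that \<phi> v(2) by simp
qed

lemma energy_expand:
  assumes m: "m \<in> H1_torus_sphere"
  shows "energy \<epsilon> l m = \<epsilon> / 2 * (\<Sum>j\<in>UNIV. nsq (weak_gradient (\<lambda>y. m y $ j)))
     + 1 / (2 * \<epsilon>) * (1 - nsq (\<lambda>x. m x $ 3)) - l / \<bar>ln \<epsilon>\<bar> * half_gradient_energy (\<lambda>x. m x $ 3)"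
proof -
  have "tint (\<lambda>x. 1 - (m x $ 3)\<^sup>2) = 1 - nsq (\<lambda>x. m x $ 3)"
    unfolding nsq_def using L2_torusD(3)[OF H1_sphereD(1)[OF m, of 3]] torus.prob_space by simp
  then show ?thesis
    unfolding energy_def nonlocal_energy_def local_energy_eq[OF m] by simp
qed

text \<open>Lower semicontinuity is proved on Fourier coefficients, without weak convergence of
  gradients. With the gradients truncated at n and the nonlocal term at M, only finitely many
  coefficients occur and the minimizing sequence may pass to its limit. Membership of the limit in
  H1 is settled before M tends to infinity, since it ensures that its half-gradient series
  converges.\<close>

lemma energy_minimizer_exists:
  assumes \<epsilon>: "0 < \<epsilon>" "\<epsilon> < 1" and l: "lambda_c < l" and k: "l < 1 / 2 * \<bar>ln \<epsilon>\<bar>"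
    and ne: "H1_torus_sphere \<noteq> {}"
  obtains w where "w \<in> H1_torus_sphere" "\<And>m. m \<in> H1_torus_sphere \<Longrightarrow> energy \<epsilon> l w \<le> energy \<epsilon> l m"
proof -
  let ?k = "l / \<bar>ln \<epsilon>\<bar>"
  have l0: "0 < l" using l lambda_c_pos by simp
  have "0 < \<bar>ln \<epsilon>\<bar>" using \<epsilon> by simp
  with l0 have k0: "0 < ?k" by (rule divide_pos_pos)
  define C where "C = coercivity_const * perimeter_scale \<epsilon> l"
  have co: "?k * (local_energy \<epsilon> m - C) \<le> energy \<epsilon> l m" if "m \<in> H1_torus_sphere" for m
    unfolding C_def by (rule energy_coercive[OF that \<epsilon> l k])
  have local0: "0 \<le> local_energy \<epsilon> m" if "m \<in> H1_torus_sphere" for m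
    using total_variation_le_local_energy[OF that \<epsilon>(1)] total_variation_nonneg[of m] by linarith
  let ?V = "energy \<epsilon> l ` H1_torus_sphere"
  have bdd: "bdd_below ?V"
  proof (rule bdd_belowI2)
    fix m assume m: "m \<in> H1_torus_sphere"
    have "?k * (0 - C) \<le> ?k * (local_energy \<epsilon> m - C)" using local0[OF m] by (intro mult_left_mono less_imp_le[OF k0]) simp
    then show "?k * (0 - C) \<le> energy \<epsilon> l m" using co[OF m] by linarith
  qed
  define I where "I = Inf ?V"
  have I_le: "I \<le> energy \<epsilon> l m" if "m \<in> H1_torus_sphere" for m
    unfolding I_def using that bdd by (intro cInf_lower) auto
  have "\<exists>m\<in>H1_torus_sphere. energy \<epsilon> l m < I + 1 / real (Suc n)" for n
  proof -
    have "I < I + 1 / real (Suc n)" by simp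
    then show ?thesis using cInf_lessD[of ?V] ne unfolding I_def by auto
  qed
  then obtain m where m: "\<And>n. m n \<in> H1_torus_sphere" and mI: "\<And>n. energy \<epsilon> l (m n) < I + 1 / real (Suc n)"
    by metis
  define M where "M = (I + 1) / ?k + C"
  have EM: "local_energy \<epsilon> (m n) \<le> M" for n
  proof -
    have "1 / real (Suc n) \<le> 1" by simp
    then have "?k * (local_energy \<epsilon> (m n) - C) \<le> I + 1" using co[OF m[of n]] mI[of n] by linarith
    then have "local_energy \<epsilon> (m n) - C \<le> (I + 1) / ?k"
      by (simp only: pos_le_divide_eq[OF k0] mult.commute)
    then show ?thesis by (simp add: M_def)
  qed
  define D where "D = M / (\<epsilon> / 2)"
  have D: "nsq (weak_gradient (\<lambda>x. m n x $ j)) \<le> D" for n j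
  proof -
    have "\<epsilon> / 2 * nsq (weak_gradient (\<lambda>x. m n x $ j)) \<le> M"
      using gradient_le_local_energy(2)[OF m \<epsilon>(1), of n j] EM[of n] by linarith
    then show ?thesis unfolding D_def using \<epsilon> by (simp add: pos_le_divide_eq mult.commute)
  qed
  obtain \<phi> w where \<phi>: "strict_mono \<phi>" and w: "w \<in> L1_torus_sphere"
    and lim: "(\<lambda>n. nsq (\<lambda>x. m (\<phi> n) x - w x)) \<longlonglongrightarrow> 0"
    by (rule sphere_compactness[OF m D])
  have mL: "m n \<in> L2_torus" for n using m by (intro L1_sphere_L2 H1_sphere_L1)
  have wL: "w \<in> L2_torus" by (rule L1_sphere_L2[OF w])
  have uL: "(\<lambda>x. m n x $ j) \<in> L2_torus" and wjL: "(\<lambda>x. w x $ j) \<in> L2_torus" for n j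
    by (intro L2_component mL wL)+
  have limj: "(\<lambda>n. nsq (\<lambda>x. m (\<phi> n) x $ j - w x $ j)) \<longlonglongrightarrow> 0" for j
  proof (rule Lim_null_comparison[OF _ lim])
    show "\<forall>\<^sub>F n in sequentially. norm (nsq (\<lambda>x. m (\<phi> n) x $ j - w x $ j)) \<le> nsq (\<lambda>x. m (\<phi> n) x - w x)"
      using nsq_component_le[OF L2_diff[OF mL wL], of _ j] by (intro always_eventually) simp
  qed
  let ?c = "\<lambda>n j k. (norm (fcoef (\<lambda>x. complex_of_real (m (\<phi> n) x $ j)) k))\<^sup>2"
  let ?d = "\<lambda>j k. (norm (fcoef (\<lambda>x. complex_of_real (w x $ j)) k))\<^sup>2"
  have c_lim: "(\<lambda>n. ?c n j k) \<longlonglongrightarrow> ?d j k" if "k \<in> dual_lattice" for j k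
  proof (intro tendsto_power tendsto_norm fcoef_tendsto that)
    show "(\<lambda>n. nsq (\<lambda>x. complex_of_real (m (\<phi> n) x $ j) - complex_of_real (w x $ j))) \<longlonglongrightarrow> 0"
      using limj[of j] by (simp flip: of_real_diff add: nsq_of_real)
  qed (simp_all add: L2_of_real_iff uL wjL)
  have W_lim: "(\<lambda>n. nsq (\<lambda>x. m (\<phi> n) x $ 3)) \<longlonglongrightarrow> nsq (\<lambda>x. w x $ 3)"
    by (rule nsq_tendsto[OF uL wjL limj])
  \<comment> \<open>Truncation only lowers the gradient part. In the nonlocal part, which is
    subtracted from the energy, it costs the tail estimate with \<open>D\<close>.\<close>
  have key: "\<epsilon> / 2 * (\<Sum>j\<in>UNIV. \<Sum>k\<in>dual_box n. (norm k)\<^sup>2 * ?d j k)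
      \<le> I - 1 / (2 * \<epsilon>) * (1 - nsq (\<lambda>x. w x $ 3))
        + ?k * ((\<Sum>k\<in>dual_box M. norm k * ?d 3 k) + D / (2 * pi * real M))" if M: "0 < M" for n M
  proof (rule LIMSEQ_le)
    show "(\<lambda>i. \<epsilon> / 2 * (\<Sum>j\<in>UNIV. \<Sum>k\<in>dual_box n. (norm k)\<^sup>2 * ?c i j k))
      \<longlonglongrightarrow> \<epsilon> / 2 * (\<Sum>j\<in>UNIV. \<Sum>k\<in>dual_box n. (norm k)\<^sup>2 * ?d j k)"
      using dual_box_subset[of n] by (intro tendsto_mult_left tendsto_sum c_lim) auto
    have "(\<lambda>i. 1 / real (Suc (\<phi> i))) \<longlonglongrightarrow> 0"
      using LIMSEQ_subseq_LIMSEQ[OF LIMSEQ_inverse_real_of_nat \<phi>] by (simp add: o_def inverse_eq_divide)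
    then have "(\<lambda>i. I + 1 / real (Suc (\<phi> i)) - 1 / (2 * \<epsilon>) * (1 - nsq (\<lambda>x. m (\<phi> i) x $ 3))
        + ?k * ((\<Sum>k\<in>dual_box M. norm k * ?c i 3 k) + D / (2 * pi * real M)))
      \<longlonglongrightarrow> I + 0 - 1 / (2 * \<epsilon>) * (1 - nsq (\<lambda>x. w x $ 3))
        + ?k * ((\<Sum>k\<in>dual_box M. norm k * ?d 3 k) + D / (2 * pi * real M))"
      using dual_box_subset[of M]
      by (intro tendsto_add tendsto_diff tendsto_mult_left tendsto_sum c_lim W_lim tendsto_const) auto
    then show "(\<lambda>i. I + 1 / real (Suc (\<phi> i)) - 1 / (2 * \<epsilon>) * (1 - nsq (\<lambda>x. m (\<phi> i) x $ 3))
        + ?k * ((\<Sum>k\<in>dual_box M. norm k * ?c i 3 k) + D / (2 * pi * real M)))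
      \<longlonglongrightarrow> I - 1 / (2 * \<epsilon>) * (1 - nsq (\<lambda>x. w x $ 3))
        + ?k * ((\<Sum>k\<in>dual_box M. norm k * ?d 3 k) + D / (2 * pi * real M))"
      by simp
    show "\<exists>N. \<forall>i\<ge>N. \<epsilon> / 2 * (\<Sum>j\<in>UNIV. \<Sum>k\<in>dual_box n. (norm k)\<^sup>2 * ?c i j k)
      \<le> I + 1 / real (Suc (\<phi> i)) - 1 / (2 * \<epsilon>) * (1 - nsq (\<lambda>x. m (\<phi> i) x $ 3))
        + ?k * ((\<Sum>k\<in>dual_box M. norm k * ?c i 3 k) + D / (2 * pi * real M))"
    proof (intro exI[of _ 0] allI impI)
      fix i
      note H = H1_sphereD[OF m[of "\<phi> i"]]
      have "(\<Sum>j\<in>UNIV. \<Sum>k\<in>dual_box n. (norm k)\<^sup>2 * ?c i j k) \<le> (\<Sum>j\<in>UNIV. nsq (weak_gradient (\<lambda>y. m (\<phi> i) y $ j)))"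
        by (intro sum_mono finite_sum_le_has_sum[OF Parseval_gradient[OF H(1,2)] finite_dual_box dual_box_subset]) simp
      then have 1: "\<epsilon> / 2 * (\<Sum>j\<in>UNIV. \<Sum>k\<in>dual_box n. (norm k)\<^sup>2 * ?c i j k)
          \<le> \<epsilon> / 2 * (\<Sum>j\<in>UNIV. nsq (weak_gradient (\<lambda>y. m (\<phi> i) y $ j)))"
        using \<epsilon> by (intro mult_left_mono) auto
      have "half_gradient_energy (\<lambda>x. m (\<phi> i) x $ 3) \<le> (\<Sum>k\<in>dual_box M. norm k * ?c i 3 k) + nsq (weak_gradient (\<lambda>x. m (\<phi> i) x $ 3)) / (2 * pi * real M)"
        by (rule half_gradient_tail[OF H(1) sphere_m3_le[OF H1_sphere_L1[OF m]] H(2) M])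
      also have "\<dots> \<le> (\<Sum>k\<in>dual_box M. norm k * ?c i 3 k) + D / (2 * pi * real M)"
        by (intro add_left_mono divide_right_mono D) simp
      finally have 2: "?k * half_gradient_energy (\<lambda>x. m (\<phi> i) x $ 3) \<le> ?k * ((\<Sum>k\<in>dual_box M. norm k * ?c i 3 k) + D / (2 * pi * real M))"
        by (intro mult_left_mono less_imp_le[OF k0])
      show "\<epsilon> / 2 * (\<Sum>j\<in>UNIV. \<Sum>k\<in>dual_box n. (norm k)\<^sup>2 * ?c i j k)
        \<le> I + 1 / real (Suc (\<phi> i)) - 1 / (2 * \<epsilon>) * (1 - nsq (\<lambda>x. m (\<phi> i) x $ 3))
          + ?k * ((\<Sum>k\<in>dual_box M. norm k * ?c i 3 k) + D / (2 * pi * real M))"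
        using 1 2 mI[of "\<phi> i"] energy_expand[OF m[of "\<phi> i"], of \<epsilon> l] by linarith
    qed
  qed
  have sum_j: "(\<Sum>k\<in>dual_box n. (norm k)\<^sup>2 * ?d j k) \<le> (\<Sum>j\<in>UNIV. \<Sum>k\<in>dual_box n. (norm k)\<^sup>2 * ?d j k)" for j n
    by (rule member_le_sum[of j UNIV "\<lambda>j. \<Sum>k\<in>dual_box n. (norm k)\<^sup>2 * ?d j k"]) (auto intro: sum_nonneg)
  have wH: "(\<lambda>x. w x $ j) \<in> H1_torus" for j
  proof (rule H1_torusI[OF wjL])
    \<comment> \<open>Any fixed M bounds the gradient sums uniformly in n; here M = 1.\<close>
    define B where "B = (I - 1 / (2 * \<epsilon>) * (1 - nsq (\<lambda>x. w x $ 3))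
        + ?k * ((\<Sum>k\<in>dual_box 1. norm k * ?d 3 k) + D / (2 * pi * real 1))) / (\<epsilon> / 2)"
    have box: "(\<Sum>k\<in>dual_box n. (norm k)\<^sup>2 * ?d j k) \<le> B" for n
    proof -
      have "\<epsilon> / 2 * (\<Sum>k\<in>dual_box n. (norm k)\<^sup>2 * ?d j k) \<le> \<epsilon> / 2 * (\<Sum>j\<in>UNIV. \<Sum>k\<in>dual_box n. (norm k)\<^sup>2 * ?d j k)"
        using sum_j[of j n] \<epsilon> by (intro mult_left_mono) auto
      also note key[OF zero_less_one, of n]
      finally have "\<epsilon> / 2 * (\<Sum>k\<in>dual_box n. (norm k)\<^sup>2 * ?d j k) \<le> I - 1 / (2 * \<epsilon>) * (1 - nsq (\<lambda>x. w x $ 3))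
        + ?k * ((\<Sum>k\<in>dual_box 1. norm k * ?d 3 k) + D / (2 * pi * real 1))" .
      moreover have "0 < \<epsilon> / 2" using \<epsilon> by simp
      ultimately show ?thesis
        unfolding B_def by (simp only: pos_le_divide_eq mult.commute)
    qed
    show "(\<lambda>k. (norm k)\<^sup>2 * ?d j k) summable_on dual_lattice"
    proof (rule nonneg_bdd_above_summable_on)
      show "bdd_above (sum (\<lambda>k. (norm k)\<^sup>2 * ?d j k) ` {F. F \<subseteq> dual_lattice \<and> finite F})"
      proof (rule bdd_aboveI2[of _ _ B])
        fix F assume "F \<in> {F. F \<subseteq> dual_lattice \<and> finite F}"
        then obtain n where "F \<subseteq> dual_box n" by (auto elim: dual_box_exhaust)
        then have "(\<Sum>k\<in>F. (norm k)\<^sup>2 * ?d j k) \<le> (\<Sum>k\<in>dual_box n. (norm k)\<^sup>2 * ?d j k)"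
          by (intro sum_mono2) auto
        then show "(\<Sum>k\<in>F. (norm k)\<^sup>2 * ?d j k) \<le> B" using box[of n] by linarith
      qed
    qed simp
  qed
  have wS: "w \<in> H1_torus_sphere" using w wH by (simp add: H1_torus_sphere_def)
  note H = H1_sphereD[OF wS]
  have half: "(\<Sum>k\<in>dual_box M. norm k * ?d 3 k) \<le> half_gradient_energy (\<lambda>x. w x $ 3)" for M
    by (rule half_gradient_box_le[OF H(1) sphere_m3_le[OF w] H(2)])
  have key2: "\<epsilon> / 2 * (\<Sum>j\<in>UNIV. \<Sum>k\<in>dual_box n. (norm k)\<^sup>2 * ?d j k)
      \<le> I - 1 / (2 * \<epsilon>) * (1 - nsq (\<lambda>x. w x $ 3)) + ?k * (half_gradient_energy (\<lambda>x. w x $ 3) + D / (2 * pi * real (Suc M)))" for n M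
  proof -
    have "?k * ((\<Sum>k\<in>dual_box (Suc M). norm k * ?d 3 k) + D / (2 * pi * real (Suc M)))
      \<le> ?k * (half_gradient_energy (\<lambda>x. w x $ 3) + D / (2 * pi * real (Suc M)))"
      by (intro mult_left_mono add_right_mono half less_imp_le[OF k0])
    then show ?thesis using key[of "Suc M" n] by linarith
  qed
  have key3: "\<epsilon> / 2 * (\<Sum>j\<in>UNIV. \<Sum>k\<in>dual_box n. (norm k)\<^sup>2 * ?d j k)
      \<le> I - 1 / (2 * \<epsilon>) * (1 - nsq (\<lambda>x. w x $ 3)) + ?k * (half_gradient_energy (\<lambda>x. w x $ 3) + 0)" for n
  proof (rule LIMSEQ_le_const)
    have "(\<lambda>M. D / (2 * pi) * inverse (real (Suc M))) \<longlonglongrightarrow> D / (2 * pi) * 0"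
      by (intro tendsto_mult_left LIMSEQ_inverse_real_of_nat)
    moreover have "(\<lambda>M. D / (2 * pi) * inverse (real (Suc M))) = (\<lambda>M. D / (2 * pi * real (Suc M)))"
      by (simp add: fun_eq_iff inverse_eq_divide del: of_nat_Suc)
    ultimately have "(\<lambda>M. D / (2 * pi * real (Suc M))) \<longlonglongrightarrow> 0" by (simp only: mult_zero_right)
    then show "(\<lambda>M. I - 1 / (2 * \<epsilon>) * (1 - nsq (\<lambda>x. w x $ 3)) + ?k * (half_gradient_energy (\<lambda>x. w x $ 3) + D / (2 * pi * real (Suc M))))
      \<longlonglongrightarrow> I - 1 / (2 * \<epsilon>) * (1 - nsq (\<lambda>x. w x $ 3)) + ?k * (half_gradient_energy (\<lambda>x. w x $ 3) + 0)"
      by (intro tendsto_add tendsto_mult_left tendsto_const)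
  qed (use key2 in blast)
  have "(\<lambda>n. \<epsilon> / 2 * (\<Sum>j\<in>UNIV. \<Sum>k\<in>dual_box n. (norm k)\<^sup>2 * ?d j k))
      \<longlonglongrightarrow> \<epsilon> / 2 * (\<Sum>j\<in>UNIV. nsq (weak_gradient (\<lambda>x. w x $ j)))"
    by (intro tendsto_mult_left tendsto_sum has_sum_dual_boxD Parseval_gradient H)
  then have "\<epsilon> / 2 * (\<Sum>j\<in>UNIV. nsq (weak_gradient (\<lambda>x. w x $ j)))
      \<le> I - 1 / (2 * \<epsilon>) * (1 - nsq (\<lambda>x. w x $ 3)) + ?k * (half_gradient_energy (\<lambda>x. w x $ 3) + 0)"
    by (rule LIMSEQ_le_const2) (use key3 in blast)
  then have "energy \<epsilon> l w \<le> I" unfolding energy_expand[OF wS] add_0_right by linarith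
  then show thesis using that[OF wS] I_le order_trans by blast
qed

subsection \<open>A striped competitor\<close>

text \<open>By shift invariance an added phase s does not change the torus integral. Averaging over
  s and exchanging the integrals turns the inner one into a full period, independent of x. The torus
  measure need not be written as a product.\<close>

lemma integral_periodic_profile:
  fixes h :: "real \<Rightarrow> real"
  assumes cont: "continuous_on UNIV h" and per: "\<And>t. h (t + 2 * pi) = h t" and N: "0 < N"
  shows "tint (\<lambda>x. h (2 * pi * real N * x $ 1)) = integral {0..2 * pi} h / (2 * pi)"
proof -
  let ?f = "\<lambda>x::real^2. h (2 * pi * real N * x $ 1)"
  interpret D: finite_measure dir_measure by (rule finite_dir_measure)
  interpret P: pair_sigma_finite torus_measure dir_measure ..
  have [measurable]: "h \<in> borel_measurable borel" by (rule borel_measurable_continuous_onI[OF cont])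
  have pern: "h (t + 2 * pi * real n) = h t" for n t
  proof (induction n)
    case (Suc n)
    have "t + 2 * pi * real (Suc n) = (t + 2 * pi * real n) + 2 * pi" by (simp add: algebra_simps)
    then show ?case using per Suc by metis
  qed simp
  have tp: "torus_periodic ?f"
    unfolding torus_periodic_def
  proof safe
    fix x :: "real^2" and i :: 2
    show "h (2 * pi * real N * (x + axis i 1) $ 1) = h (2 * pi * real N * x $ 1)"
      using pern[of "2 * pi * real N * x $ 1" N] by (cases "i = 1") (simp_all add: axis_def algebra_simps)
  qed
  have fm: "?f \<in> borel_measurable borel" by measurable
  have sh: "tint (\<lambda>x. h (2 * pi * real N * x $ 1 + s)) = tint ?f" for s
  proof -
    have "2 * pi * real N * (x + axis 1 (s / (2 * pi * real N))) $ 1 = 2 * pi * real N * x $ 1 + s" for x :: "real^2"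
      using N by (simp add: axis_def algebra_simps)
    then show ?thesis using torus_shift(1)[OF tp fm, of "axis 1 (s / (2 * pi * real N))"] by simp
  qed
  have avg: "((\<lambda>s. h (t + s)) has_integral integral {0..2 * pi} h) {0..2 * pi}" for t
    using periodic_integral_shift[OF cont per, of t] by (simp add: add.commute)
  have ct: "continuous_on UNIV (\<lambda>s. h (t + s))" for t
    by (intro continuous_on_compose2[OF cont] continuous_intros) auto
  note dir = integral_dir_measure[OF ct avg]
  have id: "(\<lambda>t. t) \<in> measurable dir_measure borel"
    unfolding dir_measure_def by (rule measurable_restrict_space1) simp
  have s1: "snd \<in> borel_measurable (torus_measure \<Otimes>\<^sub>M dir_measure)"
    by (rule measurable_compose[OF measurable_snd id])
  have f1: "fst \<in> borel_measurable (torus_measure \<Otimes>\<^sub>M dir_measure)"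
    by (rule measurable_compose[OF measurable_fst measurable_ident_torus])
  have nm: "((\<lambda>s. norm (h (t + s))) has_integral integral {0..2 * pi} (\<lambda>s. norm (h s))) {0..2 * pi}" for t
    using periodic_integral_shift[of "\<lambda>s. norm (h s)" t, OF continuous_on_norm[OF cont]] per
    by (simp add: add.commute)
  have nc: "continuous_on UNIV (\<lambda>s. norm (h (t + s)))" for t
    by (intro continuous_on_norm ct)
  have int: "integrable (torus_measure \<Otimes>\<^sub>M dir_measure) (case_prod (\<lambda>x s. h (2 * pi * real N * x $ 1 + s)))"
  proof (rule P.Fubini_integrable)
    show "case_prod (\<lambda>x s. h (2 * pi * real N * x $ 1 + s)) \<in> borel_measurable (torus_measure \<Otimes>\<^sub>M dir_measure)"
    proof -
      have f2: "(\<lambda>p. fst p $ 1) \<in> borel_measurable (torus_measure \<Otimes>\<^sub>M dir_measure)"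
        by (rule measurable_compose[OF f1]) measurable
      have "(\<lambda>p. 2 * pi * real N * fst p $ 1 + snd p) \<in> borel_measurable (torus_measure \<Otimes>\<^sub>M dir_measure)"
        by (intro borel_measurable_add borel_measurable_times borel_measurable_const f2 s1)
      from measurable_compose[OF this \<open>h \<in> borel_measurable borel\<close>] show ?thesis
        unfolding case_prod_beta .
    qed
  qed (simp_all add: integral_dir_measure(1)[OF nc nm, unfolded real_norm_def] dir(2))
  have "2 * pi * tint ?f = integral\<^sup>L dir_measure (\<lambda>s. tint (\<lambda>x. h (2 * pi * real N * x $ 1 + s)))"
    unfolding sh by (rule integral_dir_const(1)[symmetric])
  also have "\<dots> = tint (\<lambda>x. integral\<^sup>L dir_measure (\<lambda>s. h (2 * pi * real N * x $ 1 + s)))"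
    by (rule P.Fubini_integral[OF int])
  also have "\<dots> = integral {0..2 * pi} h"
    unfolding dir(1) using torus.prob_space by simp
  finally show ?thesis by (simp add: field_simps)
qed

lemma quarter_period_integral:
  fixes h :: "real \<Rightarrow> real"
  assumes cont: "continuous_on UNIV h" and r: "\<And>y. h (pi - y) = h y" and p: "\<And>y. h (y + pi) = h y"
  shows "integral {0..2 * pi} h = 4 * integral {0..pi / 2} h"
proof -
  have int: "h integrable_on {a..b}" for a b
    by (intro integrable_continuous_interval continuous_on_subset[OF cont]) auto
  define I where "I = integral {0..pi / 2} h"
  have 1: "(h has_integral I) {0..pi / 2}" unfolding I_def using int by (rule integrable_integral)
  have 2: "(h has_integral I) {pi / 2..pi}"
  proof -
    have "((\<lambda>y. h ((-1) *\<^sub>R y + pi)) has_integral (1 / (abs (-1) ^ DIM(real))) *\<^sub>R I) ((\<lambda>x. (1 / (-1)) *\<^sub>R x + - ((1 / (-1)) *\<^sub>R pi)) ` cbox 0 (pi / 2))"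
      using 1 by (intro has_integral_affinity) auto
    moreover have "(\<lambda>x. (1 / (-1)) *\<^sub>R x + - ((1 / (-1)) *\<^sub>R pi)) ` cbox 0 (pi / 2) = {pi / 2..pi}"
    proof (intro set_eqI iffI)
      fix y assume "y \<in> {pi / 2..pi}"
      then show "y \<in> (\<lambda>x. (1 / (-1)) *\<^sub>R x + - ((1 / (-1)) *\<^sub>R pi)) ` cbox 0 (pi / 2)"
        by (intro image_eqI[of _ _ "pi - y"]) auto
    qed auto
    ultimately show ?thesis using r by (simp add: algebra_simps)
  qed
  have 3: "(h has_integral (I + I)) {0..pi}"
    by (rule has_integral_combine[OF _ _ 1 2]) auto
  have 4: "(h has_integral (I + I)) {pi..2 * pi}"
  proof -
    have "((\<lambda>y. h (1 *\<^sub>R y + - pi)) has_integral (1 / (abs 1 ^ DIM(real))) *\<^sub>R (I + I)) ((\<lambda>x. (1 / 1) *\<^sub>R x + - ((1 / 1) *\<^sub>R - pi)) ` cbox 0 pi)"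
      using 3 by (intro has_integral_affinity) auto
    moreover have "(\<lambda>x. (1 / 1) *\<^sub>R x + - ((1 / 1) *\<^sub>R - pi)) ` cbox 0 pi = {pi..2 * pi}"
      by simp
    moreover have "h (1 *\<^sub>R y + - pi) = h y" for y using p[of "y - pi"] by simp
    ultimately show ?thesis by simp
  qed
  have "(h has_integral (I + I) + (I + I)) {0..2 * pi}"
    by (rule has_integral_combine[OF _ _ 3 4]) auto
  then show ?thesis unfolding I_def by (simp add: integral_unique)
qed

section \<open>Elementary bounds for sine and hyperbolic functions\<close>

lemma sin_ge_half:
  assumes "0 \<le> y" "y \<le> pi / 2"
  shows "y / 2 \<le> sin (y::real)"
proof (cases "y \<le> pi / 3")
  case True
  \<comment> \<open>The difference \<open>sin y - y / 2\<close> increases up to \<pi>/3 and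
    decreases afterwards, so its values at the two ends decide.\<close>
  have "sin 0 - 0 / 2 \<le> sin y - y / 2"
  proof (rule DERIV_nonneg_imp_nondecreasing[OF assms(1)])
    fix x :: real assume x: "0 \<le> x" "x \<le> y"
    have "cos (pi / 3) \<le> cos x" using x True pi_gt_zero by (intro cos_monotone_0_pi_le) auto
    then show "\<exists>d. ((\<lambda>y. sin y - y / 2) has_real_derivative d) (at x) \<and> 0 \<le> d"
      by (intro exI[of _ "cos x - 1 / 2"]) (auto intro!: derivative_eq_intros simp: cos_60)
  qed
  then show ?thesis by simp
next
  case False
  have "sin (pi / 2) - (pi / 2) / 2 \<le> sin y - y / 2"
  proof (rule DERIV_nonpos_imp_nonincreasing[OF assms(2)])
    fix x :: real assume x: "y \<le> x" "x \<le> pi / 2"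
    have "cos x \<le> cos (pi / 3)" using x False pi_gt_zero by (intro cos_monotone_0_pi_le) auto
    then show "\<exists>d. ((\<lambda>y. sin y - y / 2) has_real_derivative d) (at x) \<and> d \<le> 0"
      by (intro exI[of _ "cos x - 1 / 2"]) (auto intro!: derivative_eq_intros simp: cos_60)
  qed
  then show ?thesis using pi_less_4 by simp
qed

lemma one_minus_tanh_le: "1 - tanh s \<le> 2 * exp (- 2 * (s::real))"
proof -
  have "1 - tanh s = 2 * exp (- 2 * s) / (1 + exp (- 2 * s))"
    unfolding tanh_real_altdef by (simp add: field_simps add_pos_pos less_imp_neq[symmetric])
  also have "\<dots> \<le> 2 * exp (- 2 * s)"
    by (simp add: divide_le_eq add_pos_pos mult_le_cancel_left)
  finally show ?thesis .
qed

lemma inverse_cosh_sq_le: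
  assumes "0 < (s::real)"
  shows "1 / (cosh s)\<^sup>2 \<le> 4 / s\<^sup>2"
proof -
  have "s / 2 \<le> cosh s"
  proof -
    have "s \<le> exp s + exp (- s)"
      using exp_ge_add_one_self[of s] exp_gt_zero[of "- s"] by linarith
    then show ?thesis unfolding cosh_field_def by simp
  qed
  then have "(s / 2)\<^sup>2 \<le> (cosh s)\<^sup>2" using assms by (intro power_mono) auto
  then have "1 / (cosh s)\<^sup>2 \<le> 1 / (s / 2)\<^sup>2" using assms by (intro divide_left_mono mult_pos_pos) auto
  then show ?thesis by (simp add: power_divide)
qed

section \<open>Maps depending on one coordinate\<close>

lemma profile_weak_gradient:
  assumes der: "\<And>t. (f has_real_derivative f' t) (at t)" and c: "continuous_on UNIV f'" and p: "\<And>t. f (t + 1) = f t"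
  shows "is_weak_gradient (\<lambda>x. f (x $ 1)) (\<lambda>x. axis 1 (f' (x $ 1)))" "(\<lambda>x. f ((x::real^2) $ 1)) \<in> L2_torus"
proof -
  have tp: "torus_periodic (\<lambda>x::real^2. f (x $ 1))"
    unfolding torus_periodic_def
  proof safe
    fix x :: "real^2" and i :: 2
    show "f ((x + axis i 1) $ 1) = f (x $ 1)" using p by (cases "i = 1") (simp_all add: axis_def)
  qed
  have d: "((\<lambda>x::real^2. f (x $ 1)) has_derivative (\<lambda>h. axis 1 (f' (x $ 1)) \<bullet> h)) (at x)" for x :: "real^2"
  proof -
    have "((\<lambda>x::real^2. x $ 1) has_derivative (\<lambda>h. h $ 1)) (at x)"
      by (intro bounded_linear_imp_has_derivative bounded_linear_vec_nth)
    from has_derivative_compose[OF this, of f "\<lambda>h. f' (x $ 1) * h"] der[of "x $ 1"]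
    show ?thesis by (simp add: has_field_derivative_def inner_axis')
  qed
  have g: "continuous_on UNIV (\<lambda>x::real^2. axis 1 (f' (x $ 1)) :: real^2)"
  proof -
    have "(\<lambda>x::real^2. axis 1 (f' (x $ 1)) :: real^2) = (\<lambda>x. f' (x $ 1) *\<^sub>R axis 1 1)"
      by (auto simp: fun_eq_iff vec_eq_iff axis_def)
    moreover have "continuous_on UNIV (\<lambda>x::real^2. f' (x $ 1) *\<^sub>R (axis 1 1 :: real^2))"
      by (intro continuous_intros continuous_on_compose2[OF c]) auto
    ultimately show ?thesis by (simp only:)
  qed
  show "is_weak_gradient (\<lambda>x. f (x $ 1)) (\<lambda>x. axis 1 (f' (x $ 1)))" "(\<lambda>x. f ((x::real^2) $ 1)) \<in> L2_torus"
    using classical_weak_gradient[OF tp d g] by auto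
qed

text \<open>The curve (1/cosh, 0, tanh) at t/\<epsilon> is the optimal transition between the poles:
  along it the density of total variation equals that of the local energy. Inserting A sin (2 \<pi>
  N x1) gives a smooth periodic map with 2 N such walls, and 2 \<pi> N A = 1/\<epsilon> gives the
  argument slope 1/\<epsilon> in modulus at each wall.\<close>

definition stripes :: "real \<Rightarrow> nat \<Rightarrow> real^2 \<Rightarrow> real^3" where
  "stripes A N x = vector [1 / cosh (A * sin (2 * pi * real N * x $ 1)), 0, tanh (A * sin (2 * pi * real N * x $ 1))]"

lemma stripes_nth [simp]:
  "stripes A N x $ 1 = 1 / cosh (A * sin (2 * pi * real N * x $ 1))"
  "stripes A N x $ 2 = 0"
  "stripes A N x $ 3 = tanh (A * sin (2 * pi * real N * x $ 1))"
  by (simp_all add: stripes_def)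

lemma sin_stripe_period: "sin (2 * pi * real N * (t + 1)) = sin (2 * pi * real N * t)"
proof -
  have "2 * pi * real N * (t + 1) = 2 * pi * real N * t + 2 * real N * pi" by (simp add: algebra_simps)
  then show ?thesis by (simp only: sin_add sin_2npi cos_2npi)
qed

lemma inverse_cosh_sq: "1 - (tanh s)\<^sup>2 = 1 / (cosh (s::real))\<^sup>2"
proof -
  have "cosh s \<noteq> 0" using cosh_real_pos[of s] by simp
  then have "1 - (tanh s)\<^sup>2 = ((cosh s)\<^sup>2 - (sinh s)\<^sup>2) / (cosh s)\<^sup>2"
    by (simp add: tanh_def power_divide diff_divide_distrib)
  then show ?thesis by (simp add: cosh_square_eq)
qed

lemma stripes_gradient:
  fixes A :: real
  defines "q \<equiv> (\<lambda>N t. A * sin (2 * pi * real N * t))" and "q' \<equiv> (\<lambda>N t. A * (2 * pi * real N * cos (2 * pi * real N * t)))"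
  shows "is_weak_gradient (\<lambda>x. stripes A N x $ 1) (\<lambda>x. axis 1 (- sinh (q N (x $ 1)) / (cosh (q N (x $ 1)))\<^sup>2 * q' N (x $ 1)))"
    "(\<lambda>x. stripes A N x $ 1) \<in> L2_torus"
    "is_weak_gradient (\<lambda>x. stripes A N x $ 2) (\<lambda>x. axis 1 0)" "(\<lambda>x. stripes A N x $ 2) \<in> L2_torus"
    "is_weak_gradient (\<lambda>x. stripes A N x $ 3) (\<lambda>x. axis 1 (1 / (cosh (q N (x $ 1)))\<^sup>2 * q' N (x $ 1)))"
    "(\<lambda>x. stripes A N x $ 3) \<in> L2_torus"
proof -
  have ch: "cosh s \<noteq> 0" for s :: real using cosh_real_pos[of s] by simp
  have dq: "(q N has_real_derivative q' N t) (at t)" for t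
    unfolding q_def q'_def by (auto intro!: derivative_eq_intros)
  have cq: "continuous_on UNIV (q N)" "continuous_on UNIV (q' N)"
    unfolding q_def q'_def by (intro continuous_intros)+
  have pq: "q N (t + 1) = q N t" for t unfolding q_def by (simp only: sin_stripe_period)
  have d1: "((\<lambda>t. 1 / cosh (q N t)) has_real_derivative - sinh (q N t) / (cosh (q N t))\<^sup>2 * q' N t) (at t)" for t
    by (rule derivative_eq_intros dq refl ch)+ (simp add: power2_eq_square)
  have d3: "((\<lambda>t. tanh (q N t)) has_real_derivative 1 / (cosh (q N t))\<^sup>2 * q' N t) (at t)" for t
    by (rule derivative_eq_intros dq refl ch)+ (simp add: inverse_cosh_sq)
  have c1: "continuous_on UNIV (\<lambda>t. - sinh (q N t) / (cosh (q N t))\<^sup>2 * q' N t)"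
    and c3: "continuous_on UNIV (\<lambda>t. 1 / (cosh (q N t))\<^sup>2 * q' N t)"
    using ch by (auto intro!: continuous_intros cq)
  have p1: "1 / cosh (q N (t + 1)) = 1 / cosh (q N t)" and p3: "tanh (q N (t + 1)) = tanh (q N t)" for t
    by (simp_all only: pq)
  show "is_weak_gradient (\<lambda>x. stripes A N x $ 1) (\<lambda>x. axis 1 (- sinh (q N (x $ 1)) / (cosh (q N (x $ 1)))\<^sup>2 * q' N (x $ 1)))"
    "(\<lambda>x. stripes A N x $ 1) \<in> L2_torus"
    using profile_weak_gradient[OF d1 c1 p1] by (simp_all only: stripes_nth q_def)
  show "is_weak_gradient (\<lambda>x. stripes A N x $ 2) (\<lambda>x. axis 1 0)" "(\<lambda>x. stripes A N x $ 2) \<in> L2_torus"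
    using profile_weak_gradient[of "\<lambda>_. 0" "\<lambda>_. 0"] by auto
  show "is_weak_gradient (\<lambda>x. stripes A N x $ 3) (\<lambda>x. axis 1 (1 / (cosh (q N (x $ 1)))\<^sup>2 * q' N (x $ 1)))"
    "(\<lambda>x. stripes A N x $ 3) \<in> L2_torus"
    using profile_weak_gradient[OF d3 c3 p3] by (simp_all only: stripes_nth q_def)
qed

lemma stripes_H1: "stripes A N \<in> H1_torus_sphere"
proof -
  note G = stripes_gradient[of A N]
  have H: "(\<lambda>x. stripes A N x $ j) \<in> H1_torus" for j
    using G exhaust_3[of j] unfolding H1_torus_def by blast
  have L: "(\<lambda>x. stripes A N x $ j) \<in> L2_torus" for j
    using H[of j] by (simp add: H1_torus_def)
  have "stripes A N = (\<lambda>x. \<Sum>j\<in>UNIV. stripes A N x $ j *\<^sub>R axis j 1)"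
    by (simp add: fun_eq_iff vec_eq_iff forall_3 sum_3 axis_def)
  moreover have "(\<lambda>x. \<Sum>j\<in>UNIV. stripes A N x $ j *\<^sub>R (axis j 1 :: real^3)) \<in> L2_torus"
    by (intro L2_sum L2_bounded_linear[OF L bounded_linear_scaleR_left]) auto
  ultimately have S: "stripes A N \<in> L2_torus" by metis
  have "norm (stripes A N x) = 1" for x
  proof -
    let ?s = "A * sin (2 * pi * real N * x $ 1)"
    have "(norm (stripes A N x))\<^sup>2 = 1"
      unfolding sphere_sum_squares sum_3 using inverse_cosh_sq[of ?s] by (simp add: power_divide)
    then show ?thesis using norm_ge_zero[of "stripes A N x"] by (simp add: power2_eq_1_iff)
  qed
  then have "stripes A N \<in> L1_torus_sphere"
    using L2_torusD[OF S] L2_integrable[OF S] by (simp add: L1_torus_sphere_def torus_integrable_eq)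
  then show ?thesis using H by (simp add: H1_torus_sphere_def)
qed

section \<open>Local energy of the stripes\<close>

lemma nsq_weak_gradient_eq:
  assumes "u \<in> L2_torus" "is_weak_gradient u g"
  shows "nsq (weak_gradient u) = nsq g"
proof -
  have u: "u \<in> H1_torus" using assms by (auto simp: H1_torus_def)
  show ?thesis
    by (rule nsq_cong_AE[OF weak_gradient_unique[OF assms(1) H1_torusD(2)[OF u] assms(2)]])
      (use H1_torusD(3)[OF u] assms(2) in \<open>auto simp: is_weak_gradient_def intro: L2_torusD\<close>)
qed

text \<open>Here |m'|^2 = cos^2 / (\<epsilon> cosh)^2 and 1 - m3^2 = 1 / cosh^2, so the weighted
  gradient and anisotropy terms differ only by the factor cos^2.\<close>

lemma stripes_local_energy_eq:
  assumes N: "0 < N" and \<epsilon>: "0 < \<epsilon>" and A: "2 * pi * real N * A = 1 / \<epsilon>"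
  shows "local_energy \<epsilon> (stripes A N)
    = 1 / (2 * \<epsilon>) * (integral {0..2 * pi} (\<lambda>y. (1 + (cos y)\<^sup>2) / (cosh (A * sin y))\<^sup>2) / (2 * pi))"
proof -
  note G = stripes_gradient[of A N]
  let ?s = "\<lambda>x::real^2. A * sin (2 * pi * real N * x $ 1)"
  let ?c = "\<lambda>x::real^2. cos (2 * pi * real N * x $ 1)"
  have A': "A * (2 * pi * real N * t) = t / \<epsilon>" for t
  proof -
    have "A * (2 * pi * real N * t) = (2 * pi * real N * A) * t" by simp
    then show ?thesis unfolding A by simp
  qed
  have na: "(norm (axis 1 a :: real^2))\<^sup>2 = a\<^sup>2" for a :: real by (simp add: norm_vec2 axis_def)
  have cpos: "0 < cosh (t::real)" for t by simp
  note i = local_energy_integrable[OF stripes_H1[of A N]]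
  have g1: "nsq (weak_gradient (\<lambda>x. stripes A N x $ 1)) = tint (\<lambda>x. (- sinh (?s x) / (cosh (?s x))\<^sup>2 * (?c x / \<epsilon>))\<^sup>2)"
    unfolding nsq_weak_gradient_eq[OF G(2,1)] unfolding nsq_def na A' ..
  have g2: "nsq (weak_gradient (\<lambda>x. stripes A N x $ 2)) = 0"
    unfolding nsq_weak_gradient_eq[OF G(4,3)] unfolding nsq_def na by simp
  have g3: "nsq (weak_gradient (\<lambda>x. stripes A N x $ 3)) = tint (\<lambda>x. (1 / (cosh (?s x))\<^sup>2 * (?c x / \<epsilon>))\<^sup>2)"
    unfolding nsq_weak_gradient_eq[OF G(6,5)] unfolding nsq_def na A' ..
  have L1: "integrable torus_measure (\<lambda>x. (- sinh (?s x) / (cosh (?s x))\<^sup>2 * (?c x / \<epsilon>))\<^sup>2)"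
    using L2_torusD(3)[of "\<lambda>x. axis 1 (- sinh (?s x) / (cosh (?s x))\<^sup>2 * (A * (2 * pi * real N * ?c x))) :: real^2"] G(1)
    unfolding na A' by (simp add: is_weak_gradient_def)
  have L3: "integrable torus_measure (\<lambda>x. (1 / (cosh (?s x))\<^sup>2 * (?c x / \<epsilon>))\<^sup>2)"
    using L2_torusD(3)[of "\<lambda>x. axis 1 (1 / (cosh (?s x))\<^sup>2 * (A * (2 * pi * real N * ?c x))) :: real^2"] G(5)
    unfolding na A' by (simp add: is_weak_gradient_def)
  have "local_energy \<epsilon> (stripes A N)
    = \<epsilon> / 2 * (tint (\<lambda>x. (- sinh (?s x) / (cosh (?s x))\<^sup>2 * (?c x / \<epsilon>))\<^sup>2)
       + tint (\<lambda>x. (1 / (cosh (?s x))\<^sup>2 * (?c x / \<epsilon>))\<^sup>2))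
      + 1 / (2 * \<epsilon>) * tint (\<lambda>x. 1 - (stripes A N x $ 3)\<^sup>2)"
    unfolding local_energy_eq[OF stripes_H1] sum_3 g1 g2 g3 by simp
  also have "\<dots> = tint (\<lambda>x. \<epsilon> / 2 * ((- sinh (?s x) / (cosh (?s x))\<^sup>2 * (?c x / \<epsilon>))\<^sup>2
       + (1 / (cosh (?s x))\<^sup>2 * (?c x / \<epsilon>))\<^sup>2) + 1 / (2 * \<epsilon>) * (1 - (stripes A N x $ 3)\<^sup>2))"
    using L1 L3 i(2) by (simp only: Bochner_Integration.integral_add Bochner_Integration.integrable_add integrable_mult_right integral_mult_right_zero)
  also have "\<dots> = tint (\<lambda>x. 1 / (2 * \<epsilon>) * ((1 + (?c x)\<^sup>2) / (cosh (?s x))\<^sup>2))"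
  proof (intro Bochner_Integration.integral_cong refl)
    fix x :: "real^2"
    have alg: "\<epsilon> / 2 * ((- a / b\<^sup>2 * (c / \<epsilon>))\<^sup>2 + (1 / b\<^sup>2 * (c / \<epsilon>))\<^sup>2) + 1 / (2 * \<epsilon>) * (1 / b\<^sup>2) = 1 / (2 * \<epsilon>) * ((1 + c\<^sup>2) / b\<^sup>2)"
      if "b\<^sup>2 = a\<^sup>2 + 1" "0 < b" for a b c :: real
    proof -
      have "(- a / b\<^sup>2 * (c / \<epsilon>))\<^sup>2 + (1 / b\<^sup>2 * (c / \<epsilon>))\<^sup>2 = (a\<^sup>2 + 1) / (b\<^sup>2 * b\<^sup>2) * (c\<^sup>2 / \<epsilon>\<^sup>2)"
        by (simp add: power_mult_distrib power_divide power2_eq_square[of "b\<^sup>2", symmetric] add_divide_distrib distrib_right)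
          (simp add: power2_eq_square)?
      also have "\<dots> = c\<^sup>2 / (b\<^sup>2 * \<epsilon>\<^sup>2)"
      proof -
        have "b\<^sup>2 / (b\<^sup>2 * b\<^sup>2) = 1 / b\<^sup>2" using that(2) by (subst nonzero_divide_mult_cancel_left) auto
        then show ?thesis unfolding that(1)[symmetric] by simp
      qed
      finally show ?thesis using \<epsilon> that(2) by (simp add: field_simps power2_eq_square)
    qed
    show "\<epsilon> / 2 * ((- sinh (?s x) / (cosh (?s x))\<^sup>2 * (?c x / \<epsilon>))\<^sup>2
       + (1 / (cosh (?s x))\<^sup>2 * (?c x / \<epsilon>))\<^sup>2) + 1 / (2 * \<epsilon>) * (1 - (stripes A N x $ 3)\<^sup>2)
      = 1 / (2 * \<epsilon>) * ((1 + (?c x)\<^sup>2) / (cosh (?s x))\<^sup>2)"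
      unfolding stripes_nth inverse_cosh_sq by (rule alg[OF cosh_square_eq cosh_real_pos])
  qed
  also have "\<dots> = 1 / (2 * \<epsilon>) * tint (\<lambda>x. (1 + (?c x)\<^sup>2) / (cosh (?s x))\<^sup>2)"
    by (rule integral_mult_right_zero)
  also have "tint (\<lambda>x. (1 + (?c x)\<^sup>2) / (cosh (?s x))\<^sup>2)
     = integral {0..2 * pi} (\<lambda>y. (1 + (cos y)\<^sup>2) / (cosh (A * sin y))\<^sup>2) / (2 * pi)"
    using cpos by (intro integral_periodic_profile[of "\<lambda>y. (1 + (cos y)\<^sup>2) / (cosh (A * sin y))\<^sup>2", OF _ _ N] continuous_intros)
      (auto simp: less_imp_neq[symmetric])
  finally show ?thesis .
qed

text \<open>Write 1 + cos^2 = 2 cos + (1 - cos)^2. The first part is the exact derivative of a tanh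
  and contributes at most 4 N, that is 2 for each of the 2 N walls. The second vanishes to fourth
  order at a wall, while 1 / cosh^2 is small away from it; this leaves a relative error of order
  1/A.\<close>

lemma stripes_local_energy_le:
  assumes N: "0 < N" and \<epsilon>: "0 < \<epsilon>" and A: "2 * pi * real N * A = 1 / \<epsilon>" and A0: "0 < A"
  shows "local_energy \<epsilon> (stripes A N) \<le> 4 * real N * (1 + 16 / A)"
proof -
  let ?h = "\<lambda>y. (1 + (cos y)\<^sup>2) / (cosh (A * sin y))\<^sup>2"
  have chp: "0 < cosh (t::real)" "cosh t \<noteq> 0" for t using cosh_real_pos[of t] by simp_all
  have hc: "continuous_on S ?h" for S
    using chp by (intro continuous_intros) auto
  have q: "integral {0..2 * pi} ?h = 4 * integral {0..pi / 2} ?h"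
    by (rule quarter_period_integral[OF hc]) simp_all
  have tan: "((\<lambda>y. A * cos y / (cosh (A * sin y))\<^sup>2) has_integral (tanh (A * sin (pi / 2)) - tanh (A * sin 0))) {0..pi / 2}"
  proof (rule fundamental_theorem_of_calculus)
    fix y :: real
    have "((\<lambda>y. tanh (A * sin y)) has_real_derivative (1 - (tanh (A * sin y))\<^sup>2) * (A * cos y)) (at y within {0..pi / 2})"
      by (rule derivative_eq_intros refl chp)+ simp
    then show "((\<lambda>y. tanh (A * sin y)) has_vector_derivative A * cos y / (cosh (A * sin y))\<^sup>2) (at y within {0..pi / 2})"
      unfolding inverse_cosh_sq has_real_derivative_iff_has_vector_derivative by simp
  qed simp
  have pt: "?h y \<le> 2 / A * (A * cos y / (cosh (A * sin y))\<^sup>2) + 16 / A\<^sup>2" if y: "y \<in> {0..pi / 2}" for y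
  proof -
    have "(1 + (cos y)\<^sup>2) = 2 * cos y + (1 - cos y)\<^sup>2" by (simp add: power2_eq_square algebra_simps)
    then have "?h y = 2 / A * (A * cos y / (cosh (A * sin y))\<^sup>2) + (1 - cos y)\<^sup>2 * (1 / (cosh (A * sin y))\<^sup>2)"
      using A0 by (simp add: add_divide_distrib)
    moreover have "(1 - cos y)\<^sup>2 * (1 / (cosh (A * sin y))\<^sup>2) \<le> 16 / A\<^sup>2"
    proof (cases "y = 0")
      case False
      then have y0: "0 < y" using y by simp
      have s: "y / 2 \<le> sin y" using y by (intro sin_ge_half) auto
      then have s0: "0 < A * sin y" using y0 A0 by (intro mult_pos_pos) auto
      have "(1 - cos y)\<^sup>2 \<le> (y\<^sup>2 / 2)\<^sup>2"
        using two_minus_cos_le[of y] cos_le_one[of y] by (intro power_mono) auto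
      moreover have "1 / (cosh (A * sin y))\<^sup>2 \<le> 4 / (A * (y / 2))\<^sup>2"
      proof -
        have "4 / (A * sin y)\<^sup>2 \<le> 4 / (A * (y / 2))\<^sup>2"
          using s y0 A0 by (intro divide_left_mono power_mono mult_left_mono mult_pos_pos) auto
        then show ?thesis using inverse_cosh_sq_le[OF s0] by linarith
      qed
      ultimately have "(1 - cos y)\<^sup>2 * (1 / (cosh (A * sin y))\<^sup>2) \<le> (y\<^sup>2 / 2)\<^sup>2 * (4 / (A * (y / 2))\<^sup>2)"
        by (intro mult_mono) auto
      also have "\<dots> = 4 * y\<^sup>2 / A\<^sup>2" using y0 A0 by (simp add: field_simps power2_eq_square)
      also have "\<dots> \<le> 4 * 2\<^sup>2 / A\<^sup>2"
        using y pi_less_4 by (intro divide_right_mono mult_left_mono power_mono) auto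
      finally show ?thesis by simp
    qed simp
    ultimately show ?thesis by linarith
  qed
  have rhs: "((\<lambda>y. 2 / A * (A * cos y / (cosh (A * sin y))\<^sup>2) + 16 / A\<^sup>2) has_integral
      (2 / A * tanh A + (pi / 2) * (16 / A\<^sup>2))) {0..pi / 2}"
    using has_integral_add[OF has_integral_mult_right[OF tan, of "2 / A"] has_integral_const_real[of "16 / A\<^sup>2" 0 "pi / 2"]]
    by simp
  have "integral {0..pi / 2} ?h \<le> 2 / A * tanh A + (pi / 2) * (16 / A\<^sup>2)"
    by (rule has_integral_le[OF integrable_integral[OF integrable_continuous_interval[OF hc]] rhs]) (rule pt)
  also have "\<dots> \<le> 2 / A * 1 + 2 * (16 / A\<^sup>2)"
    using A0 tanh_real_lt_1[of A] pi_less_4 by (intro add_mono mult_left_mono mult_right_mono) auto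
  finally have "integral {0..pi / 2} ?h \<le> 2 / A + 32 / A\<^sup>2" by simp
  then have "1 / (2 * \<epsilon>) * ((4 * integral {0..pi / 2} ?h) / (2 * pi)) \<le> 1 / (2 * \<epsilon>) * ((4 * (2 / A + 32 / A\<^sup>2)) / (2 * pi))"
    using \<epsilon> by (intro mult_left_mono divide_right_mono) auto
  also have "\<dots> = (1 / \<epsilon>) * (2 / A + 32 / A\<^sup>2) / pi"
  proof -
    have "1 / (2 * \<epsilon>) * ((4 * I) / (2 * pi)) = (1 / \<epsilon>) * I / pi" for I :: real
      using \<epsilon> by (simp add: field_simps)
    then show ?thesis .
  qed
  also have "\<dots> = 4 * real N * (1 + 16 / A)"
    unfolding A[symmetric] using A0 by (simp add: field_simps power2_eq_square)
  finally show ?thesis unfolding stripes_local_energy_eq[OF N \<epsilon> A] q .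
qed

section \<open>Nonlocal energy of the stripes\<close>

lemma stripes_fcoef:
  assumes N: "0 < N"
  shows "tint (\<lambda>x. stripes A N x $ 3 * sin (real (2 * i + 1) * (2 * pi * real N * x $ 1)))
    = 2 / pi * integral {0..pi / 2} (\<lambda>y. tanh (A * sin y) * sin (real (2 * i + 1) * y))"
proof -
  define j where "j = 2 * i + 1"
  let ?h = "\<lambda>y. tanh (A * sin y) * sin (real j * y)"
  have ch: "cosh (t::real) \<noteq> 0" for t using cosh_real_pos[of t] by simp
  have c: "continuous_on S ?h" for S by (intro continuous_intros ch)
  \<comment> \<open>Since \<open>j\<close> is odd, the product with \<open>tanh (A * sin y)\<close>
    has both symmetries required by \<open>quarter_period_integral\<close>.\<close>
  have "real j * pi = 2 * real i * pi + pi" by (simp add: j_def algebra_simps)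
  then have np: "sin (real j * pi) = 0" "cos (real j * pi) = - 1"
    by (simp_all only: sin_add cos_add sin_2npi cos_2npi) simp_all
  have sp: "sin (real j * (y + pi)) = - sin (real j * y)" for y
    unfolding distrib_left sin_add np by simp
  have sm: "sin (real j * (pi - y)) = sin (real j * y)" for y
    unfolding right_diff_distrib sin_diff np by simp
  have p: "?h (y + pi) = ?h y" and m: "?h (pi - y) = ?h y" for y
    unfolding sp sm by simp_all
  have p2: "?h (y + 2 * pi) = ?h y" for y
    using p[of "y + pi"] p[of y] by (simp add: add.assoc)
  have "tint (\<lambda>x. ?h (2 * pi * real N * x $ 1)) = integral {0..2 * pi} ?h / (2 * pi)"
    by (rule integral_periodic_profile[OF c p2 N])
  also have "integral {0..2 * pi} ?h = 4 * integral {0..pi / 2} ?h"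
    by (rule quarter_period_integral[OF c m p])
  finally show ?thesis by (simp add: j_def)
qed

text \<open>For large A the profile approaches a square wave, for which the integral is 1/(2 i + 1).
  The deviation is at most 1 - tanh (A sin y) \<le> 2 exp (- A y), because sin y \<ge> y/2; its
  integral is of order 1/A uniformly in i.\<close>

lemma stripes_quarter_integral:
  assumes A: "0 < A"
  shows "1 / real (2 * i + 1) - 4 / A \<le> integral {0..pi / 2} (\<lambda>y. tanh (A * sin y) * sin (real (2 * i + 1) * y))"
proof -
  define j where "j = 2 * i + 1"
  have j: "0 < real j" by (simp add: j_def)
  have ch: "cosh (t::real) \<noteq> 0" for t using cosh_real_pos[of t] by simp
  have c: "continuous_on S (\<lambda>y. tanh (A * sin y) * sin (real j * y))" for S by (intro continuous_intros ch)
  have s: "((\<lambda>y. sin (real j * y)) has_integral (- cos (real j * (pi / 2)) / real j - - cos (real j * 0) / real j)) {0..pi / 2}"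
    by (rule fundamental_theorem_of_calculus)
      (use j in \<open>auto intro!: derivative_eq_intros simp: has_real_derivative_iff_has_vector_derivative[symmetric]\<close>)
  have "cos (real j * (pi / 2)) = 0"
  proof -
    have "real j * (pi / 2) = real i * pi + pi / 2" by (simp add: j_def algebra_simps add_divide_distrib)
    then show ?thesis by (simp only: cos_add sin_npi) simp
  qed
  then have s': "((\<lambda>y. sin (real j * y)) has_integral 1 / real j) {0..pi / 2}" using s by simp
  have e: "((\<lambda>y. 2 * exp (- (A * y))) has_integral (- (2 / A) * exp (- (A * (pi / 2))) - - (2 / A) * exp (- (A * 0)))) {0..pi / 2}"
    by (rule fundamental_theorem_of_calculus)
      (use A in \<open>auto intro!: derivative_eq_intros simp: has_real_derivative_iff_has_vector_derivative[symmetric]\<close>)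
  have "1 / real j - (- (2 / A) * exp (- (A * (pi / 2))) - - (2 / A) * exp (- (A * 0)))
      \<le> integral {0..pi / 2} (\<lambda>y. tanh (A * sin y) * sin (real j * y))"
  proof (rule has_integral_le[OF has_integral_diff[OF s' e] integrable_integral[OF integrable_continuous_interval[OF c]]])
    fix y assume y: "y \<in> {0..pi / 2}"
    have "y / 2 \<le> sin y" using y by (intro sin_ge_half) auto
    then have "A * (y / 2) \<le> A * sin y" using A by (intro mult_left_mono) auto
    then have "2 * exp (- 2 * (A * sin y)) \<le> 2 * exp (- (A * y))" by simp
    then have t: "1 - tanh (A * sin y) \<le> 2 * exp (- (A * y))"
      using one_minus_tanh_le[of "A * sin y"] by linarith
    have t0: "0 \<le> 1 - tanh (A * sin y)" using tanh_real_lt_1[of "A * sin y"] by simp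
    have "(1 - tanh (A * sin y)) * sin (real j * y) \<le> (1 - tanh (A * sin y)) * 1"
      using t0 by (intro mult_left_mono) auto
    then show "sin (real j * y) - 2 * exp (- (A * y)) \<le> tanh (A * sin y) * sin (real j * y)"
      using t by (simp add: algebra_simps)
  qed
  moreover have "- (2 / A) * exp (- (A * (pi / 2))) - - (2 / A) * exp (- (A * 0)) \<le> 4 / A"
  proof -
    have "0 \<le> (2 / A) * exp (- (A * (pi / 2)))" using A by simp
    moreover have "2 / A \<le> 4 / A" using A by (intro divide_right_mono) auto
    ultimately show ?thesis by simp
  qed
  ultimately show ?thesis unfolding j_def by linarith
qed

text \<open>The function ln (2 n + 1) / 2 vanishes at n = 0 and grows by at most 1/(2 n + 1) from n
  to n + 1.\<close>

lemma sum_odd_reciprocal_ge: "ln (real n) / 2 \<le> (\<Sum>i<n. 1 / real (2 * i + 1))"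
proof -
  have "ln (real (2 * n + 1)) / 2 \<le> (\<Sum>i<n. 1 / real (2 * i + 1))"
  proof (induction n)
    case (Suc n)
    have "ln (real (2 * Suc n + 1)) - ln (real (2 * n + 1)) = ln (real (2 * Suc n + 1) / real (2 * n + 1))"
      by (simp add: ln_div)
    also have "real (2 * Suc n + 1) / real (2 * n + 1) = 1 + 2 / real (2 * n + 1)"
      by (simp add: field_simps)
    also have "ln (1 + 2 / real (2 * n + 1)) \<le> 2 / real (2 * n + 1)"
      by (rule ln_add_one_self_le_self) simp
    finally have "ln (real (2 * Suc n + 1)) \<le> ln (real (2 * n + 1)) + 2 * (1 / real (2 * n + 1))" by simp
    then show ?case using Suc unfolding sum.lessThan_Suc by linarith
  qed simp
  moreover have "ln (real n) \<le> ln (real (2 * n + 1))" by (cases "n = 0") auto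
  ultimately show ?thesis by linarith
qed

text \<open>All terms of the series are nonnegative, and only odd multiples of the basic stripe
  frequency, with both signs, are kept. A weight |k| proportional to 2 i + 1 against squared
  coefficients of order (2 i + 1)^(-2) leaves a harmonic sum, the source of the logarithm.\<close>

lemma stripes_half_gradient_sum:
  assumes N: "0 < N" and A: "0 < A"
  shows "16 * real N / pi * (\<Sum>i<n. 1 / real (2 * i + 1) - 8 / A) \<le> half_gradient_energy (\<lambda>x. stripes A N x $ 3)"
proof -
  let ?u = "\<lambda>x. stripes A N x $ 3"
  note H = H1_sphereD[OF stripes_H1[of A N]]
  have u1: "AE x in torus_measure. \<bar>?u x\<bar> \<le> 1" by (rule sphere_m3_le[OF H1_sphere_L1[OF stripes_H1]])
  note hs = half_gradient_energy_bound(2)[OF H(1) u1 H(2) zero_less_one order_refl, unfolded fourier_coeff_eq]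
  \<comment> \<open>The first entry of the pair is the sign of the frequency, the second the index
    of the odd multiple.\<close>
  define kk :: "int \<times> nat \<Rightarrow> real^2" where "kk p = axis 1 (2 * pi * of_int (fst p * (int N * (2 * int (snd p) + 1))))" for p
  let ?P = "{1, - 1 :: int} \<times> {..<n}"
  define val where "val i = 8 * real N / pi * (1 / real (2 * i + 1) - 8 / A)" for i
  have inj: "inj_on kk ?P"
  proof (rule inj_onI)
    fix p q assume pq: "p \<in> ?P" "q \<in> ?P" "kk p = kk q"
    have "fst p * (int N * (2 * int (snd p) + 1)) = fst q * (int N * (2 * int (snd q) + 1))"
      using pq by (auto simp: kk_def axis_eq_axis simp del: of_int_mult)
    then have eq: "fst p * (2 * int (snd p) + 1) = fst q * (2 * int (snd q) + 1)" using N by simp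
    have "\<bar>fst p * (2 * int (snd p) + 1)\<bar> = 2 * int (snd p) + 1" "\<bar>fst q * (2 * int (snd q) + 1)\<bar> = 2 * int (snd q) + 1"
      using pq by (auto simp: abs_mult)
    then have "snd p = snd q" using eq by simp
    moreover from this have "fst p = fst q" using eq by simp
    ultimately show "p = q" by (rule prod_eqI[rotated])
  qed
  have term_le: "val (snd p) \<le> norm (kk p) * (norm (fcoef (\<lambda>x. complex_of_real (?u x)) (kk p)))\<^sup>2" if p: "p \<in> ?P" for p
  proof -
    define j where "j = 2 * snd p + 1"
    have j: "0 < real j" by (simp add: j_def)
    have sg: "fst p = 1 \<or> fst p = - 1" using p by auto
    define b where "b = integral {0..pi / 2} (\<lambda>y. tanh (A * sin y) * sin (real j * y))"
    have kx: "kk p \<bullet> x = of_int (fst p) * (real j * (2 * pi * real N * x $ 1))" for x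
      by (simp add: kk_def inner_axis' j_def)
    have nk: "norm (kk p) = 2 * pi * real N * real j"
    proof -
      have "kk p = (of_int (fst p) * (2 * pi * real N * real j)) *\<^sub>R axis 1 1"
        by (simp add: kk_def vec_eq_iff axis_def j_def)
      then have "norm (kk p) = \<bar>of_int (fst p) * (2 * pi * real N * real j)\<bar>"
        by (simp add: norm_axis_1)
      then show ?thesis using sg by auto
    qed
    have "tint (\<lambda>x. ?u x * sin (kk p \<bullet> x))
        = of_int (fst p) * tint (\<lambda>x. ?u x * sin (real j * (2 * pi * real N * x $ 1)))"
      unfolding kx using sg by auto
    also have "\<dots> = of_int (fst p) * (2 / pi * b)"
      unfolding j_def b_def stripes_fcoef[OF N] ..
    finally have I: "tint (\<lambda>x. ?u x * sin (kk p \<bullet> x)) = of_int (fst p) * (2 / pi * b)" .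
    have "Im (fcoef (\<lambda>x. complex_of_real (?u x)) (kk p)) = - (of_int (fst p) * (2 / pi * b))"
      unfolding fcoef_real[OF H(1)] complex.sel I ..
    then have "(Im (fcoef (\<lambda>x. complex_of_real (?u x)) (kk p)))\<^sup>2 = (2 / pi * b)\<^sup>2"
      using sg by (auto simp: power2_eq_square)
    then have im: "(2 / pi * b)\<^sup>2 \<le> (norm (fcoef (\<lambda>x. complex_of_real (?u x)) (kk p)))\<^sup>2"
      by (simp add: cmod_power2)
    have b: "1 / real j - 4 / A \<le> b" unfolding b_def j_def by (rule stripes_quarter_integral[OF A])
    \<comment> \<open>This is the square of \<open>1 / real j - 4 / A\<close> without its last term.
      The weaker bound is linear in \<open>1 / A\<close> after multiplication by \<open>j\<close>,
      and it stays true when \<open>1 / real j < 4 / A\<close>, where its left side is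
      negative.\<close>
    have "1 / real j * (1 / real j - 8 / A) \<le> b\<^sup>2"
    proof (cases "0 \<le> 1 / real j - 4 / A")
      case True
      then have "(1 / real j - 4 / A)\<^sup>2 \<le> b\<^sup>2" using b by (intro power_mono)
      moreover have "(1 / real j - 4 / A)\<^sup>2 = 1 / real j * (1 / real j - 8 / A) + (4 / A)\<^sup>2"
        by (simp add: power2_eq_square algebra_simps)
      ultimately show ?thesis using zero_le_power2[of "4 / A"] by linarith
    next
      case False
      have "0 < 4 / A" using A by simp
      moreover have "8 / A = 4 / A + 4 / A" by simp
      ultimately have "1 / real j - 8 / A \<le> 0" using False by linarith
      then have "1 / real j * (1 / real j - 8 / A) \<le> 0" using j by (intro mult_nonneg_nonpos) auto
      then show ?thesis using zero_le_power2[of b] by linarith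
    qed
    then have "real j * (1 / real j * (1 / real j - 8 / A)) \<le> real j * b\<^sup>2"
      using j by (intro mult_left_mono) auto
    then have jb: "1 / real j - 8 / A \<le> real j * b\<^sup>2" using j by simp
    have "val (snd p) = 8 * real N / pi * (1 / real j - 8 / A)" by (simp add: val_def j_def)
    also have "\<dots> \<le> 8 * real N / pi * (real j * b\<^sup>2)"
      by (intro mult_left_mono jb) simp
    also have "\<dots> = norm (kk p) * (2 / pi * b)\<^sup>2"
      unfolding nk by (simp add: power2_eq_square)
    also have "\<dots> \<le> norm (kk p) * (norm (fcoef (\<lambda>x. complex_of_real (?u x)) (kk p)))\<^sup>2"
      by (intro mult_left_mono im) simp
    finally show ?thesis .
  qed
  have "16 * real N / pi * (\<Sum>i<n. 1 / real (2 * i + 1) - 8 / A) = 2 * (\<Sum>i<n. val i)"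
    unfolding val_def sum_distrib_left[symmetric] by simp
  also have "\<dots> = (\<Sum>p\<in>?P. val (snd p))"
    using sum.cartesian_product[of "\<lambda>_ i. val i" "{..<n}" "{1, - 1 :: int}"] by (simp add: case_prod_beta)
  also have "\<dots> \<le> (\<Sum>p\<in>?P. norm (kk p) * (norm (fcoef (\<lambda>x. complex_of_real (?u x)) (kk p)))\<^sup>2)"
    by (rule sum_mono) (rule term_le)
  also have "\<dots> = (\<Sum>k\<in>kk ` ?P. norm k * (norm (fcoef (\<lambda>x. complex_of_real (?u x)) k))\<^sup>2)"
    using inj by (subst sum.reindex) (auto simp: o_def)
  also have "\<dots> \<le> half_gradient_energy ?u"
  proof (rule finite_sum_le_has_sum[OF hs])
    show "kk ` ?P \<subseteq> dual_lattice" by (auto simp only: kk_def dual_axis)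
  qed auto
  finally show ?thesis .
qed

lemma stripes_half_gradient_ge:
  assumes N: "0 < N" and A: "1 \<le> A"
  shows "8 * real N / pi * (ln A - 32) \<le> half_gradient_energy (\<lambda>x. stripes A N x $ 3)"
proof -
  \<comment> \<open>About \<open>A\<close> terms are enough for the full \<open>ln A / 2\<close>,
    while their errors \<open>8 / A\<close> add up to at most 16.\<close>
  define n where "n = nat \<lceil>A\<rceil>"
  have n: "A \<le> real n" "real n \<le> A + 1" unfolding n_def using A by linarith+
  have "ln A / 2 \<le> ln (real n) / 2" using n A by simp
  also have "\<dots> \<le> (\<Sum>i<n. 1 / real (2 * i + 1))" by (rule sum_odd_reciprocal_ge)
  finally have s: "ln A / 2 \<le> (\<Sum>i<n. 1 / real (2 * i + 1))" .
  have "real n * (8 / A) \<le> (A + 1) * (8 / A)" using n A by (intro mult_right_mono) auto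
  also have "\<dots> \<le> 16" using A by (simp add: field_simps)
  finally have "ln A / 2 - 16 \<le> (\<Sum>i<n. 1 / real (2 * i + 1) - 8 / A)"
    using s by (simp add: sum_subtractf)
  then have "16 * real N / pi * (ln A / 2 - 16) \<le> 16 * real N / pi * (\<Sum>i<n. 1 / real (2 * i + 1) - 8 / A)"
    by (intro mult_left_mono) auto
  also have "\<dots> \<le> half_gradient_energy (\<lambda>x. stripes A N x $ 3)"
    using A by (intro stripes_half_gradient_sum N) simp
  also have "16 * real N / pi * (ln A / 2 - 16) = 8 * real N / pi * (ln A - 32)" by (simp add: field_simps)
  finally show ?thesis .
qed

text \<open>The summand 32 is the loss in \<open>stripes_half_gradient_ge\<close>. The summand 32
  \<pi> covers the wall error 16/A, as 1/A \<le> 2 \<pi> k / \<open>lambda_c\<close> with k =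
  \<lambda>/|ln \<epsilon>|.\<close>

definition stripes_const :: real where
  "stripes_const = 32 + 32 * pi"

text \<open>With k = \<lambda>/|ln \<epsilon>| one has ln A = \<open>lambda_c\<close> / k - ln (2
  \<pi> N / S), so the main part of the nonlocal energy cancels the wall energy 4 N. What remains is
  of order k N with a sign governed by N / S.\<close>

lemma stripes_energy_le:
  assumes r: "regime (1 / 4) K \<epsilon> l" "1 < K" and N: "0 < N" "real N \<le> perimeter_scale \<epsilon> l"
  shows "energy \<epsilon> l (stripes (1 / (2 * pi * real N * \<epsilon>)) N)
    \<le> 4 * real N * (l / \<bar>ln \<epsilon>\<bar> / lambda_c * (ln (2 * pi * real N / perimeter_scale \<epsilon> l) + stripes_const))"
proof -
  have q: "(1 / 4 :: real) \<le> 1 / 2" by simp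
  note R = regimeD[OF r(1) q r(2)]
  define \<Lambda> where "\<Lambda> = \<bar>ln \<epsilon>\<bar>"
  define k where "k = l / \<Lambda>"
  define S where "S = perimeter_scale \<epsilon> l"
  define A where "A = 1 / (2 * pi * real N * \<epsilon>)"
  have eps: "0 < \<epsilon>" "\<epsilon> < 1" using R by auto
  have \<Lambda>: "0 < \<Lambda>" "ln \<epsilon> = - \<Lambda>" using eps by (simp_all add: \<Lambda>_def)
  have l0: "0 < l" using R by simp
  have k: "0 < k" "k < 1 / 4" "l = k * \<Lambda>"
    using R \<Lambda> l0 unfolding k_def \<Lambda>_def by (auto simp: divide_less_eq)
  have lc: "0 < lambda_c" by (rule lambda_c_pos)
  have S: "S = exp (\<Lambda> * ((l - lambda_c) / l))" "0 < S"
    using perimeter_scale_exp[OF eps, of l] by (simp_all add: S_def \<Lambda>_def)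
  have lnS: "ln S = \<Lambda> - lambda_c / k"
  proof -
    have "ln S = \<Lambda> * ((l - lambda_c) / l)" by (simp add: S)
    also have "\<dots> = \<Lambda> - \<Lambda> * lambda_c / l" using l0 by (simp add: field_simps)
    also have "\<Lambda> * lambda_c / l = lambda_c / k" unfolding k(3) using \<Lambda> by simp
    finally show ?thesis .
  qed
  have lnA: "ln A = \<Lambda> - ln (2 * pi * real N)"
    unfolding A_def using N eps \<Lambda> by (simp add: ln_div ln_mult)
  have A0: "0 < A" unfolding A_def using N eps by simp
  have inv: "1 / A \<le> 2 * pi * k / lambda_c"
  proof -
    have "1 / A = 2 * pi * (real N * \<epsilon>)" by (simp add: A_def)
    also have "\<dots> \<le> 2 * pi * (S * \<epsilon>)"
      using N eps by (intro mult_left_mono mult_right_mono) (auto simp: S_def)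
    \<comment> \<open>Up to constants this bounds the wall width relative to the stripe width. It is
      exponentially small in \<open>1 / k\<close>, but a bound linear in \<open>k\<close> suffices,
      the remainder being of order \<open>k\<close> anyway.\<close>
    also have "S * \<epsilon> = exp (- (lambda_c / k))"
    proof -
      have "S * \<epsilon> = exp (ln S + ln \<epsilon>)" using S(2) eps by (simp add: exp_add)
      then show ?thesis by (simp add: lnS \<Lambda>)
    qed
    also have "exp (- (lambda_c / k)) \<le> k / lambda_c"
    proof -
      have "lambda_c / k \<le> exp (lambda_c / k)" using exp_ge_add_one_self[of "lambda_c / k"] by linarith
      then have "inverse (exp (lambda_c / k)) \<le> inverse (lambda_c / k)"
        using lc k by (intro le_imp_inverse_le) auto
      then show ?thesis by (simp add: exp_minus)
    qed
    finally show ?thesis by simp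
  qed
  \<comment> \<open>The left side is \<open>4 * k\<close>, which is where the value 1/4 for \<delta>
    comes from.\<close>
  have "2 * pi * k / lambda_c \<le> 1" unfolding lambda_c_def using k by simp
  with inv have "1 / A \<le> 1" by linarith
  then have A1: "1 \<le> A" using A0 by (simp add: divide_le_eq)
  have Ae: "2 * pi * real N * A = 1 / \<epsilon>" unfolding A_def using N by simp
  have E: "local_energy \<epsilon> (stripes A N) \<le> 4 * real N * (1 + 16 / A)"
    by (rule stripes_local_energy_le[OF N(1) eps(1) Ae A0])
  have "k * (8 * real N / pi * (ln A - 32)) \<le> nonlocal_energy \<epsilon> l (stripes A N)"
    unfolding nonlocal_energy_def \<Lambda>_def[symmetric] k_def[symmetric]
    using k by (intro mult_left_mono stripes_half_gradient_ge N A1) auto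
  also have "k * (8 * real N / pi * (ln A - 32)) = 4 * real N * (k / lambda_c * (ln A - 32))"
    by (simp add: lambda_c_def)
  finally have "energy \<epsilon> l (stripes A N) \<le> 4 * real N * (1 + 16 / A) - 4 * real N * (k / lambda_c * (ln A - 32))"
    using E by (simp add: energy_def)
  also have "\<dots> = 4 * real N * (1 + 16 * (1 / A) - k / lambda_c * (ln A - 32))" by (simp add: algebra_simps)
  also have "\<dots> \<le> 4 * real N * (k / lambda_c * (ln (2 * pi * real N / S) + stripes_const))"
  proof (rule mult_left_mono)
    have "ln A = lambda_c / k - ln (2 * pi * real N / S)"
      using lnA lnS S(2) N by (simp add: ln_div)
    then have "k / lambda_c * (ln A - 32) = k / lambda_c * (lambda_c / k) - k / lambda_c * ln (2 * pi * real N / S) - k / lambda_c * 32"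
      by (simp only: right_diff_distrib)
    moreover have "k / lambda_c * (lambda_c / k) = 1" using k lc by simp
    moreover have "16 * (1 / A) \<le> k / lambda_c * (32 * pi)"
    proof -
      have "k / lambda_c * (32 * pi) = 16 * (2 * pi * k / lambda_c)" by simp
      then show ?thesis using inv by linarith
    qed
    ultimately show "1 + 16 * (1 / A) - k / lambda_c * (ln A - 32) \<le> k / lambda_c * (ln (2 * pi * real N / S) + stripes_const)"
      unfolding stripes_const_def distrib_left by linarith
  qed simp
  finally show ?thesis unfolding A_def S_def k_def \<Lambda>_def .
qed

text \<open>Chosen such that ln (2 \<pi> \<open>stripes_density\<close>) +
  \<open>stripes_const\<close> = -1. This makes the bound in \<open>stripes_energy_le\<close>
  negative when N is close to \<open>stripes_density\<close> times the perimeter scale.\<close>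

definition stripes_density :: real where
  "stripes_density = exp (- (1 + stripes_const)) / (2 * pi)"

lemma stripes_density_pos: "0 < stripes_density"
  by (simp add: stripes_density_def)

lemma stripes_density_lt_1: "stripes_density < 1"
proof -
  have "exp (- (1 + stripes_const)) \<le> 1" using pi_gt3 by (simp add: stripes_const_def)
  moreover have "1 < 2 * pi" using pi_gt3 by simp
  ultimately have "exp (- (1 + stripes_const)) < 2 * pi" by linarith
  then show ?thesis unfolding stripes_density_def by (subst pos_divide_less_eq) simp_all
qed

lemma energy_upper_bound:
  assumes r: "regime (1 / 4) (1 / stripes_density) \<epsilon> l"
  obtains m where "m \<in> H1_torus_sphere"
    "energy \<epsilon> l m \<le> - (2 * stripes_density / lambda_c) * energy_scale \<epsilon> l"
proof -
  let ?\<eta> = stripes_density and ?S = "perimeter_scale \<epsilon> l"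
  have K: "1 < 1 / ?\<eta>" using stripes_density_pos stripes_density_lt_1 by simp
  have q: "(1 / 4 :: real) \<le> 1 / 2" by simp
  note R = regimeD[OF r q K]
  define k where "k = l / \<bar>ln \<epsilon>\<bar>"
  have "0 < k" using R(9) by (simp only: k_def)
  then have k0: "0 < k / lambda_c" using lambda_c_pos by (rule divide_pos_pos)
  have S: "0 < ?S" using R by (simp add: perimeter_scale_pos)
  have \<eta>S: "1 < ?\<eta> * ?S" using R(8) stripes_density_pos by (simp add: divide_less_eq mult.commute)
  \<comment> \<open>As K is the inverse of \<open>stripes_density\<close>, the number rounded down
    exceeds 1, so at least one stripe fits and rounding loses less than half.\<close>
  define N where "N = nat \<lfloor>?\<eta> * ?S\<rfloor>"
  have N: "real N \<le> ?\<eta> * ?S" "?\<eta> * ?S / 2 \<le> real N" "0 < N"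
  proof -
    have "1 \<le> \<lfloor>?\<eta> * ?S\<rfloor>" using \<eta>S by linarith
    then have rN: "real N = of_int \<lfloor>?\<eta> * ?S\<rfloor>" unfolding N_def by simp
    have r1: "(1::real) \<le> of_int \<lfloor>?\<eta> * ?S\<rfloor>" using \<eta>S by simp
    show "real N \<le> ?\<eta> * ?S" "?\<eta> * ?S / 2 \<le> real N"
      using rN r1 of_int_floor_le[of "?\<eta> * ?S"] real_of_int_floor_add_one_gt[of "?\<eta> * ?S"] by linarith+
    have "0 < real N" using rN r1 by linarith
    then show "0 < N" by simp
  qed
  have "?\<eta> * ?S \<le> 1 * ?S" using stripes_density_lt_1 S by (intro mult_right_mono) auto
  then have NS: "real N \<le> ?S" using N by linarith
  have "2 * pi * real N / ?S \<le> 2 * pi * ?\<eta>"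
    using N(1) S by (simp add: divide_le_eq)
  then have "ln (2 * pi * real N / ?S) \<le> ln (2 * pi * ?\<eta>)"
    using N S stripes_density_pos by (subst ln_le_cancel_iff) auto
  also have "2 * pi * ?\<eta> = exp (- (1 + stripes_const))" by (simp add: stripes_density_def)
  finally have "ln (2 * pi * real N / ?S) + stripes_const \<le> - 1" by simp
  then have "k / lambda_c * (ln (2 * pi * real N / ?S) + stripes_const) \<le> k / lambda_c * - 1"
    using k0 by (intro mult_left_mono) auto
  then have "4 * real N * (k / lambda_c * (ln (2 * pi * real N / ?S) + stripes_const)) \<le> 4 * real N * (k / lambda_c * - 1)"
    by (rule mult_left_mono) simp
  also have "\<dots> = (- (4 * (k / lambda_c))) * real N" by simp
  also have "\<dots> \<le> (- (4 * (k / lambda_c))) * (?\<eta> * ?S / 2)"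
    using N(2) k0 by (intro mult_left_mono_neg) auto
  also have "\<dots> = - (2 * ?\<eta> / lambda_c) * energy_scale \<epsilon> l"
    by (simp add: energy_scale_eq k_def)
  finally have "energy \<epsilon> l (stripes (1 / (2 * pi * real N * \<epsilon>)) N) \<le> - (2 * ?\<eta> / lambda_c) * energy_scale \<epsilon> l"
    using stripes_energy_le[OF r K N(3) NS] unfolding k_def by linarith
  then show thesis using that stripes_H1 by blast
qed

section \<open>The minimal energy and the scaling law\<close>

lemma F_energy_H1: "m \<in> H1_torus_sphere \<Longrightarrow> F_energy \<epsilon> l m = ereal (energy \<epsilon> l m)"
  by (simp add: F_energy_def energy_def)

text \<open>The lower bound is coercivity with a nonnegative local energy. The stripes give the
  upper bound and also the admissible map that the direct method starts from.\<close>

lemma minimal_energy_bounds: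
  assumes r: "regime (1 / 4) (1 / stripes_density) \<epsilon> l"
  shows "\<exists>m\<^sub>0. is_arg_min (F_energy \<epsilon> l) (\<lambda>m. m \<in> L1_torus_sphere) m\<^sub>0 \<and>
    ereal (- coercivity_const * energy_scale \<epsilon> l) \<le> F_energy \<epsilon> l m\<^sub>0 \<and>
    F_energy \<epsilon> l m\<^sub>0 \<le> ereal (- min 1 (2 * stripes_density / lambda_c) * energy_scale \<epsilon> l)"
proof -
  have K: "1 < 1 / stripes_density" using stripes_density_pos stripes_density_lt_1 by simp
  have q: "(1 / 4 :: real) \<le> 1 / 2" by simp
  note R = regimeD[OF r q K]
  have k: "0 < l / \<bar>ln \<epsilon>\<bar>" using R by simp
  have S: "0 < perimeter_scale \<epsilon> l" using R by (simp add: perimeter_scale_pos)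
  have es: "0 < energy_scale \<epsilon> l" unfolding energy_scale_eq using k S by (rule mult_pos_pos)
  have ln2: "l < 1 / 2 * \<bar>ln \<epsilon>\<bar>" using R by simp
  obtain m where m: "m \<in> H1_torus_sphere" "energy \<epsilon> l m \<le> - (2 * stripes_density / lambda_c) * energy_scale \<epsilon> l"
    by (rule energy_upper_bound[OF r])
  have ne: "H1_torus_sphere \<noteq> {}" using m by auto
  obtain w where w: "w \<in> H1_torus_sphere" "\<And>m. m \<in> H1_torus_sphere \<Longrightarrow> energy \<epsilon> l w \<le> energy \<epsilon> l m"
    by (rule energy_minimizer_exists[OF R(1,2,3) ln2 ne]) blast
  have "is_arg_min (F_energy \<epsilon> l) (\<lambda>m. m \<in> L1_torus_sphere) w"
    unfolding is_arg_min_def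
  proof (intro conjI notI)
    show "w \<in> L1_torus_sphere" by (rule H1_sphere_L1[OF w(1)])
    assume "\<exists>y. y \<in> L1_torus_sphere \<and> F_energy \<epsilon> l y < F_energy \<epsilon> l w"
    then obtain y where y: "F_energy \<epsilon> l y < F_energy \<epsilon> l w" by blast
    \<comment> \<open>The functional is infinite elsewhere, so a strictly better competitor has to
      lie in H1.\<close>
    have "y \<in> H1_torus_sphere"
      using y unfolding F_energy_H1[OF w(1)] by (auto simp: F_energy_def split: if_splits)
    then show False using y w by (simp add: F_energy_H1 not_le[symmetric])
  qed
  moreover have "- coercivity_const * energy_scale \<epsilon> l \<le> energy \<epsilon> l w"
  proof -
    have "0 \<le> local_energy \<epsilon> w"
      using total_variation_le_local_energy[OF w(1) R(1)] total_variation_nonneg[of w] by linarith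
    then have "l / \<bar>ln \<epsilon>\<bar> * (0 - coercivity_const * perimeter_scale \<epsilon> l)
        \<le> l / \<bar>ln \<epsilon>\<bar> * (local_energy \<epsilon> w - coercivity_const * perimeter_scale \<epsilon> l)"
      by (intro mult_left_mono less_imp_le[OF k]) simp
    then show ?thesis
      using energy_coercive[OF w(1) R(1,2,3) ln2] by (simp add: energy_scale_eq mult_ac)
  qed
  moreover have "energy \<epsilon> l w \<le> - min 1 (2 * stripes_density / lambda_c) * energy_scale \<epsilon> l"
  proof -
    have "min 1 (2 * stripes_density / lambda_c) * energy_scale \<epsilon> l \<le> (2 * stripes_density / lambda_c) * energy_scale \<epsilon> l"
      using es by (intro mult_right_mono) auto
    then show ?thesis using w(2)[OF m(1)] m(2) by linarith
  qed
  ultimately show ?thesis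
    using F_energy_H1[OF w(1)] by auto
qed

theorem theorem3p6:
  "\<exists>\<delta> K c C :: real.
     0 < \<delta> \<and> \<delta> < 1 \<and> 1 < K \<and> 0 < c \<and> c < C \<and>
     (\<forall>\<epsilon> l. regime \<delta> K \<epsilon> l \<longrightarrow>
        (\<exists>m\<^sub>0. is_arg_min (F_energy \<epsilon> l) (\<lambda>m. m \<in> L1_torus_sphere) m\<^sub>0 \<and>
           ereal (- C * energy_scale \<epsilon> l) \<le> F_energy \<epsilon> l m\<^sub>0 \<and>
           F_energy \<epsilon> l m\<^sub>0 \<le> ereal (- c * energy_scale \<epsilon> l))) \<and>
     (\<forall>\<gamma>>0. \<exists>c\<^sub>\<gamma> C\<^sub>\<gamma> C'\<^sub>\<gamma> :: real.
        0 < c\<^sub>\<gamma> \<and> 0 < C\<^sub>\<gamma> \<and> 0 < C'\<^sub>\<gamma> \<and>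
        (\<forall>\<epsilon> l. regime \<delta> K \<epsilon> l \<longrightarrow>
           (\<forall>m\<in>H1_torus_sphere. F_energy \<epsilon> l m \<le> ereal (- \<gamma> * energy_scale \<epsilon> l) \<longrightarrow>
              total_variation_m3 m \<le> local_energy \<epsilon> m \<and>
              local_energy \<epsilon> m \<le> nonlocal_energy \<epsilon> l m \<and>
              (\<forall>A\<in>{total_variation_m3 m, local_energy \<epsilon> m, nonlocal_energy \<epsilon> l m}.
               \<forall>B\<in>{total_variation_m3 m, local_energy \<epsilon> m, nonlocal_energy \<epsilon> l m}.
                 c\<^sub>\<gamma> * perimeter_scale \<epsilon> l \<le> A \<and> A \<le> C\<^sub>\<gamma> * perimeter_scale \<epsilon> l \<and>
                 \<bar>A - B\<bar> \<le> C'\<^sub>\<gamma> * (l / \<bar>ln \<epsilon>\<bar>) * A))))"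
proof -
  \<comment> \<open>The minimum with 1 secures c < C, because \<open>coercivity_const\<close> is at
    least 2.\<close>
  let ?K = "1 / stripes_density" and ?c = "min 1 (2 * stripes_density / lambda_c)"
  have K: "1 < ?K" using stripes_density_pos stripes_density_lt_1 by simp
  have q: "(1 / 4 :: real) \<le> 1 / 2" by simp
  have C2: "2 \<le> coercivity_const" by (rule coercivity_const_ge_2)
  show ?thesis
  proof (rule exI[of _ "1 / 4"], rule exI[of _ ?K], rule exI[of _ ?c], rule exI[of _ coercivity_const], intro conjI)
    show "(0::real) < 1 / 4" "(1 / 4 :: real) < 1" by simp_all
    show "1 < ?K" by (rule K)
    show "0 < ?c" using stripes_density_pos lambda_c_pos by simp
    show "?c < coercivity_const" using C2 by linarith
    show "\<forall>\<epsilon> l. regime (1 / 4) ?K \<epsilon> l \<longrightarrow>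
      (\<exists>m\<^sub>0. is_arg_min (F_energy \<epsilon> l) (\<lambda>m. m \<in> L1_torus_sphere) m\<^sub>0 \<and>
        ereal (- coercivity_const * energy_scale \<epsilon> l) \<le> F_energy \<epsilon> l m\<^sub>0 \<and>
        F_energy \<epsilon> l m\<^sub>0 \<le> ereal (- ?c * energy_scale \<epsilon> l))"
      using minimal_energy_bounds by blast
  next
    show "\<forall>\<gamma>>0. \<exists>c\<^sub>\<gamma> C\<^sub>\<gamma> C'\<^sub>\<gamma> :: real.
        0 < c\<^sub>\<gamma> \<and> 0 < C\<^sub>\<gamma> \<and> 0 < C'\<^sub>\<gamma> \<and>
        (\<forall>\<epsilon> l. regime (1 / 4) ?K \<epsilon> l \<longrightarrow>
           (\<forall>m\<in>H1_torus_sphere. F_energy \<epsilon> l m \<le> ereal (- \<gamma> * energy_scale \<epsilon> l) \<longrightarrow>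
              total_variation_m3 m \<le> local_energy \<epsilon> m \<and>
              local_energy \<epsilon> m \<le> nonlocal_energy \<epsilon> l m \<and>
              (\<forall>A\<in>{total_variation_m3 m, local_energy \<epsilon> m, nonlocal_energy \<epsilon> l m}.
               \<forall>B\<in>{total_variation_m3 m, local_energy \<epsilon> m, nonlocal_energy \<epsilon> l m}.
                 c\<^sub>\<gamma> * perimeter_scale \<epsilon> l \<le> A \<and> A \<le> C\<^sub>\<gamma> * perimeter_scale \<epsilon> l \<and>
                 \<bar>A - B\<bar> \<le> C'\<^sub>\<gamma> * (l / \<bar>ln \<epsilon>\<bar>) * A)))"
    proof (intro allI impI)
      fix \<gamma> :: real assume \<gamma>: "\<gamma> > 0"
      let ?C = "2 * coercivity_const" and ?c' = "scaling_lower \<gamma>"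
      \<comment> \<open>The gap between the quantities is bounded by a multiple of the perimeter
        scale; dividing by the lower constant \<open>?c'\<close> expresses it through
        \<open>A\<close>.\<close>
      let ?D = "(3 * coercivity_const + 4) / ?c'"
      have c': "0 < ?c'" by (rule scaling_lower_pos[OF \<gamma>])
      show "\<exists>c\<^sub>\<gamma> C\<^sub>\<gamma> C'\<^sub>\<gamma> :: real.
        0 < c\<^sub>\<gamma> \<and> 0 < C\<^sub>\<gamma> \<and> 0 < C'\<^sub>\<gamma> \<and>
        (\<forall>\<epsilon> l. regime (1 / 4) ?K \<epsilon> l \<longrightarrow>
           (\<forall>m\<in>H1_torus_sphere. F_energy \<epsilon> l m \<le> ereal (- \<gamma> * energy_scale \<epsilon> l) \<longrightarrow>
              total_variation_m3 m \<le> local_energy \<epsilon> m \<and>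
              local_energy \<epsilon> m \<le> nonlocal_energy \<epsilon> l m \<and>
              (\<forall>A\<in>{total_variation_m3 m, local_energy \<epsilon> m, nonlocal_energy \<epsilon> l m}.
               \<forall>B\<in>{total_variation_m3 m, local_energy \<epsilon> m, nonlocal_energy \<epsilon> l m}.
                 c\<^sub>\<gamma> * perimeter_scale \<epsilon> l \<le> A \<and> A \<le> C\<^sub>\<gamma> * perimeter_scale \<epsilon> l \<and>
                 \<bar>A - B\<bar> \<le> C'\<^sub>\<gamma> * (l / \<bar>ln \<epsilon>\<bar>) * A)))"
      proof (rule exI[of _ ?c'], rule exI[of _ ?C], rule exI[of _ ?D], intro conjI allI impI ballI)
        show "0 < ?c'" by (rule c')
        show "0 < ?C" using C2 by simp
        show "0 < ?D" using C2 c' by (intro divide_pos_pos) auto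
      next
        fix \<epsilon> l m
        assume r: "regime (1 / 4) ?K \<epsilon> l" and m: "m \<in> H1_torus_sphere"
          and F: "F_energy \<epsilon> l m \<le> ereal (- \<gamma> * energy_scale \<epsilon> l)"
        have "energy \<epsilon> l m \<le> - \<gamma> * energy_scale \<epsilon> l" using F by (simp add: F_energy_H1[OF m])
        note b = scaling_bounds[OF r q K \<gamma> m this]
        show "total_variation_m3 m \<le> local_energy \<epsilon> m" "local_energy \<epsilon> m \<le> nonlocal_energy \<epsilon> l m"
          by (rule b(1), rule b(2))
        fix A B
        assume A: "A \<in> {total_variation_m3 m, local_energy \<epsilon> m, nonlocal_energy \<epsilon> l m}"
        then show lo: "?c' * perimeter_scale \<epsilon> l \<le> A" and "A \<le> ?C * perimeter_scale \<epsilon> l"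
          using b(1,2,3,4) by auto
        assume B: "B \<in> {total_variation_m3 m, local_energy \<epsilon> m, nonlocal_energy \<epsilon> l m}"
        define k where "k = l / \<bar>ln \<epsilon>\<bar>"
        have k: "0 < k" using regimeD(9)[OF r q K] by (simp only: k_def)
        have "\<bar>A - B\<bar> \<le> k * ((3 * coercivity_const + 4) * perimeter_scale \<epsilon> l)"
          using A B b(1,2,5) unfolding k_def[symmetric] by auto
        also have "\<dots> = ?D * k * (?c' * perimeter_scale \<epsilon> l)" using c' by simp
        also have "\<dots> \<le> ?D * k * A"
          using k c' C2 by (intro mult_left_mono lo mult_nonneg_nonneg divide_nonneg_nonneg) auto
        finally show "\<bar>A - B\<bar> \<le> ?D * (l / \<bar>ln \<epsilon>\<bar>) * A" unfolding k_def .
      qed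
    qed
  qed
qed

end
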